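(* Let $s\in\mathbb{N}$, and let $c_s>0$ be a number such that $c_s/(n+|k|)^s\le\tilde e(n,k,s)$ for all $k\in\mathbb{Z}$ and $n\in\mathbb{N}$. Consider the absolute error criterion for the integration problem $I_k$ over the space $H^s$. (a) For $k=0$ and all $\varepsilon\in(0,1)$ we have $$c_s^{1/s}\left(\frac1\varepsilon\right)^{1/s}\le n^{\rm abs}(\varepsilon,0,s)\le\left\lceil\frac3{2\pi}\left(\frac2\varepsilon\right)^{1/s}\right\rceil+2s-1.$$ (b) For $k\in\mathbb{Z}$, $k\ne0$, and $\varepsilon\in[\beta_{k,s}/(2\pi|k|),1)$ we have $n^{\rm abs}(\varepsilon,k,s)=0$, whereas for $\varepsilon\in(0,\beta_{k,s}/(2\pi|k|))$ we have $$c_s^{1/s}\left(\frac1\varepsilon\right)^{1/s}-|k|\le n^{\rm abs}(\varepsilon,k,s)\le2s+\max\left\{0,\left\lceil\frac3{2\pi}\left(\frac2\varepsilon\right)^{1/s}\right\rceil-1-|k|\right\}.$$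
   Context: For $s\in\mathbb{N}=\{1,2,\dots\}$ let $H^s=\{f:[0,1]\to\mathbb{C} : f^{(s-1)}\text{ is absolutely continuous},\ f^{(s)}\in L_2([0,1])\}$ with inner product $$\langle f,g\rangle_s=\sum_{\ell=0}^{s-1}\int_0^1 f^{(\ell)}(x)\,dx\ \int_0^1\overline{g^{(\ell)}(x)}\,dx+\int_0^1 f^{(s)}(x)\,\overline{g^{(s)}(x)}\,dx$$ and norm $\|f\|_{H^s}=\langle f,f\rangle_s^{1/2}$. The periodic subspace is $\widetilde H^s=\{f\in H^s : f^{(\ell)}(0)=f^{(\ell)}(1)\text{ for }\ell=0,\dots,s-1\}$ with the same inner product. For $k\in\mathbb{Z}$, $I_k(f)=\int_0^1 f(x)\,e^{-2\pi i kx}\,dx$. Algorithms using $n$ values have the form $A_n(f)=\sum_{j=1}^n a_j f^{(\ell_j)}(x_j)$ with $a_j\in\mathbb{C}$, $\ell_j\in\{0,\dots,s-1\}$, $x_j\in[0,1]$; for $n=0$ the only algorithm is $A_0=0$. Set $$e(n,k,s)=\inf_{A_n}\ \sup_{f\in H^s,\ \|f\|_{H^s}\le1}|I_k(f)-A_n(f)|,\qquad \tilde e(n,k,s)=\inf_{A_n}\ \sup_{f\in\widetilde H^s,\ \|f\|_{H^s}\le1}|I_k(f)-A_n(f)|.$$ A number $c_s>0$ depending only on $s$ with $c_s/(n+|k|)^s\le\tilde e(n,k,s)$ for all $k\in\mathbb{Z}$, $n\in\mathbb{N}$ is known to exist. The information complexity for the absolute error criterion is $n^{\rm abs}(\varepsilon,k,s)=\min\{n\in\{0,1,2,\dots\}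 : e(n,k,s)\le\varepsilon\}$. For $k\neq0$, $\beta_{k,1}=\sqrt2$ and $\beta_{k,s}=\sqrt{\frac{(2\pi k)^{2s}+(2\pi k)^2-2}{(2\pi k)^{2s}-(2\pi k)^{2(s-1)}}}$ for $s>1$ (so that $e(0,k,s)=\beta_{k,s}/(2\pi|k|)$). *)

theory Defs
  imports "HOL-Analysis.Analysis"
begin

definition absolutely_continuous_on :: "real \<Rightarrow> real \<Rightarrow> (real \<Rightarrow> complex) \<Rightarrow> bool" where
  "absolutely_continuous_on a b f \<longleftrightarrow>
     (\<forall>\<epsilon>>0. \<exists>\<delta>>0. \<forall>(n::nat) u v.
        (\<forall>i<n. a \<le> u i \<and> u i \<le> v i \<and> v i \<le> b) \<and>
        disjoint_family_on (\<lambda>i. {u i<..<v i}) {..<n} \<and>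
        (\<Sum>i<n. v i - u i) < \<delta> \<longrightarrow>
        (\<Sum>i<n. cmod (f (v i) - f (u i))) < \<epsilon>)"

text \<open>
  A function on $[0,1]$ is represented by a function on all of \<^typ>\<open>real\<close> whose values outside
  $[0,1]$ are irrelevant: derivatives are taken within $[0,1]$ (one-sided at the end points) and
  evaluated only there. Where a derivative does not exist, its value is arbitrary; in the space
  below this can only concern the derivative of order \<open>s\<close>, on a null set.
\<close>

primrec deriv01 :: "nat \<Rightarrow> (real \<Rightarrow> complex) \<Rightarrow> real \<Rightarrow> complex" where
  "deriv01 0 f = f"
| "deriv01 (Suc l) f = (\<lambda>x. vector_derivative (deriv01 l f) (at x within {0..1}))"

definition square_integrable01 :: "(real \<Rightarrow> complex) \<Rightarrow> bool" where
  "square_integrable01 g \<longleftrightarrow>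
     g \<in> borel_measurable (lebesgue_on {0..1}) \<and>
     integrable (lebesgue_on {0..1}) (\<lambda>x. (cmod (g x))\<^sup>2)"

definition sobolev :: "nat \<Rightarrow> (real \<Rightarrow> complex) set" where
  "sobolev s = {f.
     (\<forall>l<s - 1. \<forall>x\<in>{0..1}. deriv01 l f differentiable (at x within {0..1})) \<and>
     absolutely_continuous_on 0 1 (deriv01 (s - 1) f) \<and>
     square_integrable01 (deriv01 s f)}"

definition periodic_sobolev :: "nat \<Rightarrow> (real \<Rightarrow> complex) set" where
  "periodic_sobolev s = {f \<in> sobolev s. \<forall>l<s. deriv01 l f 0 = deriv01 l f 1}"

definition sobolev_inner :: "nat \<Rightarrow> (real \<Rightarrow> complex) \<Rightarrow> (real \<Rightarrow> complex) \<Rightarrow> complex" where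
  "sobolev_inner s f g =
     (\<Sum>l<s. (LINT x|lebesgue_on {0..1}. deriv01 l f x) *
              (LINT x|lebesgue_on {0..1}. cnj (deriv01 l g x))) +
     (LINT x|lebesgue_on {0..1}. deriv01 s f x * cnj (deriv01 s g x))"

definition sobolev_norm :: "nat \<Rightarrow> (real \<Rightarrow> complex) \<Rightarrow> real" where
  "sobolev_norm s f = sqrt (Re (sobolev_inner s f f))"

definition fourier_integral :: "int \<Rightarrow> (real \<Rightarrow> complex) \<Rightarrow> complex" where
  "fourier_integral k f =
     (LINT x|lebesgue_on {0..1}. f x * exp (- 2 * of_real pi * \<i> * of_int k * of_real x))"

definition algorithms :: "nat \<Rightarrow> nat \<Rightarrow> ((real \<Rightarrow> complex) \<Rightarrow> complex) set" where
  "algorithms n s = {A. \<exists>(a :: nat \<Rightarrow> complex) (l :: nat \<Rightarrow> nat) (x :: nat \<Rightarrow> real).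
     (\<forall>j\<in>{1..n}. l j < s \<and> x j \<in> {0..1}) \<and>
     A = (\<lambda>f. \<Sum>j=1..n. a j * deriv01 (l j) f (x j))}"

text \<open>
  Errors take values in \<^typ>\<open>ennreal\<close>, so that the supremum and the infimum are meaningful
  without a prior proof of boundedness.
\<close>

definition worst_case_error ::
    "(real \<Rightarrow> complex) set \<Rightarrow> nat \<Rightarrow> int \<Rightarrow> ((real \<Rightarrow> complex) \<Rightarrow> complex) \<Rightarrow> ennreal" where
  "worst_case_error F s k A =
     (SUP f\<in>{f \<in> F. sobolev_norm s f \<le> 1}. ennreal (cmod (fourier_integral k f - A f)))"

definition min_error :: "nat \<Rightarrow> int \<Rightarrow> nat \<Rightarrow> ennreal" where
  "min_error n k s = (INF A\<in>algorithms n s. worst_case_error (sobolev s) s k A)"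

definition min_error_periodic :: "nat \<Rightarrow> int \<Rightarrow> nat \<Rightarrow> ennreal" where
  "min_error_periodic n k s = (INF A\<in>algorithms n s. worst_case_error (periodic_sobolev s) s k A)"

text \<open>
  The minimum over \<open>n\<close>, with value \<open>\<infinity>\<close> if no \<open>n\<close> qualifies; hence a finite upper bound
  also asserts that the minimum exists.
\<close>

definition info_complexity :: "real \<Rightarrow> int \<Rightarrow> nat \<Rightarrow> enat" where
  "info_complexity \<epsilon> k s = (INF n\<in>{n. min_error n k s \<le> ennreal \<epsilon>}. enat n)"

definition beta :: "int \<Rightarrow> nat \<Rightarrow> real" where
  "beta k s =
     (if s = 1 then sqrt 2
      else sqrt (((2 * pi * of_int k) ^ (2 * s) + (2 * pi * of_int k)\<^sup>2 - 2) /
                 ((2 * pi * of_int k) ^ (2 * s) - (2 * pi * of_int k) ^ (2 * (s - 1)))))"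

end

theory Submission
  imports Defs
begin

text \<open>
  Write \<open>w\<^sub>j = 2 \<pi> i j\<close>, let \<open>g\<close> be the derivative of \<open>f\<close> of order \<open>s\<close>, and let \<open>D\<^sub>m\<close> be the difference of the
  values at 1 and 0 of the derivative of order \<open>m\<close>. Integrating by parts \<open>s\<close> times gives, for \<open>j \<noteq> 0\<close>,

    \<open>I\<^sub>j(f) = I\<^sub>j(g) / w\<^sub>j ^ s - (\<Sum>m<s. D\<^sub>m / w\<^sub>j ^ (m + 1))\<close>

  (\<open>fourier_integral_sobolev\<close>). The upper bounds combine this with Poisson summation: the trapezoidal rule
  with \<open>M\<close> panels for the integrand of \<open>I\<^sub>k(f)\<close> is the symmetric sum of all \<open>I\<^sub>j(f)\<close> with \<open>j\<close> congruent to \<open>k\<close>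
  modulo \<open>M\<close> (\<open>fourier_sum_limit\<close>). So its error is the sum over \<open>j \<noteq> k\<close>. Values and derivatives at the two
  end points, \<open>2 s\<close> numbers in all, determine the part of this sum that comes from the \<open>D\<^sub>m\<close>. An algorithm
  with \<open>M - 1\<close> further nodes can therefore remove that part, and what remains is at most the norm of \<open>g\<close>
  times the root of the sum of \<open>|w\<^sub>j|\<close> to the power \<open>- 2 s\<close>. If \<open>2 |k| \<le> M\<close>, no such \<open>|j|\<close> is smaller than
  \<open>(M + |k|) / 3\<close>, and the error is, for \<open>g\<close> of norm 1, at most \<open>2 (3 / (2 \<pi> (M + |k|))) ^ s\<close>
  (\<open>corrected_trapezoid_algorithm\<close>). If \<open>2 |k| > M\<close>, the end point values alone do as well
  (\<open>hermite_algorithm\<close>). Choosing \<open>M\<close> for a given \<open>\<epsilon>\<close> gives the upper bounds on the complexity.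

  The identity also yields the threshold in terms of \<open>\<beta>\<close>: \<open>D\<^sub>m\<close> is the mean of the derivative of order \<open>m + 1\<close>,
  so that the Cauchy-Schwarz inequality in the Sobolev norm bounds \<open>|I\<^sub>k(f)|\<close>
  (\<open>fourier_integral_le_beta\<close>).

  The lower bounds for \<open>n \<ge> 1\<close> are the hypothesis on \<open>c\<close>, because an algorithm is not worse on the smaller
  periodic space. For \<open>n = 0\<close> the hypothesis is silent. But for one node and \<open>|k| \<rightarrow> \<infinity>\<close> it forces
  \<open>c \<le> (1 / (2 \<pi>)) ^ s\<close> (\<open>lower_constant_bound\<close>), and testing with a single exponential closes the gap
  (\<open>info_complexity_lower\<close>).

  Functions of the Sobolev space are given by absolute continuity in terms of \<open>\<epsilon>\<close> and \<open>\<delta>\<close>, so integration by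
  parts rests on two theorems of Lebesgue: such functions are differentiable almost everywhere
  (\<open>absolutely_continuous_on_differentiable_ae\<close>) and are integrals of their derivative
  (\<open>integral_absolutely_continuous_on\<close>). The former follows from the convexity of arc length: when a
  refined polygon is hardly longer than a coarse one, the two are close in variation. The latter is
  immediate for the gauge integral.
\<close>

section \<open>Absolute continuity\<close>

text \<open>
  The definition indexes the intervals by an initial segment of the natural numbers, whereas dyadic
  cells and the cells of a tagged division come with index sets of their own.
\<close>

lemma absolutely_continuous_on_finite_family:
  assumes ac: "absolutely_continuous_on a b f" and "e > 0"
  obtains d where "d > 0"
    "\<And>(I :: 'i set) u v. finite I \<Longrightarrow> (\<And>i. i \<in> I \<Longrightarrow> a \<le> u i \<and> u i \<le> v i \<and> v i \<le> b) \<Longrightarrow>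
       disjoint_family_on (\<lambda>i. {u i<..<v i}) I \<Longrightarrow> (\<Sum>i\<in>I. v i - u i) < d \<Longrightarrow>
       (\<Sum>i\<in>I. cmod (f (v i) - f (u i))) < e"
proof -
  from ac \<open>e > 0\<close> obtain d where "d > 0" and d: "\<And>(n::nat) u v.
      (\<forall>i<n. a \<le> u i \<and> u i \<le> v i \<and> v i \<le> b) \<Longrightarrow>
      disjoint_family_on (\<lambda>i. {u i<..<v i}) {..<n} \<Longrightarrow>
      (\<Sum>i<n. v i - u i) < d \<Longrightarrow> (\<Sum>i<n. cmod (f (v i) - f (u i))) < e"
    unfolding absolutely_continuous_on_def by meson
  show thesis
  proof (rule that[OF \<open>d > 0\<close>])
    fix I :: "'i set" and u v
    assume I: "finite I" "\<And>i. i \<in> I \<Longrightarrow> a \<le> u i \<and> u i \<le> v i \<and> v i \<le> b"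
      "disjoint_family_on (\<lambda>i. {u i<..<v i}) I" "(\<Sum>i\<in>I. v i - u i) < d"
    obtain h where h: "bij_betw h {..<card I} I"
      using ex_bij_betw_nat_finite[OF I(1)] by (auto simp: atLeast0LessThan)
    have hI: "h i \<in> I" if "i < card I" for i
      using h that by (auto simp: bij_betw_def)
    have "disjoint_family_on (\<lambda>i. {u (h i)<..<v (h i)}) {..<card I}"
      unfolding disjoint_family_on_def
    proof (intro ballI impI)
      fix i j assume "i \<in> {..<card I}" "j \<in> {..<card I}" "i \<noteq> j"
      then have "h i \<noteq> h j" "h i \<in> I" "h j \<in> I"
        using h hI by (auto simp: bij_betw_def inj_on_def)
      then show "{u (h i)<..<v (h i)} \<inter> {u (h j)<..<v (h j)} = {}"
        using I(3) by (auto simp: disjoint_family_on_def)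
    qed
    moreover have "(\<Sum>i<card I. v (h i) - u (h i)) < d"
      using sum.reindex_bij_betw[OF h, of "\<lambda>i. v i - u i"] I(4) by simp
    ultimately have "(\<Sum>i<card I. cmod (f (v (h i)) - f (u (h i)))) < e"
      using I(2) hI by (intro d) auto
    then show "(\<Sum>i\<in>I. cmod (f (v i) - f (u i))) < e"
      using sum.reindex_bij_betw[OF h, of "\<lambda>i. cmod (f (v i) - f (u i))"] by simp
  qed
qed

lemma absolutely_continuous_on_imp_continuous_on:
  assumes "absolutely_continuous_on a b f"
  shows "continuous_on {a..b} f"
  unfolding continuous_on_iff
proof (intro ballI allI impI)
  fix x e :: real assume x: "x \<in> {a..b}" and "e > 0"
  from absolutely_continuous_on_finite_family[OF assms this(2), where ?'i = unit]
  obtain d where d: "d > 0" "\<And>(I :: unit set) u v. finite I \<Longrightarrow> (\<And>i. i \<in> I \<Longrightarrow> a \<le> u i \<and> u i \<le> v i \<and> v i \<le> b) \<Longrightarrow>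
       disjoint_family_on (\<lambda>i. {u i<..<v i}) I \<Longrightarrow> (\<Sum>i\<in>I. v i - u i) < d \<Longrightarrow>
       (\<Sum>i\<in>I. cmod (f (v i) - f (u i))) < e"
    by blast
  have *: "cmod (f v - f u) < e" if "a \<le> u" "u \<le> v" "v \<le> b" "v - u < d" for u v
    using d(2)[of "{()}" "\<lambda>_. u" "\<lambda>_. v"] that by (auto simp: disjoint_family_on_def)
  show "\<exists>d>0. \<forall>x'\<in>{a..b}. dist x' x < d \<longrightarrow> dist (f x') (f x) < e"
  proof (intro exI[of _ d] conjI ballI impI)
    fix y assume y: "y \<in> {a..b}" "dist y x < d"
    show "dist (f y) (f x) < e"
    proof (cases "x \<le> y")
      case True then show ?thesis using *[of x y] x y by (auto simp: dist_norm)
    next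
      case False then show ?thesis using *[of y x] x y by (auto simp: dist_norm norm_minus_commute)
    qed
  qed (use d in auto)
qed

section \<open>Approximation of absolutely continuous functions by dyadic polygons\<close>

text \<open>
  Here \<open>V\<close> is the length of the vector \<open>(t, w)\<close> in \<open>\<real> \<times> \<complex>\<close> and \<open>l\<close> its component in the direction
  \<open>(1, z)\<close>. The deviation \<open>w - t z\<close> only sees the component orthogonal to that direction, whose square
  is \<open>(V + l) (V - l) \<le> 2 V (V - l)\<close>. This is the strict convexity of arc length in quantitative form:
  a chord that deviates from a given slope lengthens the graph.
\<close>

lemma chord_deviation_le_excess:
  fixes w z :: complex and t :: real
  assumes "t \<ge> 0"
  defines "V \<equiv> sqrt (t\<^sup>2 + (cmod w)\<^sup>2)"
    and "l \<equiv> (t + Re (cnj z * w)) / sqrt (1 + (cmod z)\<^sup>2)"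
  shows "l \<le> V" "(cmod (w - of_real t * z))\<^sup>2 \<le> 2 * (1 + (cmod z)\<^sup>2) * V * (V - l)"
proof -
  define S R where "S = sqrt (1 + (cmod z)\<^sup>2)" and "R = Re (cnj z * w)"
  have S: "S > 0" "S\<^sup>2 = 1 + (cmod z)\<^sup>2"
    unfolding S_def by (simp_all add: add_pos_nonneg)
  have V: "V \<ge> 0" "V\<^sup>2 = t\<^sup>2 + (cmod w)\<^sup>2"
    unfolding V_def by simp_all
  have "\<bar>R\<bar> \<le> cmod (cnj z * w)"
    unfolding R_def by (rule abs_Re_le_cmod)
  then have R: "R\<^sup>2 \<le> (cmod z)\<^sup>2 * (cmod w)\<^sup>2"
    by (metis abs_le_square_iff abs_norm_cancel complex_mod_cnj norm_mult power_mult_distrib)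
  have dev: "(cmod (w - of_real t * z))\<^sup>2 = (cmod w)\<^sup>2 - 2 * t * R + t\<^sup>2 * (cmod z)\<^sup>2"
    unfolding R_def cmod_power2 by (simp add: power2_eq_square algebra_simps)
  have lS: "l * S = t + R"
    using S by (simp add: l_def S_def R_def)
  have key: "(cmod (w - of_real t * z))\<^sup>2 \<le> S\<^sup>2 * (V\<^sup>2 - l\<^sup>2)"
  proof -
    have "S\<^sup>2 * (V\<^sup>2 - l\<^sup>2) = (1 + (cmod z)\<^sup>2) * (t\<^sup>2 + (cmod w)\<^sup>2) - (t + R)\<^sup>2"
      using lS S V by (metis power_mult_distrib right_diff_distrib' mult.commute)
    then show ?thesis
      unfolding dev using R by (simp add: power2_eq_square algebra_simps)
  qed
  then have "0 \<le> S\<^sup>2 * (V\<^sup>2 - l\<^sup>2)"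
    by (rule order_trans[rotated]) simp
  then have "l\<^sup>2 \<le> V\<^sup>2"
    using S(1) by (simp add: zero_le_mult_iff)
  then show l: "l \<le> V"
    using V(1) by (rule power2_le_imp_le)
  have "S\<^sup>2 * (V\<^sup>2 - l\<^sup>2) \<le> S\<^sup>2 * (2 * V * (V - l))"
  proof (rule mult_left_mono)
    have "V\<^sup>2 - l\<^sup>2 = (V + l) * (V - l)" by (simp add: power2_eq_square algebra_simps)
    also have "\<dots> \<le> 2 * V * (V - l)" using l by (intro mult_right_mono) auto
    finally show "V\<^sup>2 - l\<^sup>2 \<le> 2 * V * (V - l)" .
  qed simp
  with key show "(cmod (w - of_real t * z))\<^sup>2 \<le> 2 * (1 + (cmod z)\<^sup>2) * V * (V - l)"
    unfolding S(2) by (simp add: algebra_simps)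
qed

definition dyadic_increment :: "(real \<Rightarrow> complex) \<Rightarrow> nat \<Rightarrow> nat \<Rightarrow> complex" where
  "dyadic_increment f n i = f (real (Suc i) / 2 ^ n) - f (real i / 2 ^ n)"

text \<open>
  The length of the chord of the graph over the \<open>i\<close>-th dyadic interval of level \<open>n\<close>.
\<close>

definition dyadic_chord :: "(real \<Rightarrow> complex) \<Rightarrow> nat \<Rightarrow> nat \<Rightarrow> real" where
  "dyadic_chord f n i = sqrt ((1 / 2 ^ n)\<^sup>2 + (cmod (dyadic_increment f n i))\<^sup>2)"

definition dyadic_slope :: "(real \<Rightarrow> complex) \<Rightarrow> nat \<Rightarrow> nat \<Rightarrow> complex" where
  "dyadic_slope f n i = 2 ^ n * dyadic_increment f n i"

lemma dyadic_increment_refine: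
  "(\<Sum>j<2 ^ r. dyadic_increment f (n + r) (j + i * 2 ^ r)) = dyadic_increment f n i"
proof -
  define h where "h = (\<lambda>j. f (real (j + i * 2 ^ r) / 2 ^ (n + r)))"
  have "(\<Sum>j<2 ^ r. dyadic_increment f (n + r) (j + i * 2 ^ r)) = (\<Sum>j<2 ^ r. h (Suc j) - h j)"
    by (simp add: dyadic_increment_def h_def add.assoc)
  also have "\<dots> = h (2 ^ r) - h 0"
    by (rule sum_lessThan_telescope)
  also have "\<dots> = dyadic_increment f n i"
  proof -
    have "real (2 ^ r + i * 2 ^ r) / 2 ^ (n + r) = real (Suc i) / 2 ^ n"
      "real (0 + i * 2 ^ r) / 2 ^ (n + r) = real i / 2 ^ n"
      by (simp_all add: power_add field_simps)
    then show ?thesis by (simp only: h_def dyadic_increment_def)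
  qed
  finally show ?thesis .
qed

text \<open>
  Measured in the direction of a coarse chord, the fine chords add up to exactly the coarse one. Hence
  the excesses in the third claim add up to the arc length gained by the refinement.
\<close>

lemma dyadic_chord_deviation:
  fixes f :: "real \<Rightarrow> complex" and n i r :: nat
  defines "z \<equiv> dyadic_slope f n i"
  defines "l \<equiv> (\<lambda>j. (1 / 2 ^ (n + r) + Re (cnj z * dyadic_increment f (n + r) (j + i * 2 ^ r))) /
                     sqrt (1 + (cmod z)\<^sup>2))"
  shows "(\<Sum>j<2 ^ r. l j) = dyadic_chord f n i"
    and "l j \<le> dyadic_chord f (n + r) (j + i * 2 ^ r)"
    and "(cmod (dyadic_increment f (n + r) (j + i * 2 ^ r) - z / 2 ^ (n + r)))\<^sup>2 \<le>
           2 * (1 + (cmod z)\<^sup>2) * dyadic_chord f (n + r) (j + i * 2 ^ r) *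
           (dyadic_chord f (n + r) (j + i * 2 ^ r) - l j)"
proof -
  define S where "S = sqrt (1 + (cmod z)\<^sup>2)"
  have S: "S > 0" "S\<^sup>2 = 1 + (cmod z)\<^sup>2"
    unfolding S_def by (simp_all add: add_pos_nonneg)
  have "(\<Sum>j<2 ^ r. l j) = ((\<Sum>j<(2::nat) ^ r. 1 / 2 ^ (n + r)) +
          Re (cnj z * (\<Sum>j<2 ^ r. dyadic_increment f (n + r) (j + i * 2 ^ r)))) / S"
    by (simp add: l_def S_def sum_divide_distrib[symmetric] sum.distrib sum_distrib_left
          del: sum_constant)
  also have "\<dots> = (1 / 2 ^ n + Re (cnj z * dyadic_increment f n i)) / S"
    by (simp only: dyadic_increment_refine) (simp add: power_add)
  also have "dyadic_increment f n i = z / 2 ^ n"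
    by (simp add: z_def dyadic_slope_def)
  also have "Re (cnj z * (z / 2 ^ n)) = (cmod z)\<^sup>2 / 2 ^ n"
  proof -
    have "cnj z * (z / 2 ^ n) = of_real ((cmod z)\<^sup>2 / 2 ^ n)"
      using complex_norm_square[of z] by (simp add: mult.commute)
    then show ?thesis by (metis Re_complex_of_real)
  qed
  also have "(1 / 2 ^ n + (cmod z)\<^sup>2 / 2 ^ n) / S = S / 2 ^ n"
  proof -
    have "1 / 2 ^ n + (cmod z)\<^sup>2 / 2 ^ n = S\<^sup>2 / 2 ^ n"
      by (simp add: S(2) add_divide_distrib)
    then show ?thesis using S(1) by (simp add: power2_eq_square)
  qed
  also have "S / 2 ^ n = dyadic_chord f n i"
  proof -
    have "(1 / 2 ^ n)\<^sup>2 + (cmod (dyadic_increment f n i))\<^sup>2 = (S / 2 ^ n)\<^sup>2"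
      unfolding power_divide S(2)
      by (simp add: z_def dyadic_slope_def norm_mult norm_power power_mult_distrib field_simps)
    then show ?thesis
      using S(1) unfolding dyadic_chord_def by simp
  qed
  finally show "(\<Sum>j<2 ^ r. l j) = dyadic_chord f n i" .
  have eq: "of_real (1 / 2 ^ (n + r)) * z = z / 2 ^ (n + r)" by simp
  show "l j \<le> dyadic_chord f (n + r) (j + i * 2 ^ r)"
    unfolding l_def dyadic_chord_def by (rule chord_deviation_le_excess) simp
  show "(cmod (dyadic_increment f (n + r) (j + i * 2 ^ r) - z / 2 ^ (n + r)))\<^sup>2 \<le>
           2 * (1 + (cmod z)\<^sup>2) * dyadic_chord f (n + r) (j + i * 2 ^ r) *
           (dyadic_chord f (n + r) (j + i * 2 ^ r) - l j)"
    using chord_deviation_le_excess(2)[of "1 / 2 ^ (n + r)" "dyadic_increment f (n + r) (j + i * 2 ^ r)" z]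
    unfolding l_def dyadic_chord_def eq by simp
qed

lemma absolutely_continuous_on_dyadic:
  assumes "absolutely_continuous_on 0 1 f" "e > 0"
  obtains d where "d > 0"
    "\<And>n J. J \<subseteq> {..<2 ^ n} \<Longrightarrow> real (card J) / 2 ^ n < d \<Longrightarrow>
       (\<Sum>j\<in>J. cmod (dyadic_increment f n j)) < e"
proof -
  from absolutely_continuous_on_finite_family[OF assms, where ?'i = nat]
  obtain d where d: "d > 0"
    "\<And>(I :: nat set) u v. finite I \<Longrightarrow> (\<And>i. i \<in> I \<Longrightarrow> 0 \<le> u i \<and> u i \<le> v i \<and> v i \<le> 1) \<Longrightarrow>
       disjoint_family_on (\<lambda>i. {u i<..<v i}) I \<Longrightarrow> (\<Sum>i\<in>I. v i - u i) < d \<Longrightarrow>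
       (\<Sum>i\<in>I. cmod (f (v i) - f (u i))) < e" by blast
  show thesis
  proof (rule that[OF d(1)])
    fix n and J :: "nat set" assume J: "J \<subseteq> {..<2 ^ n}" "real (card J) / 2 ^ n < d"
    show "(\<Sum>j\<in>J. cmod (dyadic_increment f n j)) < e"
      unfolding dyadic_increment_def
    proof (rule d(2))
      show "finite J" using J(1) finite_subset by blast
      show "0 \<le> real j / 2 ^ n \<and> real j / 2 ^ n \<le> real (Suc j) / 2 ^ n \<and> real (Suc j) / 2 ^ n \<le> 1"
        if "j \<in> J" for j
      proof -
        have "Suc j \<le> 2 ^ n" using that J(1) by auto
        then have "real (Suc j) \<le> 2 ^ n" by (metis of_nat_le_iff of_nat_numeral of_nat_power)
        then show ?thesis by (auto simp: divide_simps)
      qed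
      show "disjoint_family_on (\<lambda>i. {real i / 2 ^ n<..<real (Suc i) / 2 ^ n}) J"
        unfolding disjoint_family_on_def
      proof (intro ballI impI)
        have "{real i / 2 ^ n<..<real (Suc i) / 2 ^ n} \<inter> {real j / 2 ^ n<..<real (Suc j) / 2 ^ n} = {}"
          if "i < j" for i j
        proof -
          have "real (Suc i) \<le> real j" using that by linarith
          then have "real (Suc i) / 2 ^ n \<le> real j / 2 ^ n" by (rule divide_right_mono) simp
          then show ?thesis by force
        qed
        then show "{real i / 2 ^ n<..<real (Suc i) / 2 ^ n} \<inter> {real j / 2 ^ n<..<real (Suc j) / 2 ^ n} = {}"
          if "i \<noteq> j" for i j
          using that by (metis inf_commute linorder_neqE_nat)
      qed
      have "(\<Sum>i\<in>J. real (Suc i) / 2 ^ n - real i / 2 ^ n) = real (card J) / 2 ^ n"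
        by (simp add: diff_divide_distrib[symmetric])
      then show "(\<Sum>i\<in>J. real (Suc i) / 2 ^ n - real i / 2 ^ n) < d"
        using J(2) by simp
    qed
  qed
qed

definition dyadic_length :: "(real \<Rightarrow> complex) \<Rightarrow> nat \<Rightarrow> real" where
  "dyadic_length f n = (\<Sum>i<2 ^ n. dyadic_chord f n i)"

lemma dyadic_block_index:
  fixes i j :: nat
  assumes "j < 2 ^ r" "i < 2 ^ n"
  shows "j + i * 2 ^ r < 2 ^ (n + r)"
proof -
  have "j + i * 2 ^ r < Suc i * 2 ^ r" using assms(1) by simp
  also have "\<dots> \<le> 2 ^ n * 2 ^ r" using assms(2) by (intro mult_right_mono) auto
  finally show ?thesis by (simp add: power_add)
qed

lemma sum_dyadic_blocks:
  fixes h :: "nat \<Rightarrow> real"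
  shows "(\<Sum>j<2 ^ (n + r). h j) = (\<Sum>i<2 ^ n. \<Sum>j<2 ^ r. h (j + i * 2 ^ r))"
  unfolding power_add by (rule sum_mult_product)

lemma dyadic_length_mono: "dyadic_length f n \<le> dyadic_length f (n + r)"
proof -
  have "dyadic_chord f n i \<le> (\<Sum>j<2 ^ r. dyadic_chord f (n + r) (j + i * 2 ^ r))" for i
    by (subst dyadic_chord_deviation(1)[where f = f and n = n and i = i and r = r, symmetric])
       (rule sum_mono, rule dyadic_chord_deviation(2))
  then show ?thesis
    unfolding dyadic_length_def sum_dyadic_blocks by (rule sum_mono)
qed

text \<open>
  A dyadic cell that is shorter than the \<open>\<delta>\<close> belonging to \<open>\<epsilon> = 1\<close> contributes variation at most 1,
  however finely it is subdivided.
\<close>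

lemma dyadic_length_bounded:
  assumes "absolutely_continuous_on 0 1 f"
  obtains C where "C > 0" "\<And>n. dyadic_length f n \<le> C"
proof -
  from absolutely_continuous_on_dyadic[OF assms zero_less_one] obtain d where d: "d > 0"
    "\<And>n J. J \<subseteq> {..<2 ^ n} \<Longrightarrow> real (card J) / 2 ^ n < d \<Longrightarrow>
       (\<Sum>j\<in>J. cmod (dyadic_increment f n j)) < 1" by blast
  obtain m where m: "1 / 2 ^ m < d"
    using real_arch_pow_inv[OF d(1), of "1/2"] by (auto simp: power_one_over)
  have *: "dyadic_length f (m + r) \<le> 1 + 2 ^ m" for r
  proof -
    have "(\<Sum>j<2 ^ r. cmod (dyadic_increment f (m + r) (j + i * 2 ^ r))) \<le> 1" if "i < 2 ^ m" for i
    proof -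
      define J where "J = (\<lambda>j. j + i * 2 ^ r) ` {..<(2::nat) ^ r}"
      have inj: "inj_on (\<lambda>j. j + i * 2 ^ r) {..<(2::nat) ^ r}" by (auto simp: inj_on_def)
      have "(\<Sum>j\<in>J. cmod (dyadic_increment f (m + r) j)) < 1"
      proof (rule d(2))
        show "J \<subseteq> {..<2 ^ (m + r)}"
          using dyadic_block_index \<open>i < 2 ^ m\<close> by (auto simp: J_def)
        have "card J = 2 ^ r" unfolding J_def using inj by (simp add: card_image)
        then show "real (card J) / 2 ^ (m + r) < d" using m by (simp add: power_add)
      qed
      then show ?thesis unfolding J_def by (simp add: sum.reindex[OF inj] o_def)
    qed
    then have "(\<Sum>j<2 ^ (m + r). cmod (dyadic_increment f (m + r) j)) \<le> (\<Sum>i<(2::nat) ^ m. 1)"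
      unfolding sum_dyadic_blocks by (intro sum_mono) auto
    moreover have "dyadic_length f (m + r) \<le>
        (\<Sum>j<2 ^ (m + r). 1 / 2 ^ (m + r) + cmod (dyadic_increment f (m + r) j))"
      unfolding dyadic_length_def dyadic_chord_def
      by (intro sum_mono order_trans[OF sqrt_sum_squares_le_sum_abs]) simp
    ultimately show ?thesis by (simp add: sum.distrib)
  qed
  have "dyadic_length f n \<le> 1 + 2 ^ m" for n
    using dyadic_length_mono[of f n m] *[of n] by (simp add: add.commute)
  then show thesis by (intro that[of "1 + 2 ^ m"]) (simp_all add: add_pos_pos)
qed

text \<open>
  An absolutely continuous function is close in variation to one of its dyadic polygons. Pick a level
  beyond which the bounded, increasing arc length gains at most \<open>\<eta>\<close>. On cells where the polygon has
  slope at most \<open>R\<close>, convexity of arc length bounds the deviation by the gain. The cells with larger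
  slope have small total length, because the polygon is not longer than \<open>C\<close>, and there absolute
  continuity makes both the function and the polygon vary little.
\<close>

lemma dyadic_polygon_variation:
  assumes ac: "absolutely_continuous_on 0 1 f" and "e > 0"
  obtains n where
    "\<And>r. (\<Sum>j<2 ^ (n + r). cmod (dyadic_increment f (n + r) j -
             dyadic_slope f n (j div 2 ^ r) / 2 ^ (n + r))) \<le> e"
proof -
  define e' where "e' = e / 3"
  have "e' > 0" using \<open>e > 0\<close> by (simp add: e'_def)
  obtain C where C: "C > 0" "\<And>n. dyadic_length f n \<le> C"
    using dyadic_length_bounded[OF ac] by blast
  from absolutely_continuous_on_dyadic[OF ac \<open>e' > 0\<close>] obtain d where d: "d > 0"
    "\<And>n J. J \<subseteq> {..<2 ^ n} \<Longrightarrow> real (card J) / 2 ^ n < d \<Longrightarrow>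
       (\<Sum>j\<in>J. cmod (dyadic_increment f n j)) < e'" by blast
  define R where "R = 2 * C / d"
  have R: "R > 0" "C / R < d" using C d by (auto simp: R_def)
  define K where "K = 2 * (1 + R\<^sup>2)"
  have "K > 0" by (simp add: K_def add_pos_nonneg)
  \<comment> \<open>\<open>\<kappa>\<close> weighs chord against excess in the inequality of the arithmetic and geometric mean;
    with these \<open>\<kappa>\<close> and \<open>\<eta>\<close>, both sums contribute at most \<open>e' / 2\<close>.\<close>
  define \<kappa> where "\<kappa> = e' / C"
  have "\<kappa> > 0" using \<open>e' > 0\<close> C by (simp add: \<kappa>_def)
  define \<eta> where "\<eta> = e' * \<kappa> / K"
  have "\<eta> > 0" using \<open>e' > 0\<close> \<open>\<kappa> > 0\<close> \<open>K > 0\<close> by (simp add: \<eta>_def)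
  obtain n where n: "\<And>r. dyadic_length f (n + r) - dyadic_length f n \<le> \<eta>"
  proof -
    define s where "s = (SUP n. dyadic_length f n)"
    have bdd: "bdd_above (range (dyadic_length f))" using C(2) by (auto simp: bdd_above_def)
    obtain n where "dyadic_length f n > s - \<eta>"
      using less_cSUP_iff[OF _ bdd, of "s - \<eta>"] \<open>\<eta> > 0\<close> by (auto simp: s_def)
    moreover have "dyadic_length f m \<le> s" for m
      unfolding s_def by (rule cSUP_upper[OF _ bdd]) simp
    ultimately show thesis by (intro that[of n]) (smt (verit))
  qed
  show thesis
  proof (rule that[of n])
    fix r
    define D where "D = (\<lambda>j. dyadic_increment f (n + r) j)"
    define z where "z = (\<lambda>i. dyadic_slope f n i)"
    define V where "V = (\<lambda>j. dyadic_chord f (n + r) j)"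
    define l where "l = (\<lambda>i j. (1 / 2 ^ (n + r) + Re (cnj (z i) * D (j + i * 2 ^ r))) /
                     sqrt (1 + (cmod (z i))\<^sup>2))"
    define B where "B = {i \<in> {..<(2::nat) ^ n}. cmod (z i) > R}"
    define dev where "dev = (\<lambda>i j. cmod (D (j + i * 2 ^ r) - z i / 2 ^ (n + r)))"
    have B: "finite B" "B \<subseteq> {..<2 ^ n}" by (auto simp: B_def)
    have V0: "V j \<ge> 0" for j by (simp add: V_def dyadic_chord_def)
    have lsum: "(\<Sum>j<2 ^ r. l i j) = dyadic_chord f n i" for i
      unfolding l_def z_def D_def by (rule dyadic_chord_deviation(1))
    have lV: "l i j \<le> V (j + i * 2 ^ r)" for i j
      unfolding l_def z_def D_def V_def by (rule dyadic_chord_deviation(2))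
    have dev2: "(dev i j)\<^sup>2 \<le> 2 * (1 + (cmod (z i))\<^sup>2) * V (j + i * 2 ^ r) * (V (j + i * 2 ^ r) - l i j)" for i j
      unfolding l_def z_def D_def V_def dev_def by (rule dyadic_chord_deviation(3))
    have cardB: "real (card B) / 2 ^ n < d"
    proof -
      have "real (card B) * (R / 2 ^ n) = (\<Sum>i\<in>B. R / 2 ^ n)" by simp
      also have "\<dots> \<le> (\<Sum>i\<in>B. dyadic_chord f n i)"
      proof (rule sum_mono)
        fix i assume "i \<in> B"
        then have "R / 2 ^ n \<le> cmod (z i) / 2 ^ n" by (auto simp: B_def divide_right_mono)
        also have "\<dots> = cmod (dyadic_increment f n i)"
          by (simp add: z_def dyadic_slope_def norm_mult norm_power)
        also have "\<dots> \<le> dyadic_chord f n i"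
          unfolding dyadic_chord_def by (rule real_le_rsqrt) simp
        finally show "R / 2 ^ n \<le> dyadic_chord f n i" .
      qed
      also have "\<dots> \<le> dyadic_length f n"
        unfolding dyadic_length_def using B
        by (intro sum_mono2) (auto simp: dyadic_chord_def)
      also have "\<dots> \<le> C" by (rule C(2))
      finally have "real (card B) / 2 ^ n \<le> C / R" using R(1) by (simp add: field_simps)
      then show ?thesis using R(2) by simp
    qed
    have bad: "(\<Sum>i\<in>B. \<Sum>j<2 ^ r. dev i j) \<le> 2 * e'"
    proof -
      define J where "J = (\<lambda>(i, j). j + i * 2 ^ r) ` (B \<times> {..<(2::nat) ^ r})"
      have inj: "inj_on (\<lambda>(i, j). j + i * 2 ^ r) (B \<times> {..<(2::nat) ^ r})"
      proof (rule inj_onI, clarsimp)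
        fix a b a' b' :: nat
        assume h: "b < 2 ^ r" "b' < 2 ^ r" "b + a * 2 ^ r = b' + a' * 2 ^ r"
        have "(b + a * 2 ^ r) div 2 ^ r = a" "(b' + a' * 2 ^ r) div 2 ^ r = a'"
          using h(1,2) by (simp_all add: div_mult_self3)
        then have "a = a'" using h(3) by simp
        with h(3) show "a = a' \<and> b = b'" by simp
      qed
      have "(\<Sum>j\<in>J. cmod (dyadic_increment f (n + r) j)) < e'"
      proof (rule d(2))
        show "J \<subseteq> {..<2 ^ (n + r)}"
          using B(2) dyadic_block_index by (auto simp: J_def)
        have "card J = card B * 2 ^ r" unfolding J_def by (simp add: card_image[OF inj] card_cartesian_product)
        then show "real (card J) / 2 ^ (n + r) < d" using cardB by (simp add: power_add)
      qed
      then have 1: "(\<Sum>i\<in>B. \<Sum>j<2 ^ r. cmod (D (j + i * 2 ^ r))) < e'"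
        unfolding J_def D_def sum.reindex[OF inj] by (simp add: sum.cartesian_product o_def case_prod_unfold)
      have 2: "(\<Sum>i\<in>B. cmod (dyadic_increment f n i)) < e'"
        by (rule d(2)[OF B(2) cardB])
      have "(\<Sum>j<2 ^ r. dev i j) \<le> (\<Sum>j<2 ^ r. cmod (D (j + i * 2 ^ r))) + cmod (dyadic_increment f n i)" for i
      proof -
        have "(\<Sum>j<2 ^ r. dev i j) \<le> (\<Sum>j<2 ^ r. cmod (D (j + i * 2 ^ r)) + cmod (z i / 2 ^ (n + r)))"
          unfolding dev_def by (intro sum_mono norm_triangle_ineq4)
        also have "cmod (z i / 2 ^ (n + r)) = cmod (dyadic_increment f n i) / 2 ^ r"
          by (simp add: z_def dyadic_slope_def norm_mult norm_divide norm_power power_add)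
        finally show ?thesis by (simp add: sum.distrib)
      qed
      then have "(\<Sum>i\<in>B. \<Sum>j<2 ^ r. dev i j) \<le>
          (\<Sum>i\<in>B. (\<Sum>j<2 ^ r. cmod (D (j + i * 2 ^ r))) + cmod (dyadic_increment f n i))"
        by (rule sum_mono)
      with 1 2 show ?thesis by (simp add: sum.distrib)
    qed
    have good: "(\<Sum>i\<in>{..<2 ^ n} - B. \<Sum>j<2 ^ r. dev i j) \<le> e'"
    proof -
      have pt: "dev i j \<le> (\<kappa> * V (j + i * 2 ^ r) + K / \<kappa> * (V (j + i * 2 ^ r) - l i j)) / 2"
        if "i \<in> {..<2 ^ n} - B" for i j
      proof -
        define v x where "v = V (j + i * 2 ^ r)" and "x = v - l i j"
        have v: "v \<ge> 0" "x \<ge> 0" using V0 lV by (auto simp: v_def x_def)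
        have "cmod (z i) \<le> R" using that by (auto simp: B_def)
        then have "2 * (1 + (cmod (z i))\<^sup>2) \<le> K" by (simp add: K_def power_mono)
        then have "2 * (1 + (cmod (z i))\<^sup>2) * v * x \<le> K * v * x"
          using v by (intro mult_right_mono) auto
        then have "(dev i j)\<^sup>2 \<le> (\<kappa> * v) * (K / \<kappa> * x)"
          using dev2[of i j] \<open>\<kappa> > 0\<close> by (simp add: v_def[symmetric] x_def[symmetric] mult_ac)
        also have "\<dots> \<le> ((\<kappa> * v + K / \<kappa> * x) / 2)\<^sup>2"
        proof -
          have "a * b \<le> ((a + b) / 2)\<^sup>2" for a b :: real
            using sum_squares_bound[of a b] by (simp add: power2_eq_square field_simps)
          then show ?thesis .
        qed
        finally have "dev i j \<le> (\<kappa> * v + K / \<kappa> * x) / 2"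
          by (rule power2_le_imp_le) (use v \<open>\<kappa> > 0\<close> \<open>K > 0\<close> in auto)
        then show ?thesis by (simp add: v_def x_def)
      qed
      have "(\<Sum>i\<in>{..<2 ^ n} - B. \<Sum>j<2 ^ r. dev i j) \<le>
            (\<Sum>i\<in>{..<2 ^ n} - B. \<Sum>j<2 ^ r. (\<kappa> * V (j + i * 2 ^ r) + K / \<kappa> * (V (j + i * 2 ^ r) - l i j)) / 2)"
        by (intro sum_mono pt)
      also have "\<dots> \<le> (\<Sum>i<2 ^ n. \<Sum>j<2 ^ r. (\<kappa> * V (j + i * 2 ^ r) + K / \<kappa> * (V (j + i * 2 ^ r) - l i j)) / 2)"
        using V0 lV \<open>\<kappa> > 0\<close> \<open>K > 0\<close>
        by (intro sum_mono2 sum_nonneg divide_nonneg_nonneg add_nonneg_nonneg mult_nonneg_nonneg) auto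
      also have "\<dots> = (\<kappa> * (\<Sum>i<2 ^ n. \<Sum>j<2 ^ r. V (j + i * 2 ^ r)) +
          K / \<kappa> * ((\<Sum>i<2 ^ n. \<Sum>j<2 ^ r. V (j + i * 2 ^ r)) - (\<Sum>i<2 ^ n. \<Sum>j<2 ^ r. l i j))) / 2"
        by (simp add: sum.distrib sum_subtractf sum_distrib_left sum_divide_distrib
              add_divide_distrib diff_divide_distrib right_diff_distrib)
      also have "\<dots> = (\<kappa> * dyadic_length f (n + r) + K / \<kappa> * (dyadic_length f (n + r) - dyadic_length f n)) / 2"
        by (simp add: lsum sum_dyadic_blocks dyadic_length_def V_def)
      also have "\<dots> \<le> (\<kappa> * C + K / \<kappa> * \<eta>) / 2"
        using C(2) n \<open>\<kappa> > 0\<close> \<open>K > 0\<close> by (intro divide_right_mono add_mono mult_left_mono) auto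
      also have "\<dots> = e'"
        using \<open>\<kappa> > 0\<close> \<open>K > 0\<close> C(1) by (simp add: \<eta>_def) (simp add: \<kappa>_def)
      finally show ?thesis .
    qed
    have "(\<Sum>j<2 ^ (n + r). cmod (D j - z (j div 2 ^ r) / 2 ^ (n + r))) = (\<Sum>i<2 ^ n. \<Sum>j<2 ^ r. dev i j)"
      unfolding sum_dyadic_blocks dev_def by (intro sum.cong refl) (simp add: div_mult_self3)
    also have "\<dots> = (\<Sum>i\<in>{..<2 ^ n} - B. \<Sum>j<2 ^ r. dev i j) + (\<Sum>i\<in>B. \<Sum>j<2 ^ r. dev i j)"
      using B by (intro sum.subset_diff) auto
    also have "\<dots> \<le> e" using good bad by (simp add: e'_def)
    finally show "(\<Sum>j<2 ^ (n + r). cmod (dyadic_increment f (n + r) j -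
             dyadic_slope f n (j div 2 ^ r) / 2 ^ (n + r))) \<le> e"
      by (simp add: D_def z_def)
  qed
qed

section \<open>Differentiability almost everywhere\<close>

text \<open>
  Near a non-dyadic point \<open>x\<close> the dyadic polygon is affine. If no slope fits the difference quotients at
  \<open>x\<close> up to \<open>\<mu>\<close>, then that of the polygon does not either, which yields arbitrarily short dyadic intervals
  around \<open>x\<close> on which the increment of function minus polygon exceeds \<open>\<mu>\<close> times the length. Disjoint intervals of this kind have total length at most the variation of the difference
  divided by \<open>\<mu>\<close>, which is as small as desired, and Vitali's covering lemma passes from disjoint
  intervals to a cover at the cost of a factor 5.
\<close>

lemma oscillating_quotients_negligible:
  assumes ac: "absolutely_continuous_on 0 1 f" and "\<mu> > 0"
  shows "negligible {x \<in> {0<..<1}. \<forall>c. \<forall>d>0. \<exists>y\<in>{0..1}. y \<noteq> x \<and> \<bar>y - x\<bar> < d \<and>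
           cmod (f y - f x - of_real (y - x) * c) > \<mu> * \<bar>y - x\<bar>}" (is "negligible ?N")
proof -
  define D where "D = range (\<lambda>(i::nat, m::nat). real i / 2 ^ m)"
  have "countable D" by (simp add: D_def)
  then have "negligible D" by (simp add: negligible_iff_null_sets countable_imp_null_set_lborel null_sets_completionI)
  have cont: "continuous_on {0..1} f"
    by (rule absolutely_continuous_on_imp_continuous_on[OF ac])
  have "negligible (?N - D)"
    unfolding negligible_outer_le
  proof (intro allI impI)
    fix e :: real assume "e > 0"
    then have "\<mu> * e / 5 > 0" using \<open>\<mu> > 0\<close> by simp
    then obtain n where n: "\<And>r. (\<Sum>j<2 ^ (n + r). cmod (dyadic_increment f (n + r) j -
             dyadic_slope f n (j div 2 ^ r) / 2 ^ (n + r))) \<le> \<mu> * e / 5"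
      by (rule dyadic_polygon_variation[OF ac]) (rule that)
    define z where "z = dyadic_slope f n"
    define dyadic steep where
      "dyadic = (\<lambda>u v. \<exists>r a b. u = real a / 2 ^ (n + r) \<and> v = real b / 2 ^ (n + r))" and
      "steep = (\<lambda>u v. \<exists>i. real i / 2 ^ n \<le> u \<and> v \<le> real (Suc i) / 2 ^ n \<and>
             cmod (f v - f u - of_real (v - u) * z i) > \<mu> * (v - u))"
    define K where "K = {(u, v). u < v \<and> 0 \<le> u \<and> v \<le> 1 \<and> dyadic u v \<and> steep u v}"
    define cen where "cen = (\<lambda>(u::real, v::real). (u + v) / 2)"
    define rad where "rad = (\<lambda>(u::real, v::real). (v - u) / 2)"
    have cb: "cball (cen (u, v)) (rad (u, v)) = {u..v}" for u v
      by (simp add: cen_def rad_def cball_eq_atLeastAtMost field_simps)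
    have cover: "?N - D \<subseteq> (\<Union>p\<in>K. cball (cen p) (rad p))"
    proof
      fix x assume x: "x \<in> ?N - D"
      then have x01: "0 < x" "x < 1" and "x \<notin> D" by auto
      define i where "i = nat \<lfloor>x * 2 ^ n\<rfloor>"
      have i1: "real i \<le> x * 2 ^ n" "x * 2 ^ n < real i + 1"
        using x01 by (simp_all add: i_def)
      have "real i / 2 ^ n \<noteq> x" using \<open>x \<notin> D\<close> by (force simp: D_def)
      with i1 have i2: "real i / 2 ^ n < x" "x < real (Suc i) / 2 ^ n"
        by (auto simp: field_simps)
      define d where "d = Min {x - real i / 2 ^ n, real (Suc i) / 2 ^ n - x, x, 1 - x}"
      have "d > 0" unfolding d_def using i2 x01 by auto
      then obtain y where y: "y \<noteq> x" "\<bar>y - x\<bar> < d" "cmod (f y - f x - of_real (y - x) * z i) > \<mu> * \<bar>y - x\<bar>"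
        using x by blast
      define s t where "s = min x y" and "t = max x y"
      have st: "s < t" "real i / 2 ^ n < s" "t < real (Suc i) / 2 ^ n" "0 < s" "t < 1" "s \<le> x" "x \<le> t"
      proof -
        have "d \<le> x - real i / 2 ^ n" "d \<le> real (Suc i) / 2 ^ n - x" "d \<le> x" "d \<le> 1 - x"
          unfolding d_def by (rule Min_le; simp)+
        then have "real i / 2 ^ n < y" "y < real (Suc i) / 2 ^ n" "0 < y" "y < 1"
          using y(2) by linarith+
        then show "s < t" "real i / 2 ^ n < s" "t < real (Suc i) / 2 ^ n" "0 < s" "t < 1" "s \<le> x" "x \<le> t"
          using y(1) i2 x01 by (auto simp: s_def t_def)
      qed
      have gt: "cmod (f t - f s - of_real (t - s) * z i) > \<mu> * (t - s)"
      proof (cases "x \<le> y")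
        case True then show ?thesis using y(3) by (simp add: s_def t_def)
      next
        case False
        have "cmod (f x - f y - of_real (x - y) * z i) = cmod (f y - f x - of_real (y - x) * z i)"
          by (subst norm_minus_cancel[symmetric]) (simp add: algebra_simps)
        then show ?thesis using y(3) False by (simp add: s_def t_def min_def max_def)
      qed
      \<comment> \<open>Dyadic intervals that shrink to \<open>[s, t]\<close> from outside; by continuity a fine one inherits the steepness.\<close>
      define u v where "u = (\<lambda>r. real (nat \<lfloor>s * 2 ^ (n + r)\<rfloor>) / 2 ^ (n + r))"
        and "v = (\<lambda>r. real (nat \<lceil>t * 2 ^ (n + r)\<rceil>) / 2 ^ (n + r))"
      have ub: "u r \<le> s" "s - 1 / 2 ^ r \<le> u r" for r
      proof -
        have 1: "real (nat \<lfloor>s * 2 ^ (n + r)\<rfloor>) \<le> s * 2 ^ (n + r)"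
          "s * 2 ^ (n + r) - 1 \<le> real (nat \<lfloor>s * 2 ^ (n + r)\<rfloor>)"
          using st by (simp, linarith)
        have "(s * 2 ^ (n + r) - 1) / 2 ^ (n + r) \<le> u r"
          unfolding u_def using 1 by (intro divide_right_mono) auto
        moreover have "(1::real) / 2 ^ (n + r) \<le> 1 / 2 ^ r"
          by (intro divide_left_mono power_increasing) auto
        ultimately show "s - 1 / 2 ^ r \<le> u r" by (simp add: diff_divide_distrib)
        show "u r \<le> s" unfolding u_def using 1 by (simp add: field_simps)
      qed
      have vb: "t \<le> v r" "v r \<le> t + 1 / 2 ^ r" for r
      proof -
        have 1: "t * 2 ^ (n + r) \<le> real (nat \<lceil>t * 2 ^ (n + r)\<rceil>)"
          "real (nat \<lceil>t * 2 ^ (n + r)\<rceil>) \<le> t * 2 ^ (n + r) + 1"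
          using st by (linarith, simp, linarith?)
        have "v r \<le> (t * 2 ^ (n + r) + 1) / 2 ^ (n + r)"
          unfolding v_def using 1 by (intro divide_right_mono) auto
        moreover have "(1::real) / 2 ^ (n + r) \<le> 1 / 2 ^ r"
          by (intro divide_left_mono power_increasing) auto
        ultimately show "v r \<le> t + 1 / 2 ^ r" by (simp add: add_divide_distrib)
        show "t \<le> v r" unfolding v_def using 1 by (simp add: field_simps)
      qed
      have pow0: "(\<lambda>r. 1 / 2 ^ r :: real) \<longlonglongrightarrow> 0"
        using LIMSEQ_realpow_zero[of "1/2"] by (simp add: power_one_over)
      have ul: "u \<longlonglongrightarrow> s"
      proof (rule tendsto_sandwich)
        show "\<forall>\<^sub>F r in sequentially. s - 1 / 2 ^ r \<le> u r" "\<forall>\<^sub>F r in sequentially. u r \<le> s"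
          using ub by simp_all
        show "(\<lambda>r. s - 1 / 2 ^ r) \<longlonglongrightarrow> s" using tendsto_diff[OF tendsto_const pow0, of s] by simp
      qed simp
      have vl: "v \<longlonglongrightarrow> t"
      proof (rule tendsto_sandwich)
        show "\<forall>\<^sub>F r in sequentially. t \<le> v r" "\<forall>\<^sub>F r in sequentially. v r \<le> t + 1 / 2 ^ r"
          using vb by simp_all
        show "(\<lambda>r. t + 1 / 2 ^ r) \<longlonglongrightarrow> t" using tendsto_add[OF tendsto_const pow0, of t] by simp
      qed simp
      have "eventually (\<lambda>r. real i / 2 ^ n < u r) sequentially"
        "eventually (\<lambda>r. 0 < u r) sequentially"
        "eventually (\<lambda>r. v r < real (Suc i) / 2 ^ n) sequentially"
        "eventually (\<lambda>r. v r < 1) sequentially"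
        using order_tendstoD[OF ul] order_tendstoD[OF vl] st by blast+
      moreover have "eventually (\<lambda>r. cmod (f (v r) - f (u r) - of_real (v r - u r) * z i) - \<mu> * (v r - u r) > 0) sequentially"
      proof -
        have fu: "(\<lambda>r. f (u r)) \<longlonglongrightarrow> f s"
          by (rule continuous_on_tendsto_compose[OF cont ul])
             (use st \<open>eventually (\<lambda>r. 0 < u r) sequentially\<close> ub in
               \<open>auto elim!: eventually_mono intro: order_trans[OF ub(1)]\<close>)
        have fv: "(\<lambda>r. f (v r)) \<longlonglongrightarrow> f t"
          by (rule continuous_on_tendsto_compose[OF cont vl])
             (use st \<open>eventually (\<lambda>r. v r < 1) sequentially\<close> vb in
               \<open>auto elim!: eventually_mono intro: order_trans[OF _ vb(1)]\<close>)
        have "(\<lambda>r. cmod (f (v r) - f (u r) - of_real (v r - u r) * z i) - \<mu> * (v r - u r)) \<longlonglongrightarrow>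
              cmod (f t - f s - of_real (t - s) * z i) - \<mu> * (t - s)"
          by (intro tendsto_intros fu fv ul vl)
        then show ?thesis by (rule order_tendstoD) (use gt in simp)
      qed
      ultimately have "eventually (\<lambda>r. real i / 2 ^ n < u r \<and> 0 < u r \<and> v r < real (Suc i) / 2 ^ n \<and> v r < 1 \<and>
          cmod (f (v r) - f (u r) - of_real (v r - u r) * z i) - \<mu> * (v r - u r) > 0) sequentially"
        by eventually_elim auto
      then obtain r where r: "real i / 2 ^ n < u r" "0 < u r" "v r < real (Suc i) / 2 ^ n" "v r < 1"
          "cmod (f (v r) - f (u r) - of_real (v r - u r) * z i) > \<mu> * (v r - u r)"
        by (auto dest!: eventually_happens'[OF sequentially_bot])
      have "u r < v r" using ub(1)[of r] vb(1)[of r] st by linarith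
      moreover have "dyadic (u r) (v r)"
        unfolding u_def v_def dyadic_def by blast
      moreover have "steep (u r) (v r)"
        unfolding steep_def using r by (intro exI[of _ i]) simp
      ultimately have "(u r, v r) \<in> K"
        unfolding K_def using r by simp
      moreover have "x \<in> {u r..v r}"
        using ub(1)[of r] vb(1)[of r] st by auto
      ultimately show "x \<in> (\<Union>p\<in>K. cball (cen p) (rad p))"
        using cb by blast
    qed
    have radK: "0 < rad p \<and> rad p \<le> 1" if "p \<in> K" for p
    proof -
      have "fst p < snd p" "0 \<le> fst p" "snd p \<le> 1" using that by (auto simp: K_def)
      then show ?thesis by (simp add: rad_def case_prod_unfold)
    qed
    obtain C where C: "countable C" "C \<subseteq> K"
        "pairwise (\<lambda>i j. disjnt (cball (cen i) (rad i)) (cball (cen j) (rad j))) C"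
        "?N - D \<subseteq> (\<Union>i\<in>C. cball (cen i) (5 * rad i))"
      by (rule Vitali_covering_lemma_cballs[OF cover radK]) (assumption, rule that)
    have total: "(\<Sum>(u, v)\<in>F. v - u) \<le> e / 5" if F: "F \<subseteq> C" "finite F" for F
    proof -
      have KF: "p \<in> K" if "p \<in> F" for p using that F(1) C(2) by blast
      have "\<forall>p\<in>F. dyadic (fst p) (snd p)"
        using KF by (auto simp: K_def)
      then obtain r a b where rab: "\<And>p. p \<in> F \<Longrightarrow> fst p = real (a p) / 2 ^ (n + r p) \<and> snd p = real (b p) / 2 ^ (n + r p)"
        unfolding dyadic_def by metis
      \<comment> \<open>A level that is common to all end points of the finite family.\<close>
      define R where "R = Max (insert 0 (r ` F))"
      have rR: "r p \<le> R" if "p \<in> F" for p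
        unfolding R_def using that F(2) by (intro Max_ge) auto
      define A B where "A = (\<lambda>p. a p * 2 ^ (R - r p))" and "B = (\<lambda>p. b p * 2 ^ (R - r p))"
      have AB: "fst p = real (A p) / 2 ^ (n + R)" "snd p = real (B p) / 2 ^ (n + R)" if "p \<in> F" for p
      proof -
        have "(2::real) ^ (n + R) = 2 ^ (n + r p) * 2 ^ (R - r p)"
          using rR[OF that] by (simp flip: power_add)
        then show "fst p = real (A p) / 2 ^ (n + R)" "snd p = real (B p) / 2 ^ (n + R)"
          using rab[OF that] by (simp_all add: A_def B_def)
      qed
      define dv where "dv = (\<lambda>j. cmod (dyadic_increment f (n + R) j - z (j div 2 ^ R) / 2 ^ (n + R)))"
      have one: "\<mu> * (snd p - fst p) \<le> (\<Sum>j\<in>{A p..<B p}. dv j)" "B p \<le> 2 ^ (n + R)" if "p \<in> F" for p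
      proof -
        have *: "fst p < snd p" "snd p \<le> 1" "steep (fst p) (snd p)"
          using KF[OF that] by (auto simp: K_def)
        then obtain i where i: "real i / 2 ^ n \<le> fst p" "snd p \<le> real (Suc i) / 2 ^ n"
          "cmod (f (snd p) - f (fst p) - of_real (snd p - fst p) * z i) > \<mu> * (snd p - fst p)"
          by (auto simp: steep_def)
        have "A p < B p" using *(1) AB[OF that] by (simp add: divide_less_cancel)
        have "real (i * 2 ^ R) \<le> real (A p)" "real (B p) \<le> real (Suc i * 2 ^ R)" "real (B p) \<le> real (2 ^ (n + R))"
          using i(1,2) *(2) unfolding AB[OF that] by (simp_all add: power_add field_simps)
        then have ib: "i * 2 ^ R \<le> A p" "B p \<le> Suc i * 2 ^ R" "B p \<le> 2 ^ (n + R)"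
          by (simp_all only: of_nat_le_iff)
        then show "B p \<le> 2 ^ (n + R)" by simp
        have dj: "j div 2 ^ R = i" if "j \<in> {A p..<B p}" for j
        proof (rule div_nat_eqI)
          show "2 ^ R * i \<le> j" using that ib by (auto simp: mult.commute)
          show "j < 2 ^ R * Suc i" using that ib by (simp add: mult.commute)
        qed
        have "f (snd p) - f (fst p) - of_real (snd p - fst p) * z i =
              (\<Sum>j\<in>{A p..<B p}. dyadic_increment f (n + R) j) - (\<Sum>j\<in>{A p..<B p}. z i / 2 ^ (n + R))"
        proof -
          have "(\<Sum>j\<in>{A p..<B p}. dyadic_increment f (n + R) j) = f (snd p) - f (fst p)"
            unfolding dyadic_increment_def AB[OF that]
            by (rule sum_Suc_diff'[where f = "\<lambda>j. f (real j / 2 ^ (n + R))"]) (use \<open>A p < B p\<close> in simp)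
          moreover have "(\<Sum>j\<in>{A p..<B p}. z i / 2 ^ (n + R)) = of_real (snd p - fst p) * z i"
            unfolding AB[OF that] using \<open>A p < B p\<close> by (simp add: of_nat_diff field_simps)
          ultimately show ?thesis by simp
        qed
        also have "\<dots> = (\<Sum>j\<in>{A p..<B p}. dyadic_increment f (n + R) j - z (j div 2 ^ R) / 2 ^ (n + R))"
          unfolding sum_subtractf[symmetric] by (intro sum.cong refl) (simp add: dj)
        also have "cmod \<dots> \<le> (\<Sum>j\<in>{A p..<B p}. dv j)"
          unfolding dv_def by (rule norm_sum)
        finally show "\<mu> * (snd p - fst p) \<le> (\<Sum>j\<in>{A p..<B p}. dv j)"
          using i(3) by simp
      qed
      have disj: "{A p..<B p} \<inter> {A q..<B q} = {}" if "p \<in> F" "q \<in> F" "p \<noteq> q" for p q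
      proof (rule ccontr)
        assume "{A p..<B p} \<inter> {A q..<B q} \<noteq> {}"
        then obtain j where j: "A p \<le> j" "j < B p" "A q \<le> j" "j < B q"
          by (meson atLeastLessThan_iff disjoint_iff)
        have "real j / 2 ^ (n + R) \<in> {fst p..snd p}" "real j / 2 ^ (n + R) \<in> {fst q..snd q}"
          using j unfolding AB[OF that(1)] AB[OF that(2)] by (auto intro!: divide_right_mono)
        then have "real j / 2 ^ (n + R) \<in> cball (cen p) (rad p) \<inter> cball (cen q) (rad q)"
          using cb[of "fst p" "snd p"] cb[of "fst q" "snd q"] by simp
        moreover have "disjnt (cball (cen p) (rad p)) (cball (cen q) (rad q))"
          using C(3) that F(1) by (auto simp: pairwise_def)
        ultimately show False by (auto simp: disjnt_def)
      qed
      have "\<mu> * (\<Sum>(u, v)\<in>F. v - u) = (\<Sum>p\<in>F. \<mu> * (snd p - fst p))"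
        by (simp add: sum_distrib_left case_prod_unfold)
      also have "\<dots> \<le> (\<Sum>p\<in>F. \<Sum>j\<in>{A p..<B p}. dv j)"
        by (intro sum_mono one)
      also have "\<dots> = (\<Sum>j\<in>(\<Union>p\<in>F. {A p..<B p}). dv j)"
        by (rule sum.UNION_disjoint[symmetric]) (use F disj in auto)
      also have "\<dots> \<le> (\<Sum>j<2 ^ (n + R). dv j)"
        by (rule sum_mono2) (use one(2) in \<open>force simp: dv_def\<close>)+
      also have "\<dots> \<le> \<mu> * e / 5"
        unfolding dv_def z_def by (rule n)
      finally show ?thesis using \<open>\<mu> > 0\<close> by (simp add: mult.commute field_simps)
    qed
    have bound: "measure lebesgue (\<Union>i\<in>F. cball (cen i) (5 * rad i)) \<le> e" if F: "F \<subseteq> C" "finite F" for F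
    proof -
      have "measure lebesgue (\<Union>i\<in>F. cball (cen i) (5 * rad i)) \<le> (\<Sum>i\<in>F. measure lebesgue (cball (cen i) (5 * rad i)))"
        by (rule measure_UNION_le) (use F in auto)
      also have "\<dots> = (\<Sum>(u, v)\<in>F. 5 * (v - u))"
      proof (intro sum.cong refl, clarify)
        fix u v assume "(u, v) \<in> F"
        then have "(u, v) \<in> K" using F(1) C(2) by blast
        then have "u < v" by (simp add: K_def)
        moreover have "cball (cen (u, v)) (5 * rad (u, v)) = {3 * u - 2 * v..3 * v - 2 * u}"
        proof -
          have "(u + v) / 2 - 5 * ((v - u) / 2) = 3 * u - 2 * v" "(u + v) / 2 + 5 * ((v - u) / 2) = 3 * v - 2 * u"
            by argo+
          then show ?thesis by (simp only: cen_def rad_def cball_eq_atLeastAtMost case_prod_conv)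
        qed
        ultimately show "measure lebesgue (cball (cen (u, v)) (5 * rad (u, v))) = 5 * (v - u)"
          by simp
      qed
      also have "\<dots> = 5 * (\<Sum>(u, v)\<in>F. v - u)"
        unfolding sum_distrib_left case_prod_unfold ..
      also have "\<dots> \<le> e" using total[OF F] by simp
      finally show ?thesis .
    qed
    define U where "U = (\<Union>i\<in>C. cball (cen i) (5 * rad i))"
    have "U \<in> lmeasurable" "measure lebesgue U \<le> e"
      unfolding U_def
      by (rule fmeasurable_UN_bound[OF C(1) lmeasurable_cball bound], assumption+)
         (rule measure_UN_bound[OF C(1) lmeasurable_cball bound], assumption+)
    with C(4) show "\<exists>T. ?N - D \<subseteq> T \<and> T \<in> lmeasurable \<and> measure lebesgue T \<le> e"
      unfolding U_def[symmetric] by blast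
  qed
  with \<open>negligible D\<close> have "negligible ((?N - D) \<union> D)"
    by (simp only: negligible_Un_eq)
  then show ?thesis by (rule negligible_subset) (simp only: Un_Diff_cancel2 Un_upper1)
qed

text \<open>
  Slopes that fit up to \<open>1 / (m + 1)\<close> and up to \<open>1 / (n + 1)\<close> differ by at most the sum of the tolerances,
  as a common nearby point shows. So they form a Cauchy sequence, and its limit is the derivative.
\<close>

lemma differentiable_if_quotients_settle:
  fixes f :: "real \<Rightarrow> complex"
  assumes x: "x \<in> {0<..<1}"
    and settle: "\<And>\<mu>. \<mu> > 0 \<Longrightarrow> \<exists>c. \<exists>d>0. \<forall>y\<in>{0..1}. y \<noteq> x \<and> \<bar>y - x\<bar> < d \<longrightarrow>
       cmod (f y - f x - of_real (y - x) * c) \<le> \<mu> * \<bar>y - x\<bar>"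
  shows "f differentiable (at x within {0..1})"
proof -
  have "\<forall>n. \<exists>c. \<exists>d>0. \<forall>y\<in>{0..1}. y \<noteq> x \<and> \<bar>y - x\<bar> < d \<longrightarrow>
       cmod (f y - f x - of_real (y - x) * c) \<le> 1 / real (Suc n) * \<bar>y - x\<bar>"
    by (intro allI settle) simp
  then obtain c d where cd: "\<And>n. d n > 0" "\<And>n y. y \<in> {0..1} \<Longrightarrow> y \<noteq> x \<Longrightarrow> \<bar>y - x\<bar> < d n \<Longrightarrow>
       cmod (f y - f x - of_real (y - x) * c n) \<le> 1 / real (Suc n) * \<bar>y - x\<bar>"
    by metis
  have close: "cmod (c m - c n) \<le> 1 / real (Suc m) + 1 / real (Suc n)" for m n
  proof -
    define h where "h = Min {d m, d n, 1 - x} / 2"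
    have h: "h > 0" "h < d m" "h < d n" "h < 1 - x"
    proof -
      have "Min {d m, d n, 1 - x} > 0" using cd(1) x by auto
      moreover have "Min {d m, d n, 1 - x} \<le> d m" "Min {d m, d n, 1 - x} \<le> d n" "Min {d m, d n, 1 - x} \<le> 1 - x"
        by auto
      ultimately show "h > 0" "h < d m" "h < d n" "h < 1 - x" unfolding h_def by linarith+
    qed
    have y: "x + h \<in> {0..1}" "x + h \<noteq> x" using h x by auto
    have "of_real h * (c m - c n) = (f (x + h) - f x - of_real h * c n) - (f (x + h) - f x - of_real h * c m)"
      by (simp add: algebra_simps)
    then have "h * cmod (c m - c n) \<le> cmod (f (x + h) - f x - of_real h * c n) + cmod (f (x + h) - f x - of_real h * c m)"
      using norm_triangle_ineq4[of "f (x + h) - f x - of_real h * c n" "f (x + h) - f x - of_real h * c m"] h(1)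
      by (metis abs_of_pos norm_mult norm_of_real)
    also have "\<dots> \<le> 1 / real (Suc n) * h + 1 / real (Suc m) * h"
      using cd(2)[OF y, of n] cd(2)[OF y, of m] h by (intro add_mono) auto
    also have "\<dots> = h * (1 / real (Suc m) + 1 / real (Suc n))" by (simp add: algebra_simps)
    finally show ?thesis using h(1) by (simp only: mult_le_cancel_left_pos)
  qed
  have inv0: "(\<lambda>n. 1 / real (Suc n)) \<longlonglongrightarrow> 0" by (rule LIMSEQ_Suc) (rule lim_1_over_n)
  have "Cauchy c"
  proof (rule metric_CauchyI)
    fix e :: real assume "e > 0"
    then obtain N where N: "1 / real (Suc N) < e / 2"
      using inv0[THEN order_tendstoD(2), of "e / 2"] by (auto simp: eventually_sequentially)
    have "dist (c m) (c n) < e" if "m \<ge> N" "n \<ge> N" for m n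
    proof -
      have "1 / real (Suc m) \<le> 1 / real (Suc N)" "1 / real (Suc n) \<le> 1 / real (Suc N)"
        using that by (auto intro!: divide_left_mono)
      then show ?thesis using close[of m n] N unfolding dist_norm by linarith
    qed
    then show "\<exists>M. \<forall>m\<ge>M. \<forall>n\<ge>M. dist (c m) (c n) < e" by blast
  qed
  then obtain L where L: "c \<longlonglongrightarrow> L" using Cauchy_convergent convergent_def by blast
  have cL: "cmod (c m - L) \<le> 1 / real (Suc m)" for m
  proof (rule LIMSEQ_le)
    show "(\<lambda>n. cmod (c m - c n)) \<longlonglongrightarrow> cmod (c m - L)" by (intro tendsto_intros L)
    show "(\<lambda>n. 1 / real (Suc m) + 1 / real (Suc n)) \<longlonglongrightarrow> 1 / real (Suc m)"
      using tendsto_add[OF tendsto_const inv0, of "1 / real (Suc m)"] by simp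
  qed (use close in auto)
  have "(f has_vector_derivative L) (at x within {0..1})"
    unfolding has_vector_derivative_def has_derivative_within_alt
  proof (intro conjI allI impI bounded_linear_scaleR_left)
    fix e :: real assume "e > 0"
    then obtain N where N: "1 / real (Suc N) < e / 2"
      using inv0[THEN order_tendstoD(2), of "e / 2"] by (auto simp: eventually_sequentially)
    show "\<exists>d>0. \<forall>y\<in>{0..1}. norm (y - x) < d \<longrightarrow> norm (f y - f x - (y - x) *\<^sub>R L) \<le> e * norm (y - x)"
    proof (intro exI[of _ "d N"] conjI ballI impI cd(1))
      fix y assume y: "y \<in> {0..1}" "norm (y - x) < d N"
      show "norm (f y - f x - (y - x) *\<^sub>R L) \<le> e * norm (y - x)"
      proof (cases "y = x")
        case False
        have "f y - f x - (y - x) *\<^sub>R L = (f y - f x - of_real (y - x) * c N) + of_real (y - x) * (c N - L)"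
          by (simp add: algebra_simps scaleR_conv_of_real)
        also have "norm \<dots> \<le> 1 / real (Suc N) * \<bar>y - x\<bar> + \<bar>y - x\<bar> * (1 / real (Suc N))"
        proof (rule norm_triangle_mono)
          show "cmod (f y - f x - of_real (y - x) * c N) \<le> 1 / real (Suc N) * \<bar>y - x\<bar>"
            using cd(2)[OF y(1) False, of N] y(2) by simp
          show "cmod (of_real (y - x) * (c N - L)) \<le> \<bar>y - x\<bar> * (1 / real (Suc N))"
            unfolding norm_mult norm_of_real by (intro mult_left_mono cL) simp
        qed
        also have "\<dots> = (2 * (1 / real (Suc N))) * \<bar>y - x\<bar>" by simp
        also have "\<dots> \<le> e * \<bar>y - x\<bar>" using N by (intro mult_right_mono) auto
        finally show ?thesis by simp
      qed simp
    qed
  qed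
  then show ?thesis
    using differentiableI_vector by blast
qed

theorem absolutely_continuous_on_differentiable_ae:
  assumes ac: "absolutely_continuous_on 0 1 f"
  shows "negligible {x \<in> {0..1}. \<not> f differentiable (at x within {0..1})}"
proof -
  define N where "N = (\<lambda>\<mu>. {x \<in> {0<..<1}. \<forall>c. \<forall>d>0. \<exists>y\<in>{0..1}. y \<noteq> x \<and> \<bar>y - x\<bar> < d \<and>
           cmod (f y - f x - of_real (y - x) * c) > \<mu> * \<bar>y - x\<bar>})"
  have "negligible (\<Union>n. N (1 / real (Suc n)))"
    by (rule negligible_countable_Union)
       (auto simp only: N_def intro!: oscillating_quotients_negligible[OF ac] countable_image, auto)
  moreover have "negligible {0, 1 :: real}" by simp
  ultimately have "negligible ((\<Union>n. N (1 / real (Suc n))) \<union> {0, 1})"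
    by (rule negligible_Un)
  then show ?thesis
  proof (rule negligible_subset)
    show "{x \<in> {0..1}. \<not> f differentiable (at x within {0..1})} \<subseteq> (\<Union>n. N (1 / real (Suc n))) \<union> {0, 1}"
    proof (rule subsetI, rule ccontr)
      fix x assume x: "x \<in> {x \<in> {0..1}. \<not> f differentiable (at x within {0..1})}"
        "x \<notin> (\<Union>n. N (1 / real (Suc n))) \<union> {0, 1}"
      then have x01: "x \<in> {0<..<1}" by auto
      have "f differentiable (at x within {0..1})"
      proof (rule differentiable_if_quotients_settle[OF x01])
        fix \<mu> :: real assume "\<mu> > 0"
        obtain n where n: "1 / real (Suc n) < \<mu>"
          using reals_Archimedean[OF \<open>\<mu> > 0\<close>] by (auto simp: inverse_eq_divide)
        have "x \<notin> N (1 / real (Suc n))" using x(2) by blast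
        then obtain c d where "d > 0" "\<forall>y\<in>{0..1}. y \<noteq> x \<and> \<bar>y - x\<bar> < d \<longrightarrow>
            cmod (f y - f x - of_real (y - x) * c) \<le> 1 / real (Suc n) * \<bar>y - x\<bar>"
          unfolding N_def mem_Collect_eq using x01 by (meson not_less)
        moreover have "1 / real (Suc n) * \<bar>y - x\<bar> \<le> \<mu> * \<bar>y - x\<bar>" for y
          using n by (intro mult_right_mono) auto
        ultimately show "\<exists>c. \<exists>d>0. \<forall>y\<in>{0..1}. y \<noteq> x \<and> \<bar>y - x\<bar> < d \<longrightarrow>
            cmod (f y - f x - of_real (y - x) * c) \<le> \<mu> * \<bar>y - x\<bar>"
          by (meson order_trans)
      qed
      with x(1) show False by simp
    qed
  qed
qed

section \<open>The fundamental theorem of calculus for absolutely continuous functions\<close>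

text \<open>
  The gauge follows the derivative at tags outside \<open>N\<close>. Tags in \<open>N\<close> are confined to an open set that is
  so small that absolute continuity controls the increments over their cells; the integrand is set to 0
  there, which does not affect the integral.
\<close>

lemma integral_absolutely_continuous_on:
  assumes ac: "absolutely_continuous_on a b F" and "a \<le> b" and N: "negligible N"
    and deriv: "\<And>x. x \<in> {a..b} \<Longrightarrow> x \<notin> N \<Longrightarrow> (F has_vector_derivative F' x) (at x within {a..b})"
  shows "(F' has_integral (F b - F a)) {a..b}"
proof -
  define G where "G = (\<lambda>x. if x \<in> N then 0 else F' x)"
  have "(G has_integral (F b - F a)) {a..b}"
    unfolding has_integral_real
  proof (intro allI impI)
    fix e :: real assume "e > 0"
    define e' where "e' = e / (2 * (b - a + 1))"
    have e': "e' > 0" "e' * (b - a) \<le> e / 2"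
      using \<open>e > 0\<close> \<open>a \<le> b\<close> by (auto simp: e'_def field_simps)
    have "e / 2 > 0" using \<open>e > 0\<close> by simp
    from absolutely_continuous_on_finite_family[OF ac this, where ?'i = "real \<times> real set"]
    obtain d where d: "d > 0"
      "\<And>(I :: (real \<times> real set) set) u v. finite I \<Longrightarrow> (\<And>i. i \<in> I \<Longrightarrow> a \<le> u i \<and> u i \<le> v i \<and> v i \<le> b) \<Longrightarrow>
         disjoint_family_on (\<lambda>i. {u i<..<v i}) I \<Longrightarrow> (\<Sum>i\<in>I. v i - u i) < d \<Longrightarrow>
         (\<Sum>i\<in>I. cmod (F (v i) - F (u i))) < e / 2"
      by blast
    have "N \<in> sets lebesgue" using N by (simp add: negligible_imp_sets)
    obtain U where U: "open U" "N \<subseteq> U" "U \<in> lmeasurable" "measure lebesgue U < d"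
    proof -
      obtain U where U: "open U" "N \<subseteq> U" "U - N \<in> lmeasurable" "emeasure lebesgue (U - N) < ennreal d"
        using sets_lebesgue_outer_open[OF \<open>N \<in> sets lebesgue\<close> d(1)] by metis
      have null: "N \<in> null_sets lebesgue" using N by (simp add: negligible_iff_null_sets)
      have "U = (U - N) \<union> N" using U(2) by blast
      then have "U \<in> lmeasurable"
        using U(3) N by (metis fmeasurable.Un negligible_imp_measurable)
      moreover have "measure lebesgue U = measure lebesgue (U - N)"
        using null U(1) by (intro measure_Diff_null_set[symmetric]) auto
      moreover have "measure lebesgue (U - N) < d"
        using U(3,4) d(1) by (simp add: emeasure_eq_measure2 ennreal_less_iff)
      ultimately show thesis using that U by simp
    qed
    have "\<exists>r>0. \<forall>y\<in>{a..b}. \<bar>y - x\<bar> < r \<longrightarrow> norm (F y - F x - (y - x) *\<^sub>R F' x) \<le> e' * \<bar>y - x\<bar>"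
      if "x \<in> {a..b}" "x \<notin> N" for x
      using deriv[OF that] e'(1)
      unfolding has_vector_derivative_def has_derivative_within_alt by auto
    then obtain r where r: "\<And>x. x \<in> {a..b} \<Longrightarrow> x \<notin> N \<Longrightarrow> r x > 0"
      "\<And>x y. x \<in> {a..b} \<Longrightarrow> x \<notin> N \<Longrightarrow> y \<in> {a..b} \<Longrightarrow> \<bar>y - x\<bar> < r x \<Longrightarrow>
         norm (F y - F x - (y - x) *\<^sub>R F' x) \<le> e' * \<bar>y - x\<bar>"
      by metis
    define \<gamma> where "\<gamma> = (\<lambda>x. if x \<in> N then U else if x \<in> {a..b} then ball x (r x) else UNIV)"
    have "gauge \<gamma>"
      unfolding gauge_def \<gamma>_def using U r(1) by auto
    moreover have "norm ((\<Sum>(x,k)\<in>p. measure lborel k *\<^sub>R G x) - (F b - F a)) < e"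
      if ptag: "p tagged_division_of {a..b}" and fine: "\<gamma> fine p" for p
    proof -
      have fin: "finite p" using ptag by blast
      have cell: "\<exists>u v. k = {u..v} \<and> u \<le> x \<and> x \<le> v \<and> a \<le> u \<and> v \<le> b" if xk: "(x, k) \<in> p" for x k
      proof -
        obtain u v where k: "k = {u..v}" using tagged_division_ofD(4)[OF ptag xk] by auto
        moreover have "x \<in> k" "k \<subseteq> {a..b}"
          using tagged_division_ofD(2,3)[OF ptag xk] by auto
        ultimately show ?thesis by auto
      qed
      define pN where "pN = {q \<in> p. fst q \<in> N}"
      have off: "norm (measure lborel k *\<^sub>R G x - (F (Sup k) - F (Inf k))) \<le> e' * measure lborel k"
        if "(x, k) \<in> p - pN" for x k
      proof -
        obtain u v where k: "k = {u..v}" "u \<le> x" "x \<le> v" "a \<le> u" "v \<le> b"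
          using cell[of x k] \<open>(x, k) \<in> p - pN\<close> by auto
        have xN: "x \<notin> N" "x \<in> {a..b}" using \<open>(x, k) \<in> p - pN\<close> k by (auto simp: pN_def)
        have "k \<subseteq> \<gamma> x"
          using fineD[OF fine] \<open>(x, k) \<in> p - pN\<close> by blast
        then have "k \<subseteq> ball x (r x)" using xN by (simp add: \<gamma>_def)
        moreover have "u \<in> k" "v \<in> k" using k by auto
        ultimately have "u \<in> ball x (r x)" "v \<in> ball x (r x)" by blast+
        then have ux: "\<bar>u - x\<bar> < r x" "\<bar>v - x\<bar> < r x"
          by (simp_all add: dist_real_def abs_minus_commute)
        have "u \<in> {a..b}" "v \<in> {a..b}" using k by auto
        with ux have uv: "norm (F u - F x - (u - x) *\<^sub>R F' x) \<le> e' * \<bar>u - x\<bar>"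
          "norm (F v - F x - (v - x) *\<^sub>R F' x) \<le> e' * \<bar>v - x\<bar>"
          by (simp_all only: r(2)[OF xN(2,1)])
        have "measure lborel k *\<^sub>R G x - (F (Sup k) - F (Inf k)) =
              (F u - F x - (u - x) *\<^sub>R F' x) - (F v - F x - (v - x) *\<^sub>R F' x)"
          using k xN by (simp add: G_def algebra_simps)
        also have "norm \<dots> \<le> e' * \<bar>u - x\<bar> + e' * \<bar>v - x\<bar>"
          by (rule order_trans[OF norm_triangle_ineq4 add_mono[OF uv]])
        also have "\<dots> = e' * measure lborel k" using k by (simp add: algebra_simps)
        finally show ?thesis .
      qed
      have on: "(\<Sum>q\<in>pN. cmod (F (Sup (snd q)) - F (Inf (snd q)))) < e / 2"
      proof (rule d(2))
        show "finite pN" using fin by (simp add: pN_def)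
        show "a \<le> Inf (snd q) \<and> Inf (snd q) \<le> Sup (snd q) \<and> Sup (snd q) \<le> b" if "q \<in> pN" for q
          using cell[of "fst q" "snd q"] that by (auto simp: pN_def)
        have int: "{Inf (snd q)<..<Sup (snd q)} = interior (snd q)" if "q \<in> pN" for q
          using cell[of "fst q" "snd q"] that by (auto simp: pN_def)
        have disj: "interior (snd q) \<inter> interior (snd q') = {}" if "q \<in> pN" "q' \<in> pN" "q \<noteq> q'" for q q'
          using tagged_division_ofD(5)[OF ptag, of "fst q" "snd q" "fst q'" "snd q'"] that
          by (auto simp: pN_def)
        have disj': "{Inf (snd q)<..<Sup (snd q)} \<inter> {Inf (snd q')<..<Sup (snd q')} = {}"
          if "q \<in> pN" "q' \<in> pN" "q \<noteq> q'" for q q'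
          by (simp only: int[OF that(1)] int[OF that(2)] disj[OF that])
        show "disjoint_family_on (\<lambda>q. {Inf (snd q)<..<Sup (snd q)}) pN"
          unfolding disjoint_family_on_def using disj' by blast
        have "(\<Sum>q\<in>pN. Sup (snd q) - Inf (snd q)) = (\<Sum>q\<in>pN. measure lebesgue {Inf (snd q)<..<Sup (snd q)})"
          using cell by (intro sum.cong refl) (force simp: pN_def)
        also have "\<dots> = measure lebesgue (\<Union>q\<in>pN. {Inf (snd q)<..<Sup (snd q)})"
        proof (rule measure_UNION'[symmetric, OF \<open>finite pN\<close>])
          show "{Inf (snd q)<..<Sup (snd q)} \<in> lmeasurable" for q :: "real \<times> real set"
            using lmeasurable_box[of "Inf (snd q)" "Sup (snd q)"] by (simp only: box_real)
          show "pairwise (\<lambda>q q'. disjnt {Inf (snd q)<..<Sup (snd q)} {Inf (snd q')<..<Sup (snd q')}) pN"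
            unfolding pairwise_def disjnt_def using disj' by blast
        qed
        also have "\<dots> \<le> measure lebesgue U"
        proof (rule measure_mono_fmeasurable[OF _ _ U(3)])
          show "(\<Union>q\<in>pN. {Inf (snd q)<..<Sup (snd q)}) \<subseteq> U"
          proof (rule UN_least)
            fix q assume q: "q \<in> pN"
            have "snd q \<subseteq> \<gamma> (fst q)"
              using fineD[OF fine, of "fst q" "snd q"] q by (simp add: pN_def)
            then have "snd q \<subseteq> U" using q by (simp add: \<gamma>_def pN_def)
            then show "{Inf (snd q)<..<Sup (snd q)} \<subseteq> U"
              unfolding int[OF q] using interior_subset by blast
          qed
        qed (use \<open>finite pN\<close> in auto)
        also have "\<dots> < d" by (rule U(4))
        finally show "(\<Sum>q\<in>pN. Sup (snd q) - Inf (snd q)) < d" .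
      qed
      have len: "(\<Sum>(x,k)\<in>p. measure lborel k) = b - a"
        using additive_content_tagged_division[of p a b] ptag \<open>a \<le> b\<close> by simp
      have "(\<Sum>(x,k)\<in>p. measure lborel k *\<^sub>R G x) - (F b - F a) =
            (\<Sum>(x,k)\<in>p. measure lborel k *\<^sub>R G x - (F (Sup k) - F (Inf k)))"
        using additive_tagged_division_1[OF \<open>a \<le> b\<close> ptag, of F]
        by (simp add: sum_subtractf case_prod_unfold)
      also have "\<dots> = (\<Sum>(x,k)\<in>p - pN. measure lborel k *\<^sub>R G x - (F (Sup k) - F (Inf k))) +
                      (\<Sum>(x,k)\<in>pN. measure lborel k *\<^sub>R G x - (F (Sup k) - F (Inf k)))"
        by (rule sum.subset_diff) (use fin in \<open>auto simp: pN_def\<close>)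
      also have "norm \<dots> < e / 2 + e / 2"
      proof (rule order_le_less_trans[OF norm_triangle_ineq add_le_less_mono])
        have "norm (\<Sum>(x,k)\<in>p - pN. measure lborel k *\<^sub>R G x - (F (Sup k) - F (Inf k))) \<le> (\<Sum>(x,k)\<in>p - pN. e' * measure lborel k)"
          using off by (intro sum_norm_le) auto
        also have "\<dots> \<le> (\<Sum>(x,k)\<in>p. e' * measure lborel k)"
          using fin e'(1) by (intro sum_mono2) auto
        also have "\<dots> = e' * (b - a)"
          unfolding len[symmetric] by (simp add: sum_distrib_left case_prod_unfold)
        finally show "norm (\<Sum>(x,k)\<in>p - pN. measure lborel k *\<^sub>R G x - (F (Sup k) - F (Inf k))) \<le> e / 2"
          using e'(2) by simp
        have "norm (\<Sum>(x,k)\<in>pN. measure lborel k *\<^sub>R G x - (F (Sup k) - F (Inf k))) \<le>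
              (\<Sum>q\<in>pN. cmod (F (Sup (snd q)) - F (Inf (snd q))))"
        proof (rule sum_norm_le)
          fix q assume "q \<in> pN"
          then have "G (fst q) = 0" by (simp add: pN_def G_def)
          then show "norm (case q of (x, k) \<Rightarrow> measure lborel k *\<^sub>R G x - (F (Sup k) - F (Inf k))) \<le>
              cmod (F (Sup (snd q)) - F (Inf (snd q)))"
            by (simp add: case_prod_unfold norm_minus_commute)
        qed
        then show "norm (\<Sum>(x,k)\<in>pN. measure lborel k *\<^sub>R G x - (F (Sup k) - F (Inf k))) < e / 2"
          using on by simp
      qed
      finally show ?thesis by simp
    qed
    ultimately show "\<exists>\<gamma>. gauge \<gamma> \<and> (\<forall>\<D>. \<D> tagged_division_of {a..b} \<and> \<gamma> fine \<D> \<longrightarrow>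
        norm ((\<Sum>(x,k)\<in>\<D>. measure lborel k *\<^sub>R G x) - (F b - F a)) < e)"
      by (intro exI[of _ \<gamma>] conjI allI impI) simp_all
  qed
  then show ?thesis
    by (rule has_integral_spike[OF N, rotated]) (simp add: G_def)
qed

lemma absolutely_continuous_on_subinterval:
  assumes "absolutely_continuous_on a b f" "a \<le> c" "d \<le> b"
  shows "absolutely_continuous_on c d f"
  unfolding absolutely_continuous_on_def
proof (intro allI impI)
  fix e :: real assume "e > 0"
  then obtain r where r: "r > 0" "\<And>(n::nat) u v.
      (\<forall>i<n. a \<le> u i \<and> u i \<le> v i \<and> v i \<le> b) \<Longrightarrow>
      disjoint_family_on (\<lambda>i. {u i<..<v i}) {..<n} \<Longrightarrow>
      (\<Sum>i<n. v i - u i) < r \<Longrightarrow> (\<Sum>i<n. cmod (f (v i) - f (u i))) < e"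
    using assms(1) unfolding absolutely_continuous_on_def by meson
  show "\<exists>\<delta>>0. \<forall>(n::nat) u v. (\<forall>i<n. c \<le> u i \<and> u i \<le> v i \<and> v i \<le> d) \<and>
        disjoint_family_on (\<lambda>i. {u i<..<v i}) {..<n} \<and> (\<Sum>i<n. v i - u i) < \<delta> \<longrightarrow>
        (\<Sum>i<n. cmod (f (v i) - f (u i))) < e"
  proof (intro exI[of _ r] conjI allI impI r(1))
    fix n :: nat and u v
    assume h: "(\<forall>i<n. c \<le> u i \<and> u i \<le> v i \<and> v i \<le> d) \<and>
        disjoint_family_on (\<lambda>i. {u i<..<v i}) {..<n} \<and> (\<Sum>i<n. v i - u i) < r"
    then have "\<forall>i<n. a \<le> u i \<and> u i \<le> v i \<and> v i \<le> b"
      using assms(2,3) by (meson order_trans)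
    with h show "(\<Sum>i<n. cmod (f (v i) - f (u i))) < e"
      by (intro r(2)) simp_all
  qed
qed

lemma continuous_on_interval_bounded:
  fixes f :: "real \<Rightarrow> complex"
  assumes "continuous_on {a..b} f"
  obtains B where "\<And>x. x \<in> {a..b} \<Longrightarrow> cmod (f x) \<le> B"
proof -
  have "bounded (f ` {a..b})"
    using assms compact_continuous_image compact_imp_bounded by blast
  then show thesis using that by (meson bounded_iff imageI)
qed

lemma has_vector_derivative_imp_continuous_on:
  assumes "\<And>x. x \<in> S \<Longrightarrow> (f has_vector_derivative f' x) (at x within S)"
  shows "continuous_on S f"
  unfolding continuous_on_eq_continuous_within
  using assms has_vector_derivative_continuous by blast

lemma absolutely_continuous_on_mult_Lipschitz:
  assumes ac: "absolutely_continuous_on a b f"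
    and E: "\<And>x. x \<in> {a..b} \<Longrightarrow> cmod (E x) \<le> B"
    and lip: "\<And>x y. x \<in> {a..b} \<Longrightarrow> y \<in> {a..b} \<Longrightarrow> cmod (E y - E x) \<le> L * \<bar>y - x\<bar>"
  shows "absolutely_continuous_on a b (\<lambda>x. f x * E x)"
  unfolding absolutely_continuous_on_def
proof (intro allI impI)
  fix e :: real assume "e > 0"
  obtain M0 where M0: "\<And>x. x \<in> {a..b} \<Longrightarrow> cmod (f x) \<le> M0"
    using continuous_on_interval_bounded[OF absolutely_continuous_on_imp_continuous_on[OF ac]] by blast
  define M where "M = \<bar>M0\<bar> + 1"
  have M: "M > 0" "cmod (f x) \<le> M" if "x \<in> {a..b}" for x
    using M0[OF that] by (auto simp: M_def)
  define B' L' where "B' = \<bar>B\<bar> + 1" and "L' = \<bar>L\<bar> + 1"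
  have pos: "M > 0" "B' > 0" "L' > 0" by (simp_all add: M_def B'_def L'_def)
  have "e / (2 * B') > 0" using \<open>e > 0\<close> pos by simp
  then obtain d where d: "d > 0" and small: "\<And>(n::nat) u v.
      (\<forall>i<n. a \<le> u i \<and> u i \<le> v i \<and> v i \<le> b) \<Longrightarrow>
      disjoint_family_on (\<lambda>i. {u i<..<v i}) {..<n} \<Longrightarrow>
      (\<Sum>i<n. v i - u i) < d \<Longrightarrow> (\<Sum>i<n. cmod (f (v i) - f (u i))) < e / (2 * B')"
    using ac unfolding absolutely_continuous_on_def by meson
  define d' where "d' = min d (e / (2 * M * L'))"
  have "d' > 0" using d \<open>e > 0\<close> pos by (simp add: d'_def)
  moreover have "(\<Sum>i<n. cmod (f (v i) * E (v i) - f (u i) * E (u i))) < e"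
    if h: "\<forall>i<n. a \<le> u i \<and> u i \<le> v i \<and> v i \<le> b"
      "disjoint_family_on (\<lambda>i. {u i<..<v i}) {..<n}" "(\<Sum>i<n. v i - u i) < d'" for n :: nat and u v
  proof -
    have "cmod (f (v i) * E (v i) - f (u i) * E (u i)) \<le> B' * cmod (f (v i) - f (u i)) + M * L' * (v i - u i)"
      if "i < n" for i
    proof -
      have iv: "u i \<in> {a..b}" "v i \<in> {a..b}" "u i \<le> v i" using h(1) that by force+
      have "f (v i) * E (v i) - f (u i) * E (u i) = (f (v i) - f (u i)) * E (v i) + f (u i) * (E (v i) - E (u i))"
        by (simp add: algebra_simps)
      also have "cmod \<dots> \<le> cmod (f (v i) - f (u i)) * B' + M * (L' * (v i - u i))"
        unfolding norm_mult[symmetric]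
      proof (rule norm_triangle_mono)
        show "cmod ((f (v i) - f (u i)) * E (v i)) \<le> cmod (f (v i) - f (u i)) * B'"
          unfolding norm_mult using E[OF iv(2)] by (intro mult_left_mono) (auto simp: B'_def)
        have "cmod (E (v i) - E (u i)) \<le> L * (v i - u i)" using lip[OF iv(1,2)] iv(3) by simp
        also have "\<dots> \<le> L' * (v i - u i)" using iv(3) by (intro mult_right_mono) (auto simp: L'_def)
        finally show "cmod (f (u i) * (E (v i) - E (u i))) \<le> M * (L' * (v i - u i))"
          unfolding norm_mult using M(2)[OF iv(1)] pos by (intro mult_mono) auto
      qed
      finally show ?thesis by (simp add: mult_ac)
    qed
    then have "(\<Sum>i<n. cmod (f (v i) * E (v i) - f (u i) * E (u i))) \<le>
        (\<Sum>i<n. B' * cmod (f (v i) - f (u i)) + M * L' * (v i - u i))"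
      by (intro sum_mono) simp
    also have "\<dots> = B' * (\<Sum>i<n. cmod (f (v i) - f (u i))) + M * L' * (\<Sum>i<n. v i - u i)"
      by (simp add: sum.distrib sum_distrib_left)
    also have "\<dots> < B' * (e / (2 * B')) + M * L' * (e / (2 * M * L'))"
    proof (rule add_strict_mono)
      show "B' * (\<Sum>i<n. cmod (f (v i) - f (u i))) < B' * (e / (2 * B'))"
        using small[OF h(1,2)] h(3) pos by (intro mult_strict_left_mono) (auto simp: d'_def)
      show "M * L' * (\<Sum>i<n. v i - u i) < M * L' * (e / (2 * M * L'))"
        using h(3) pos by (intro mult_strict_left_mono) (auto simp: d'_def)
    qed
    also have "\<dots> = e" using pos by (simp add: field_simps)
    finally show ?thesis .
  qed
  ultimately show "\<exists>\<delta>>0. \<forall>(n::nat) u v. (\<forall>i<n. a \<le> u i \<and> u i \<le> v i \<and> v i \<le> b) \<and>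
        disjoint_family_on (\<lambda>i. {u i<..<v i}) {..<n} \<and> (\<Sum>i<n. v i - u i) < \<delta> \<longrightarrow>
        (\<Sum>i<n. cmod (f (v i) * E (v i) - f (u i) * E (u i))) < e"
    by blast
qed

section \<open>Square-integrable functions\<close>

text \<open>
  Integrating \<open>2 |G K| \<le> t |G|\<^sup>2 + |K|\<^sup>2 / t\<close> bounds the integral for every \<open>t > 0\<close>.
\<close>

lemma Cauchy_Schwarz_integral:
  fixes G K :: "'a \<Rightarrow> complex"
  assumes [measurable]: "G \<in> borel_measurable M" "K \<in> borel_measurable M"
    and G: "integrable M (\<lambda>x. (cmod (G x))\<^sup>2)" and K: "integrable M (\<lambda>x. (cmod (K x))\<^sup>2)"
  shows "integrable M (\<lambda>x. G x * K x)"
    and "cmod (\<integral>x. G x * K x \<partial>M) \<le> sqrt (\<integral>x. (cmod (G x))\<^sup>2 \<partial>M) * sqrt (\<integral>x. (cmod (K x))\<^sup>2 \<partial>M)"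
proof -
  define X Y where "X = (\<integral>x. (cmod (G x))\<^sup>2 \<partial>M)" and "Y = (\<integral>x. (cmod (K x))\<^sup>2 \<partial>M)"
  have XY: "X \<ge> 0" "Y \<ge> 0" unfolding X_def Y_def by simp_all
  have amgm: "cmod (G x * K x) \<le> (t * (cmod (G x))\<^sup>2 + (cmod (K x))\<^sup>2 / t) / 2" if "t > 0" for t x
  proof -
    have "0 \<le> (t * cmod (G x) - cmod (K x))\<^sup>2" by simp
    then have "2 * t * (cmod (G x) * cmod (K x)) \<le> t * (t * (cmod (G x))\<^sup>2) + (cmod (K x))\<^sup>2"
      by (simp add: power2_eq_square algebra_simps)
    then show ?thesis using that by (simp add: norm_mult field_simps)
  qed
  show int: "integrable M (\<lambda>x. G x * K x)"
  proof (rule Bochner_Integration.integrable_bound)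
    show "integrable M (\<lambda>x. (1 * (cmod (G x))\<^sup>2 + (cmod (K x))\<^sup>2 / 1) / 2)"
      using G K by simp
    show "AE x in M. norm (G x * K x) \<le> norm ((1 * (cmod (G x))\<^sup>2 + (cmod (K x))\<^sup>2 / 1) / 2)"
      using amgm[of 1] by (intro AE_I2) (smt (verit) real_norm_def)
  qed simp
  have le: "cmod (\<integral>x. G x * K x \<partial>M) \<le> (t * X + Y / t) / 2" if "t > 0" for t
  proof -
    have "cmod (\<integral>x. G x * K x \<partial>M) \<le> (\<integral>x. cmod (G x * K x) \<partial>M)"
      by (rule integral_norm_bound)
    also have "\<dots> \<le> (\<integral>x. (t * (cmod (G x))\<^sup>2 + (cmod (K x))\<^sup>2 / t) / 2 \<partial>M)"
      using G K by (intro integral_mono amgm that integrable_norm int) auto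
    also have "\<dots> = (t * X + Y / t) / 2"
      using G K by (simp add: X_def Y_def)
    finally show ?thesis .
  qed
  have "cmod (\<integral>x. G x * K x \<partial>M) \<le> sqrt X * sqrt Y"
  proof (rule field_le_epsilon)
    fix e :: real assume "e > 0"
    define p q where "p = sqrt X" and "q = sqrt Y"
    have pq: "p \<ge> 0" "q \<ge> 0" "X = p\<^sup>2" "Y = q\<^sup>2" using XY by (simp_all add: p_def q_def)
    \<comment> \<open>The best \<open>t\<close> is \<open>q / p\<close>; adding \<open>r\<close> to both avoids the case that one of them vanishes.\<close>
    define r where "r = e / (p + q + e + 1)"
    have r: "r > 0" "r * (p + q) \<le> e" "r \<le> 1"
      using \<open>e > 0\<close> pq by (auto simp: r_def field_simps)
    have "cmod (\<integral>x. G x * K x \<partial>M) \<le> ((q + r) / (p + r) * p\<^sup>2 + q\<^sup>2 / ((q + r) / (p + r))) / 2"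
      using le[of "(q + r) / (p + r)"] pq r by (simp add: add_nonneg_pos)
    also have "\<dots> \<le> ((q + r) * p + q * (p + r)) / 2"
    proof -
      have "(q + r) / (p + r) * p\<^sup>2 \<le> (q + r) * p"
      proof -
        have "p\<^sup>2 / (p + r) \<le> p" using pq r by (simp add: divide_le_eq power2_eq_square algebra_simps)
        then have "(q + r) * (p\<^sup>2 / (p + r)) \<le> (q + r) * p" using pq r by (intro mult_left_mono) auto
        then show ?thesis by simp
      qed
      moreover have "q\<^sup>2 / ((q + r) / (p + r)) \<le> q * (p + r)"
      proof -
        have "q\<^sup>2 / (q + r) \<le> q" using pq r by (simp add: divide_le_eq power2_eq_square algebra_simps)
        then have "(q\<^sup>2 / (q + r)) * (p + r) \<le> q * (p + r)" using pq r by (intro mult_right_mono) auto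
        then show ?thesis by simp
      qed
      ultimately show ?thesis by (intro divide_right_mono add_mono) simp_all
    qed
    also have "\<dots> = p * q + r * (p + q) / 2" by (simp add: algebra_simps)
    also have "\<dots> \<le> p * q + e" using r \<open>e > 0\<close> by linarith
    finally show "cmod (\<integral>x. G x * K x \<partial>M) \<le> sqrt X * sqrt Y + e" by (simp add: p_def q_def)
  qed
  then show "cmod (\<integral>x. G x * K x \<partial>M) \<le> sqrt (\<integral>x. (cmod (G x))\<^sup>2 \<partial>M) * sqrt (\<integral>x. (cmod (K x))\<^sup>2 \<partial>M)"
    by (simp add: X_def Y_def)
qed

definition L2_on :: "real \<Rightarrow> real \<Rightarrow> (real \<Rightarrow> complex) \<Rightarrow> bool" where
  "L2_on a b G \<longleftrightarrow> G \<in> borel_measurable (lebesgue_on {a..b}) \<and>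
     integrable (lebesgue_on {a..b}) (\<lambda>x. (cmod (G x))\<^sup>2)"

definition L2_norm_on :: "real \<Rightarrow> real \<Rightarrow> (real \<Rightarrow> complex) \<Rightarrow> real" where
  "L2_norm_on a b G = sqrt (integral {a..b} (\<lambda>x. (cmod (G x))\<^sup>2))"

lemma L2_on_continuous:
  assumes "continuous_on {a..b} G"
  shows "L2_on a b G"
  unfolding L2_on_def
  by (intro conjI continuous_imp_measurable_on_sets_lebesgue continuous_imp_integrable_real
      continuous_intros assms) simp_all

lemma L2_on_subinterval:
  assumes "L2_on a b G" "a \<le> c" "d \<le> b"
  shows "L2_on c d G"
  using assms unfolding L2_on_def
  by (auto intro: measurable_restrict_mono integrable_subinterval[where a = a and b = b])

lemma L2_norm_on_eq_LINT:
  assumes "L2_on a b G"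
  shows "L2_norm_on a b G = sqrt (\<integral>x. (cmod (G x))\<^sup>2 \<partial>lebesgue_on {a..b})"
  using assms unfolding L2_on_def L2_norm_on_def by (simp add: lebesgue_integral_eq_integral)

lemma L2_norm_on_nonneg: "L2_norm_on a b G \<ge> 0"
  unfolding L2_norm_on_def
  by (cases "(\<lambda>x. (cmod (G x))\<^sup>2) integrable_on {a..b}")
     (auto simp: not_integrable_integral intro!: integral_nonneg)

lemma L2_on_mult:
  assumes "L2_on a b G" "L2_on a b K"
  shows "integrable (lebesgue_on {a..b}) (\<lambda>x. G x * K x)"
    and "(\<lambda>x. G x * K x) integrable_on {a..b}"
    and "cmod (integral {a..b} (\<lambda>x. G x * K x)) \<le> L2_norm_on a b G * L2_norm_on a b K"
proof -
  show 1: "integrable (lebesgue_on {a..b}) (\<lambda>x. G x * K x)"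
    using Cauchy_Schwarz_integral(1) assms unfolding L2_on_def by blast
  then show "(\<lambda>x. G x * K x) integrable_on {a..b}"
    by (rule integrable_on_lebesgue_on) simp
  have "integral {a..b} (\<lambda>x. G x * K x) = (\<integral>x. G x * K x \<partial>lebesgue_on {a..b})"
    using 1 by (simp add: lebesgue_integral_eq_integral)
  then show "cmod (integral {a..b} (\<lambda>x. G x * K x)) \<le> L2_norm_on a b G * L2_norm_on a b K"
    using Cauchy_Schwarz_integral(2)[of G "lebesgue_on {a..b}" K] assms
    by (simp add: L2_norm_on_eq_LINT L2_on_def)
qed

lemma L2_on_integrable:
  assumes "L2_on a b G"
  shows "integrable (lebesgue_on {a..b}) G" "G integrable_on {a..b}"
  using L2_on_mult[OF assms L2_on_continuous[of a b "\<lambda>_. 1"]] by simp_all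

lemma L2_on_mult_continuous:
  assumes G: "L2_on a b G" and E: "continuous_on {a..b} E"
  shows "L2_on a b (\<lambda>x. G x * E x)"
proof -
  obtain B where B: "\<And>x. x \<in> {a..b} \<Longrightarrow> cmod (E x) \<le> B"
    using continuous_on_interval_bounded[OF E] by blast
  have meas: "(\<lambda>x. G x * E x) \<in> borel_measurable (lebesgue_on {a..b})"
    using G continuous_imp_measurable_on_sets_lebesgue[OF E] unfolding L2_on_def
    by (intro borel_measurable_times) auto
  have "integrable (lebesgue_on {a..b}) (\<lambda>x. (cmod (G x * E x))\<^sup>2)"
  proof (rule Bochner_Integration.integrable_bound)
    show "integrable (lebesgue_on {a..b}) (\<lambda>x. B\<^sup>2 * (cmod (G x))\<^sup>2)"
      using G by (simp add: L2_on_def)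
    show "(\<lambda>x. (cmod (G x * E x))\<^sup>2) \<in> borel_measurable (lebesgue_on {a..b})"
      using meas by measurable
    have "(cmod (G x * E x))\<^sup>2 \<le> B\<^sup>2 * (cmod (G x))\<^sup>2" if "x \<in> {a..b}" for x
      unfolding norm_mult power_mult_distrib
      using power_mono[OF B[OF that] norm_ge_zero, of 2]
      by (subst mult.commute) (intro mult_right_mono, auto)
    then show "AE x in lebesgue_on {a..b}. norm ((cmod (G x * E x))\<^sup>2) \<le> norm (B\<^sup>2 * (cmod (G x))\<^sup>2)"
      by (intro AE_I2) simp
  qed
  with meas show ?thesis by (simp add: L2_on_def)
qed

lemma L2_on_diff:
  assumes G: "L2_on a b G" and H: "L2_on a b H"
  shows "L2_on a b (\<lambda>x. G x - H x)"
proof -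
  have meas: "(\<lambda>x. G x - H x) \<in> borel_measurable (lebesgue_on {a..b})"
    using G H unfolding L2_on_def by (intro borel_measurable_diff) auto
  have "integrable (lebesgue_on {a..b}) (\<lambda>x. (cmod (G x - H x))\<^sup>2)"
  proof (rule Bochner_Integration.integrable_bound)
    show "integrable (lebesgue_on {a..b}) (\<lambda>x. 2 * (cmod (G x))\<^sup>2 + 2 * (cmod (H x))\<^sup>2)"
      using G H by (simp add: L2_on_def)
    show "(\<lambda>x. (cmod (G x - H x))\<^sup>2) \<in> borel_measurable (lebesgue_on {a..b})"
      using meas by measurable
    have "(cmod (G x - H x))\<^sup>2 \<le> 2 * (cmod (G x))\<^sup>2 + 2 * (cmod (H x))\<^sup>2" for x
    proof -
      have "(cmod (G x - H x))\<^sup>2 \<le> (cmod (G x) + cmod (H x))\<^sup>2"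
        by (intro power_mono norm_triangle_ineq4) simp
      also have "\<dots> \<le> 2 * (cmod (G x))\<^sup>2 + 2 * (cmod (H x))\<^sup>2"
        using sum_squares_bound[of "cmod (G x)" "cmod (H x)"] by (simp add: power2_eq_square algebra_simps)
      finally show ?thesis .
    qed
    then show "AE x in lebesgue_on {a..b}. norm ((cmod (G x - H x))\<^sup>2) \<le> norm (2 * (cmod (G x))\<^sup>2 + 2 * (cmod (H x))\<^sup>2)"
      by (intro AE_I2) simp
  qed
  with meas show ?thesis by (simp add: L2_on_def)
qed

section \<open>Functions with a square-integrable derivative\<close>

text \<open>
  \<open>G\<close> is an almost everywhere derivative of \<open>F\<close> with respect to which \<open>F\<close> can be integrated by parts. Its
  values on a null set are left open, as they are for the derivative of highest order in \<^const>\<open>sobolev\<close>.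
\<close>

definition has_L2_derivative :: "real \<Rightarrow> real \<Rightarrow> (real \<Rightarrow> complex) \<Rightarrow> (real \<Rightarrow> complex) \<Rightarrow> bool" where
  "has_L2_derivative a b F G \<longleftrightarrow> absolutely_continuous_on a b F \<and> L2_on a b G \<and>
     (\<exists>N. negligible N \<and> (\<forall>x\<in>{a..b} - N. (F has_vector_derivative G x) (at x within {a..b})))"

lemma has_L2_derivative_imp_continuous_on:
  "has_L2_derivative a b F G \<Longrightarrow> continuous_on {a..b} F"
  unfolding has_L2_derivative_def by (blast intro: absolutely_continuous_on_imp_continuous_on)

lemma has_L2_derivative_subinterval:
  assumes "has_L2_derivative a b F G" "a \<le> c" "d \<le> b"
  shows "has_L2_derivative c d F G"
proof -
  obtain N where N: "negligible N" "\<forall>x\<in>{a..b} - N. (F has_vector_derivative G x) (at x within {a..b})"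
    using assms(1) unfolding has_L2_derivative_def by blast
  have sub: "{c..d} \<subseteq> {a..b}" using assms by auto
  then have "\<forall>x\<in>{c..d} - N. (F has_vector_derivative G x) (at x within {c..d})"
    using N(2) by (blast intro: has_vector_derivative_within_subset)
  with N(1) assms show ?thesis
    unfolding has_L2_derivative_def
    by (blast intro: absolutely_continuous_on_subinterval L2_on_subinterval)
qed

lemma integral_has_L2_derivative:
  assumes "has_L2_derivative a b F G" "a \<le> b"
  shows "(G has_integral (F b - F a)) {a..b}"
  using assms unfolding has_L2_derivative_def
  by (blast intro: integral_absolutely_continuous_on)

lemma C1_imp_Lipschitz:
  fixes E :: "real \<Rightarrow> complex"
  assumes E: "\<And>x. x \<in> {a..b} \<Longrightarrow> (E has_vector_derivative E' x) (at x within {a..b})"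
    and E': "continuous_on {a..b} E'"
  obtains L where "\<And>x y. x \<in> {a..b} \<Longrightarrow> y \<in> {a..b} \<Longrightarrow> cmod (E y - E x) \<le> L * \<bar>y - x\<bar>"
proof -
  obtain L where L: "\<And>x. x \<in> {a..b} \<Longrightarrow> cmod (E' x) \<le> L"
    using continuous_on_interval_bounded[OF E'] by blast
  have "cmod (E y - E x) \<le> L * \<bar>y - x\<bar>" if "x \<in> {a..b}" "y \<in> {a..b}" for x y
  proof -
    have "norm (E y - E x) \<le> L * norm (y - x)"
    proof (rule differentiable_bound[where S = "{a..b}"])
      show "(E has_derivative (\<lambda>h. h *\<^sub>R E' z)) (at z within {a..b})" if "z \<in> {a..b}" for z
        using E[OF that] by (simp add: has_vector_derivative_def)
      show "onorm (\<lambda>h. h *\<^sub>R E' z) \<le> L" if "z \<in> {a..b}" for z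
      proof (rule onorm_le)
        fix h :: real
        show "norm (h *\<^sub>R E' z) \<le> L * norm h"
          using mult_right_mono[OF L[OF that], of "\<bar>h\<bar>"] by (simp add: mult.commute)
      qed
    qed (use that in auto)
    then show ?thesis by simp
  qed
  then show thesis by (rule that)
qed

lemma has_L2_derivative_mult_C1:
  assumes F: "has_L2_derivative a b F G"
    and E: "\<And>x. x \<in> {a..b} \<Longrightarrow> (E has_vector_derivative E' x) (at x within {a..b})"
    and E': "continuous_on {a..b} E'"
  shows "has_L2_derivative a b (\<lambda>x. F x * E x) (\<lambda>x. F x * E' x + G x * E x)"
proof -
  obtain L where L: "\<And>x y. x \<in> {a..b} \<Longrightarrow> y \<in> {a..b} \<Longrightarrow> cmod (E y - E x) \<le> L * \<bar>y - x\<bar>"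
    using C1_imp_Lipschitz[OF E E'] by blast
  have cE: "continuous_on {a..b} E"
    by (rule has_vector_derivative_imp_continuous_on[OF E])
  obtain B where B: "\<And>x. x \<in> {a..b} \<Longrightarrow> cmod (E x) \<le> B"
    using continuous_on_interval_bounded[OF cE] by blast
  obtain N where N: "negligible N" "\<forall>x\<in>{a..b} - N. (F has_vector_derivative G x) (at x within {a..b})"
    using F unfolding has_L2_derivative_def by blast
  have ac: "absolutely_continuous_on a b (\<lambda>x. F x * E x)"
    using F absolutely_continuous_on_mult_Lipschitz[OF _ B L] unfolding has_L2_derivative_def by blast
  have der: "\<forall>x\<in>{a..b} - N. ((\<lambda>x. F x * E x) has_vector_derivative F x * E' x + G x * E x) (at x within {a..b})"
    using N(2) E by (auto intro!: has_vector_derivative_mult)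
  have "L2_on a b (\<lambda>x. G x * E x - - (F x * E' x))"
  proof (rule L2_on_diff)
    show "L2_on a b (\<lambda>x. G x * E x)"
      using F cE unfolding has_L2_derivative_def by (blast intro: L2_on_mult_continuous)
    show "L2_on a b (\<lambda>x. - (F x * E' x))"
      using has_L2_derivative_imp_continuous_on[OF F] E' by (intro L2_on_continuous continuous_intros)
  qed
  then have "L2_on a b (\<lambda>x. F x * E' x + G x * E x)" by (simp add: add.commute)
  with ac der N(1) show ?thesis unfolding has_L2_derivative_def by blast
qed

lemma integral_by_parts_L2:
  assumes F: "has_L2_derivative a b F G" and "a \<le> b"
    and E: "\<And>x. x \<in> {a..b} \<Longrightarrow> (E has_vector_derivative E' x) (at x within {a..b})"
    and E': "continuous_on {a..b} E'"
  shows "integral {a..b} (\<lambda>x. F x * E' x) = F b * E b - F a * E a - integral {a..b} (\<lambda>x. G x * E x)"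
proof -
  have cE: "continuous_on {a..b} E"
    by (rule has_vector_derivative_imp_continuous_on[OF E])
  have "((\<lambda>x. F x * E' x + G x * E x) has_integral (F b * E b - F a * E a)) {a..b}"
    by (rule integral_has_L2_derivative[OF has_L2_derivative_mult_C1[OF F E E'] \<open>a \<le> b\<close>])
  moreover have "(\<lambda>x. F x * E' x) integrable_on {a..b}"
    using has_L2_derivative_imp_continuous_on[OF F] E'
    by (intro integrable_continuous_real continuous_intros)
  moreover have "(\<lambda>x. G x * E x) integrable_on {a..b}"
    using F L2_on_mult(2) L2_on_continuous[OF cE] unfolding has_L2_derivative_def by blast
  ultimately have "integral {a..b} (\<lambda>x. F x * E' x) + integral {a..b} (\<lambda>x. G x * E x) = F b * E b - F a * E a"
    using integral_add integral_unique by metis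
  then show ?thesis by (simp add: algebra_simps)
qed

lemma C1_imp_has_L2_derivative:
  assumes E: "\<And>x. x \<in> {a..b} \<Longrightarrow> (E has_vector_derivative E' x) (at x within {a..b})"
    and E': "continuous_on {a..b} E'"
  shows "has_L2_derivative a b E E'"
proof -
  have "absolutely_continuous_on a b (\<lambda>_. 1)"
    unfolding absolutely_continuous_on_def by (auto intro: exI[of _ 1])
  moreover have "L2_on a b (\<lambda>_. 0)" by (simp add: L2_on_continuous)
  ultimately have "has_L2_derivative a b (\<lambda>_. 1) (\<lambda>_. 0)"
    unfolding has_L2_derivative_def by (auto intro!: exI[of _ "{}"])
  from has_L2_derivative_mult_C1[OF this E E'] show ?thesis by simp
qed

text \<open>
  Derivatives of order less than \<open>s - 1\<close> are continuously differentiable; at order \<open>s - 1\<close> only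
  almost everywhere differentiability of absolutely continuous functions is available.
\<close>

lemma sobolev_has_L2_derivative:
  assumes f: "f \<in> sobolev s" and "l < s"
  shows "has_L2_derivative 0 1 (deriv01 l f) (deriv01 (Suc l) f)"
proof -
  have diff: "deriv01 l f differentiable (at x within {0..1})" if "l < s - 1" "x \<in> {0..1}" for l x
    using f that unfolding sobolev_def by blast
  have ac: "absolutely_continuous_on 0 1 (deriv01 (s - 1) f)"
    and sq: "L2_on 0 1 (deriv01 s f)"
    using f unfolding sobolev_def square_integrable01_def L2_on_def by blast+
  show ?thesis
  proof (cases "l = s - 1")
    case True
    then have s: "Suc l = s" using \<open>l < s\<close> by simp
    define N where "N = {x \<in> {0..1}. \<not> deriv01 l f differentiable (at x within {0..1})}"
    have "negligible N"
      unfolding N_def by (rule absolutely_continuous_on_differentiable_ae) (use ac True in simp)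
    moreover have "\<forall>x\<in>{0..1} - N. (deriv01 l f has_vector_derivative deriv01 (Suc l) f x) (at x within {0..1})"
      unfolding N_def by (auto simp: vector_derivative_works[symmetric])
    ultimately show ?thesis
      using ac sq s True unfolding has_L2_derivative_def by auto
  next
    case False
    then have l: "l < s - 1" using \<open>l < s\<close> by simp
    show ?thesis
    proof (rule C1_imp_has_L2_derivative)
      show "(deriv01 l f has_vector_derivative deriv01 (Suc l) f x) (at x within {0..1})"
        if "x \<in> {0..1}" for x
        using diff[OF l that] by (simp add: vector_derivative_works[symmetric])
      show "continuous_on {0..1} (deriv01 (Suc l) f)"
      proof (cases "Suc l = s - 1")
        case True
        then show ?thesis using absolutely_continuous_on_imp_continuous_on[OF ac] by simp
      next
        case False
        with l have "Suc l < s - 1" by simp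
        then show ?thesis
          unfolding continuous_on_eq_continuous_within
          using diff differentiable_imp_continuous_within by blast
      qed
    qed
  qed
qed

section \<open>Fourier coefficients of Sobolev functions\<close>

text \<open>
  The exponent carries a minus sign so that \<^const>\<open>fourier_integral\<close> integrates against \<open>wave\<close> itself and
  not against its conjugate.
\<close>

definition wave :: "int \<Rightarrow> real \<Rightarrow> complex" where
  "wave j x = exp (- 2 * of_real pi * \<i> * of_int j * of_real x)"

definition freq :: "int \<Rightarrow> complex" where
  "freq j = 2 * of_real pi * \<i> * of_int j"

lemma norm_freq: "cmod (freq j) = 2 * pi * real_of_int \<bar>j\<bar>"
  by (simp add: freq_def norm_mult)

lemma freq_eq_0_iff [simp]: "freq j = 0 \<longleftrightarrow> j = 0"
  by (simp add: freq_def)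

lemma wave_eq_cis: "wave j x = cis (- 2 * pi * of_int j * x)"
  by (simp add: wave_def cis_conv_exp mult_ac)

lemma norm_wave [simp]: "cmod (wave j x) = 1"
  by (simp add: wave_eq_cis)

lemma wave_add: "wave (i + j) x = wave i x * wave j x"
  by (simp add: wave_eq_cis cis_mult algebra_simps)

lemma cnj_wave: "cnj (wave j x) = wave (- j) x"
  by (simp add: wave_eq_cis cis_cnj)

lemma wave_0_left [simp]: "wave 0 x = 1"
  by (simp add: wave_eq_cis)

lemma wave_of_int [simp]: "wave j (of_int m) = 1"
proof -
  have "cis (2 * pi * of_int (- (j * m))) = 1" by (rule cis_multiple_2pi) simp
  then show ?thesis by (simp add: wave_eq_cis mult.assoc)
qed

lemma wave_0 [simp]: "wave j 0 = 1" and wave_1 [simp]: "wave j 1 = 1"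
  using wave_of_int[of j 0] wave_of_int[of j 1] by simp_all

lemma wave_has_vector_derivative:
  "(wave j has_vector_derivative - freq j * wave j x) (at x within S)"
proof -
  have "((\<lambda>z. exp (- freq j * z)) has_field_derivative - freq j * exp (- freq j * of_real x)) (at (of_real x))"
    by (auto intro!: derivative_eq_intros)
  from has_vector_derivative_real_field[OF this, of S]
  have "((\<lambda>x. exp (- freq j * of_real x)) has_vector_derivative - freq j * exp (- freq j * of_real x)) (at x within S)" .
  moreover have "wave j = (\<lambda>x. exp (- freq j * of_real x))"
    by (simp add: fun_eq_iff wave_def freq_def mult_ac)
  ultimately show ?thesis by (simp only:)
qed

lemma continuous_on_wave [continuous_intros]: "continuous_on S (wave j)"
  by (rule has_vector_derivative_imp_continuous_on[OF wave_has_vector_derivative])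

lemma has_integral_wave: "(wave j has_integral (if j = 0 then 1 else 0)) {0..1}"
proof (cases "j = 0")
  case True
  have "((\<lambda>x::real. 1 :: complex) has_integral 1) {0..1}"
    using has_integral_const_real[of "1 :: complex" 0 1] by simp
  moreover have "wave 0 = (\<lambda>x. 1)" by (simp add: fun_eq_iff)
  ultimately show ?thesis using True by simp
next
  case False
  have "((\<lambda>x. wave j x / (- freq j)) has_vector_derivative wave j x) (at x within {0..1})" for x
    using has_vector_derivative_divide[OF wave_has_vector_derivative[where j = j and x = x and S = "{0..1}"], of "- freq j"] False
    by simp
  then have "(wave j has_integral (wave j 1 / (- freq j) - wave j 0 / (- freq j))) {0..1}"
    by (intro fundamental_theorem_of_calculus) auto
  with False show ?thesis by simp
qed

text \<open>
  Pythagoras' theorem for the orthonormal waves.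
\<close>

lemma L2_norm_wave_sum:
  assumes "finite J"
  shows "L2_norm_on 0 1 (\<lambda>x. \<Sum>j\<in>J. c j * wave j x) = sqrt (\<Sum>j\<in>J. (cmod (c j))\<^sup>2)"
proof -
  have "((\<lambda>x. \<Sum>i\<in>J. \<Sum>j\<in>J. c i * cnj (c j) * wave (i - j) x) has_integral
         (\<Sum>i\<in>J. \<Sum>j\<in>J. c i * cnj (c j) * (if i - j = 0 then 1 else 0))) {0..1}"
    by (intro has_integral_sum[OF assms] has_integral_mult_right has_integral_wave)
  moreover have "(\<Sum>i\<in>J. \<Sum>j\<in>J. c i * cnj (c j) * (if i - j = 0 then 1 else 0)) = of_real (\<Sum>j\<in>J. (cmod (c j))\<^sup>2)"
    using assms by (simp add: if_distrib cong: if_cong) (simp add: complex_norm_square[symmetric])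
  moreover have "(\<Sum>i\<in>J. \<Sum>j\<in>J. c i * cnj (c j) * wave (i - j) x) = of_real ((cmod (\<Sum>j\<in>J. c j * wave j x))\<^sup>2)" for x
  proof -
    have "of_real ((cmod (\<Sum>j\<in>J. c j * wave j x))\<^sup>2) = (\<Sum>i\<in>J. c i * wave i x) * (\<Sum>j\<in>J. cnj (c j) * wave (- j) x)"
      unfolding complex_norm_square by (simp add: cnj_wave)
    also have "\<dots> = (\<Sum>i\<in>J. \<Sum>j\<in>J. c i * cnj (c j) * wave (i - j) x)"
      unfolding sum_product using wave_add by (intro sum.cong refl) (simp add: mult_ac flip: wave_add)
    finally show ?thesis ..
  qed
  ultimately have "((\<lambda>x. complex_of_real ((cmod (\<Sum>j\<in>J. c j * wave j x))\<^sup>2)) has_integral of_real (\<Sum>j\<in>J. (cmod (c j))\<^sup>2)) {0..1}"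
    by simp
  from has_integral_linear[OF this bounded_linear_Re]
  have "((\<lambda>x. (cmod (\<Sum>j\<in>J. c j * wave j x))\<^sup>2) has_integral (\<Sum>j\<in>J. (cmod (c j))\<^sup>2)) {0..1}"
    by (simp add: o_def)
  then show ?thesis unfolding L2_norm_on_def by (simp add: integral_unique)
qed

lemma fourier_integral_eq_integral:
  assumes "L2_on 0 1 F"
  shows "fourier_integral j F = integral {0..1} (\<lambda>x. F x * wave j x)"
  unfolding fourier_integral_def wave_def[symmetric]
  by (rule lebesgue_integral_eq_integral)
     (use L2_on_mult(1)[OF assms L2_on_continuous] continuous_on_wave in auto)

lemma fourier_integral_L2_derivative:
  assumes "has_L2_derivative 0 1 F G"
  shows "freq j * fourier_integral j F = fourier_integral j G - (F 1 - F 0)"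
proof -
  have "integral {0..1} (\<lambda>x. F x * (- freq j * wave j x)) = F 1 * wave j 1 - F 0 * wave j 0 - integral {0..1} (\<lambda>x. G x * wave j x)"
    by (rule integral_by_parts_L2[OF assms _ wave_has_vector_derivative]) (auto intro!: continuous_intros)
  moreover have "integral {0..1} (\<lambda>x. F x * (- freq j * wave j x)) = - freq j * integral {0..1} (\<lambda>x. F x * wave j x)"
    by (subst integral_mult_right[symmetric]) (simp add: mult_ac)
  moreover have "L2_on 0 1 F" "L2_on 0 1 G"
    using assms has_L2_derivative_imp_continuous_on[OF assms]
    by (auto simp: has_L2_derivative_def intro: L2_on_continuous)
  ultimately have "- freq j * fourier_integral j F = F 1 - F 0 - fourier_integral j G"
    by (simp add: fourier_integral_eq_integral)
  then show ?thesis by (simp add: minus_equation_iff[of "freq j * _"])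
qed

text \<open>
  Integration by parts \<open>l\<close> times. The boundary terms involve only function and derivative values at the
  end points, which an algorithm may use.
\<close>

lemma fourier_integral_sobolev:
  assumes f: "f \<in> sobolev s" and j: "j \<noteq> 0" and "l \<le> s"
  shows "fourier_integral j f = fourier_integral j (deriv01 l f) / freq j ^ l -
           (\<Sum>m<l. (deriv01 m f 1 - deriv01 m f 0) / freq j ^ Suc m)"
  using \<open>l \<le> s\<close>
proof (induction l)
  case (Suc l)
  have "freq j * fourier_integral j (deriv01 l f) =
      fourier_integral j (deriv01 (Suc l) f) - (deriv01 l f 1 - deriv01 l f 0)"
    by (rule fourier_integral_L2_derivative[OF sobolev_has_L2_derivative[OF f]]) (use Suc in simp)
  then have "fourier_integral j (deriv01 l f) =
      (fourier_integral j (deriv01 (Suc l) f) - (deriv01 l f 1 - deriv01 l f 0)) / freq j"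
    using j by (simp add: field_simps)
  moreover have "fourier_integral j f = fourier_integral j (deriv01 l f) / freq j ^ l -
           (\<Sum>m<l. (deriv01 m f 1 - deriv01 m f 0) / freq j ^ Suc m)"
    using Suc by simp
  ultimately have "fourier_integral j f =
      (fourier_integral j (deriv01 (Suc l) f) - (deriv01 l f 1 - deriv01 l f 0)) / freq j / freq j ^ l -
           (\<Sum>m<l. (deriv01 m f 1 - deriv01 m f 0) / freq j ^ Suc m)"
    by (simp only:)
  then show ?case by (simp add: diff_divide_distrib add_divide_distrib algebra_simps)
qed simp

section \<open>The trapezoidal rule and Poisson summation\<close>

text \<open>
  The sawtooth \<open>t - 1 / 2\<close> on \<open>[0, 1]\<close> minus the \<open>n\<close>-th partial sum of its Fourier series.
\<close>

definition sawtooth_error :: "nat \<Rightarrow> real \<Rightarrow> real" where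
  "sawtooth_error n t = t - 1 / 2 + (\<Sum>q=1..n. sin (2 * pi * real q * t) / (pi * real q))"

definition dirichlet_kernel :: "nat \<Rightarrow> real \<Rightarrow> real" where
  "dirichlet_kernel n t = 1 + (\<Sum>q=1..n. 2 * cos (2 * pi * real q * t))"

lemma sawtooth_error_deriv:
  "(sawtooth_error n has_real_derivative dirichlet_kernel n t) (at t within S)"
  unfolding sawtooth_error_def dirichlet_kernel_def
  by (auto intro!: derivative_eq_intros sum.cong)

lemma sawtooth_error_ends: "sawtooth_error n 0 = - 1 / 2" "sawtooth_error n 1 = 1 / 2"
proof -
  have "sin (2 * pi * real q) = 0" for q
    using sin_2npi[of q] by (simp add: mult_ac)
  then show "sawtooth_error n 0 = - 1 / 2" "sawtooth_error n 1 = 1 / 2"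
    by (simp_all add: sawtooth_error_def)
qed

lemma dirichlet_kernel_periodic: "dirichlet_kernel n (t - real i) = dirichlet_kernel n t"
proof -
  have "cos (2 * pi * real q * (t - real i)) = cos (2 * pi * real q * t)" for q
  proof -
    have "cos (2 * pi * real q * (t - real i)) = cos (2 * pi * real q * t - 2 * real (q * i) * pi)"
      by (simp add: algebra_simps)
    also have "\<dots> = cos (2 * pi * real q * t)"
      by (simp add: cos_diff cos_2npi sin_2npi del: of_nat_mult)
    finally show ?thesis .
  qed
  then show ?thesis by (simp add: dirichlet_kernel_def)
qed

lemma has_integral_cos_int:
  fixes m :: int
  assumes "m \<noteq> 0"
  shows "((\<lambda>t. cos (2 * pi * of_int m * t)) has_integral 0) {0..1::real}"
proof -
  have "((\<lambda>t. sin (2 * pi * of_int m * t) / (2 * pi * of_int m)) has_real_derivative cos (2 * pi * of_int m * t)) (at t within {0..1})" for t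
    using assms by (auto intro!: derivative_eq_intros)
  then have "((\<lambda>t. cos (2 * pi * of_int m * t)) has_integral
      (sin (2 * pi * of_int m * 1) / (2 * pi * of_int m) - sin (2 * pi * of_int m * 0) / (2 * pi * of_int m))) {0..1}"
    by (intro fundamental_theorem_of_calculus) (auto simp: has_real_derivative_iff_has_vector_derivative[symmetric])
  moreover have "sin (2 * pi * of_int m) = 0"
    by (rule sin_int_2pin)
  ultimately show ?thesis by simp
qed

lemma has_integral_sin_sin:
  assumes "p \<ge> 1" "q \<ge> (1::nat)"
  shows "((\<lambda>t. sin (2 * pi * real p * t) * sin (2 * pi * real q * t)) has_integral (if p = q then 1 / 2 else 0)) {0..1::real}"
proof -
  have eq: "sin (2 * pi * real p * t) * sin (2 * pi * real q * t) =
      (cos (2 * pi * of_int (int p - int q) * t) - cos (2 * pi * of_int (int p + int q) * t)) / 2" for t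
    unfolding sin_times_sin by (simp add: algebra_simps)
  have "((\<lambda>t. cos (2 * pi * of_int (int p - int q) * t)) has_integral (if p = q then 1 else 0)) {0..1::real}"
    using has_integral_cos_int[of "int p - int q"] has_integral_const_real[of "1::real" 0 1] by auto
  moreover have "((\<lambda>t. cos (2 * pi * of_int (int p + int q) * t)) has_integral 0) {0..1::real}"
    using assms by (intro has_integral_cos_int) linarith
  ultimately have "((\<lambda>t. (cos (2 * pi * of_int (int p - int q) * t) - cos (2 * pi * of_int (int p + int q) * t)) / 2)
      has_integral ((if p = q then 1 else 0) - 0) / 2) {0..1::real}"
    by (intro has_integral_divide has_integral_diff)
  then show ?thesis unfolding eq by (auto split: if_splits)
qed

lemma has_integral_linear_sin:
  assumes "q \<ge> (1::nat)"
  shows "((\<lambda>t. (t - 1 / 2) * sin (2 * pi * real q * t)) has_integral (- 1 / (2 * pi * q))) {0..1::real}"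
proof -
  define w where "w = 2 * pi * real q"
  have w: "w > 0" using assms by (simp add: w_def)
  have per: "sin w = 0" "cos w = 1"
    unfolding w_def using sin_2npi[of q] cos_2npi[of q] by (simp_all add: mult_ac)
  have "((\<lambda>t. sin (w * t) / w\<^sup>2 - (t - 1 / 2) * cos (w * t) / w) has_real_derivative (t - 1 / 2) * sin (w * t)) (at t within {0..1})" for t
    using w by (auto intro!: derivative_eq_intros simp: field_simps power2_eq_square)
  then have "((\<lambda>t. (t - 1 / 2) * sin (w * t)) has_integral
      ((sin (w * 1) / w\<^sup>2 - (1 - 1 / 2) * cos (w * 1) / w) - (sin (w * 0) / w\<^sup>2 - (0 - 1 / 2) * cos (w * 0) / w))) {0..1}"
    by (intro fundamental_theorem_of_calculus) (auto simp: has_real_derivative_iff_has_vector_derivative[symmetric])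
  then show ?thesis using per by (simp add: w_def field_simps)
qed

text \<open>
  Each further term of the Fourier series is orthogonal to the earlier ones and removes its own squared
  norm \<open>1 / (2 \<pi>\<^sup>2 q\<^sup>2)\<close> from the squared norm 1/12 of the sawtooth.
\<close>

lemma has_integral_sawtooth_error_sq:
  "((\<lambda>t. (sawtooth_error n t)\<^sup>2) has_integral (1 / 12 - (\<Sum>q=1..n. 1 / (2 * pi\<^sup>2 * (real q)\<^sup>2)))) {0..1}"
proof (induction n)
  case 0
  have "((\<lambda>t. (t - 1 / 2) ^ 3 / 3) has_real_derivative (t - 1 / 2)\<^sup>2) (at t within {0..1})" for t :: real
    by (auto intro!: derivative_eq_intros simp: power2_eq_square)
  then have "((\<lambda>t. (t - 1 / 2)\<^sup>2) has_integral ((1 - 1 / 2) ^ 3 / 3 - (0 - 1 / 2) ^ 3 / 3)) {0..1::real}"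
    by (intro fundamental_theorem_of_calculus) (auto simp: has_real_derivative_iff_has_vector_derivative[symmetric])
  then show ?case by (simp add: sawtooth_error_def power3_eq_cube)
next
  case (Suc n)
  define s where "s = (\<lambda>q t. sin (2 * pi * real q * t))"
  define N where "N = Suc n"
  have "N \<ge> 1" by (simp add: N_def)
  have cross: "((\<lambda>t. sawtooth_error n t * s N t) has_integral (- 1 / (2 * pi * N) + 0)) {0..1}"
  proof -
    have "((\<lambda>t. \<Sum>q=1..n. s q t * s N t / (pi * real q)) has_integral (\<Sum>q=1..n. (if q = N then 1 / 2 else 0) / (pi * real q))) {0..1}"
      unfolding s_def using \<open>N \<ge> 1\<close>
      by (intro has_integral_sum has_integral_divide has_integral_sin_sin) auto
    moreover have "(\<Sum>q=1..n. (if q = N then 1 / 2 else 0) / (pi * real q)) = 0"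
      by (intro sum.neutral) (auto simp: N_def)
    ultimately have "((\<lambda>t. (t - 1 / 2) * s N t + (\<Sum>q=1..n. s q t * s N t / (pi * real q))) has_integral (- 1 / (2 * pi * N) + 0)) {0..1}"
      unfolding s_def using has_integral_linear_sin[OF \<open>N \<ge> 1\<close>] by (intro has_integral_add) simp_all
    moreover have "(t - 1 / 2) * s N t + (\<Sum>q=1..n. s q t * s N t / (pi * real q)) = sawtooth_error n t * s N t" for t
      by (simp add: sawtooth_error_def s_def distrib_right sum_distrib_right)
    ultimately show ?thesis by simp
  qed
  have "((\<lambda>t. (sawtooth_error n t)\<^sup>2 + 2 / (pi * N) * (sawtooth_error n t * s N t) + 1 / (pi * N)\<^sup>2 * (s N t * s N t)) has_integral
      ((1 / 12 - (\<Sum>q=1..n. 1 / (2 * pi\<^sup>2 * (real q)\<^sup>2))) + 2 / (pi * N) * (- 1 / (2 * pi * N) + 0) + 1 / (pi * N)\<^sup>2 * (1 / 2))) {0..1}"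
    using has_integral_sin_sin[OF \<open>N \<ge> 1\<close> \<open>N \<ge> 1\<close>]
    by (intro has_integral_add has_integral_mult_right Suc.IH cross) (simp add: s_def)
  moreover have "(sawtooth_error n t)\<^sup>2 + 2 / (pi * N) * (sawtooth_error n t * s N t) + 1 / (pi * N)\<^sup>2 * (s N t * s N t) =
      (sawtooth_error (Suc n) t)\<^sup>2" for t
  proof -
    have "sawtooth_error (Suc n) t = sawtooth_error n t + 1 / (pi * N) * s N t"
      by (simp add: sawtooth_error_def s_def N_def)
    then show ?thesis by (simp add: power2_sum power_mult_distrib power_divide power2_eq_square algebra_simps)
  qed
  moreover have "(1 / 12 - (\<Sum>q=1..n. 1 / (2 * pi\<^sup>2 * (real q)\<^sup>2))) + 2 / (pi * N) * (- 1 / (2 * pi * N) + 0) + 1 / (pi * N)\<^sup>2 * (1 / 2) =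
      1 / 12 - (\<Sum>q=1..Suc n. 1 / (2 * pi\<^sup>2 * (real q)\<^sup>2))"
  proof -
    have "2 / (pi * N) * (- 1 / (2 * pi * N) + 0) + 1 / (pi * N)\<^sup>2 * (1 / 2) = - (1 / (2 * pi\<^sup>2 * (real N)\<^sup>2))"
      by (simp add: power_mult_distrib power2_eq_square divide_simps)
    then show ?thesis by (simp add: N_def)
  qed
  ultimately show ?case by (simp only:)
qed

text \<open>
  The squared norms removed add up to 1/12 because the sum of \<open>1 / q\<^sup>2\<close> is \<open>\<pi>\<^sup>2 / 6\<close>.
\<close>

lemma sawtooth_error_tendsto_0: "(\<lambda>n. integral {0..1} (\<lambda>t. (sawtooth_error n t)\<^sup>2)) \<longlonglongrightarrow> 0"
proof -
  have "(\<lambda>n. \<Sum>q<n. 1 / (real q + 1)\<^sup>2) \<longlonglongrightarrow> pi\<^sup>2 / 6"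
    using inverse_squares_sums by (simp add: sums_def add.commute)
  then have "(\<lambda>n. 1 / 12 - 1 / (2 * pi\<^sup>2) * (\<Sum>q<n. 1 / (real q + 1)\<^sup>2)) \<longlonglongrightarrow> 1 / 12 - 1 / (2 * pi\<^sup>2) * (pi\<^sup>2 / 6)"
    by (intro tendsto_intros)
  moreover have "1 / 12 - 1 / (2 * pi\<^sup>2) * (\<Sum>q<n. 1 / (real q + 1)\<^sup>2) = integral {0..1} (\<lambda>t. (sawtooth_error n t)\<^sup>2)" for n
  proof -
    have "(\<Sum>q=1..n. 1 / (2 * pi\<^sup>2 * (real q)\<^sup>2)) = (\<Sum>q<n. 1 / (2 * pi\<^sup>2 * (real (Suc q))\<^sup>2))"
      by (rule sum.reindex_bij_witness[of _ Suc "\<lambda>q. q - 1"]) auto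
    also have "\<dots> = 1 / (2 * pi\<^sup>2) * (\<Sum>q<n. 1 / (real q + 1)\<^sup>2)"
      by (simp add: sum_distrib_left add.commute)
    finally show ?thesis
      using integral_unique[OF has_integral_sawtooth_error_sq[of n]] by simp
  qed
  ultimately show ?thesis by simp
qed

lemma L2_norm_sawtooth_error:
  assumes "a < b"
  shows "L2_norm_on a b (\<lambda>x. of_real (sawtooth_error n ((x - a) / (b - a)))) =
         sqrt ((b - a) * integral {0..1} (\<lambda>t. (sawtooth_error n t)\<^sup>2))"
proof -
  define d where "d = b - a"
  have d: "d > 0" "b = a + d" using assms by (simp_all add: d_def)
  have int: "((\<lambda>t. (sawtooth_error n t)\<^sup>2) has_integral integral {0..1} (\<lambda>t. (sawtooth_error n t)\<^sup>2)) (cbox 0 1)"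
    using has_integral_sawtooth_error_sq[of n] by (simp add: has_integral_integral[symmetric] has_integral_integrable)
  have "((\<lambda>x. (sawtooth_error n ((1 / d) *\<^sub>R x + - a / d))\<^sup>2) has_integral
      (integral {0..1} (\<lambda>t. (sawtooth_error n t)\<^sup>2)) /\<^sub>R (1 / d) ^ DIM(real))
      (cbox ((0 - - a / d) /\<^sub>R (1 / d)) ((1 - - a / d) /\<^sub>R (1 / d)))"
    by (rule has_integral_affinity'[OF int]) (use d in simp)
  moreover have "(1 / d) *\<^sub>R x + - a / d = (x - a) / (b - a)" for x
    using d by (simp add: field_simps)
  moreover have "(0 - - a / d) /\<^sub>R (1 / d) = a" "(1 - - a / d) /\<^sub>R (1 / d) = b"
    using d by (simp_all add: field_simps)
  ultimately have "((\<lambda>x. (sawtooth_error n ((x - a) / (b - a)))\<^sup>2) has_integral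
      d * integral {0..1} (\<lambda>t. (sawtooth_error n t)\<^sup>2)) {a..b}"
    using d(1) unfolding box_real by simp
  then show ?thesis
    unfolding L2_norm_on_def d_def by (simp add: integral_unique)
qed

text \<open>
  The Dirichlet kernel is the derivative of \<^const>\<open>sawtooth_error\<close>, whose values at 0 and 1 are -1/2
  and 1/2. Integrating by parts leaves the trapezoidal value minus an integral that the Cauchy-Schwarz
  inequality bounds by the vanishing norm of the sawtooth error.
\<close>

lemma trapezoid_limit_interval:
  assumes F: "has_L2_derivative a b F G" and "a < b"
  shows "(\<lambda>n. integral {a..b} (\<lambda>x. F x * of_real (dirichlet_kernel n ((x - a) / (b - a)))))
           \<longlonglongrightarrow> of_real (b - a) * ((F a + F b) / 2)"
proof -
  define d where "d = b - a"
  have d: "d > 0" using assms by (simp add: d_def)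
  define E where "E = (\<lambda>n x. complex_of_real (sawtooth_error n ((x - a) / d)))"
  define E' where "E' = (\<lambda>n x. complex_of_real (dirichlet_kernel n ((x - a) / d) / d))"
  define r where "r = (\<lambda>n. integral {0..1} (\<lambda>t. (sawtooth_error n t)\<^sup>2))"
  have cE': "continuous_on {a..b} (E' n)" for n
    unfolding E'_def dirichlet_kernel_def using d by (intro continuous_intros) auto
  have dE: "(E n has_vector_derivative E' n x) (at x within {a..b})" for n x
  proof -
    have "((\<lambda>x. sawtooth_error n ((x - a) / d)) has_real_derivative dirichlet_kernel n ((x - a) / d) * (1 / d)) (at x within {a..b})"
      by (rule DERIV_chain2[OF sawtooth_error_deriv]) (use d in \<open>auto intro!: derivative_eq_intros\<close>)
    then show ?thesis
      unfolding E_def E'_def by (intro has_vector_derivative_of_real) (simp add: has_real_derivative_iff_has_vector_derivative)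
  qed
  have eq: "integral {a..b} (\<lambda>x. F x * of_real (dirichlet_kernel n ((x - a) / d))) =
      of_real d * ((F a + F b) / 2) - of_real d * integral {a..b} (\<lambda>x. G x * E n x)" for n
  proof -
    have "integral {a..b} (\<lambda>x. F x * E' n x) = F b * E n b - F a * E n a - integral {a..b} (\<lambda>x. G x * E n x)"
      by (rule integral_by_parts_L2[OF F _ dE cE']) (use assms in simp)
    moreover have "E n b = of_real (1 / 2)" "E n a = of_real (- 1 / 2)"
      using d unfolding E_def sawtooth_error_ends[of n, symmetric] by (simp_all add: d_def)
    moreover have "integral {a..b} (\<lambda>x. F x * of_real (dirichlet_kernel n ((x - a) / d))) = of_real d * integral {a..b} (\<lambda>x. F x * E' n x)"
      using d by (subst integral_mult_right[symmetric]) (simp add: E'_def)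
    ultimately have "integral {a..b} (\<lambda>x. F x * of_real (dirichlet_kernel n ((x - a) / d))) =
        of_real d * ((F a + F b) / 2 - integral {a..b} (\<lambda>x. G x * E n x))"
      by (simp add: add_divide_distrib)
    then show ?thesis by (simp only: right_diff_distrib)
  qed
  have "(\<lambda>n. integral {a..b} (\<lambda>x. G x * E n x)) \<longlonglongrightarrow> 0"
  proof (rule Lim_null_comparison)
    have "cmod (integral {a..b} (\<lambda>x. G x * E n x)) \<le> L2_norm_on a b G * sqrt (d * r n)" for n
    proof -
      have "continuous_on {a..b} (E n)"
        by (rule has_vector_derivative_imp_continuous_on[OF dE])
      then have "cmod (integral {a..b} (\<lambda>x. G x * E n x)) \<le> L2_norm_on a b G * L2_norm_on a b (E n)"
        using F by (intro L2_on_mult(3) L2_on_continuous[of a b "E n"]) (auto simp: has_L2_derivative_def)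
      also have "L2_norm_on a b (E n) = sqrt (d * r n)"
        unfolding E_def r_def d_def by (rule L2_norm_sawtooth_error[OF \<open>a < b\<close>])
      finally show ?thesis .
    qed
    then show "\<forall>\<^sub>F n in sequentially. norm (integral {a..b} (\<lambda>x. G x * E n x)) \<le> L2_norm_on a b G * sqrt (d * r n)"
      by simp
    have "(\<lambda>n. L2_norm_on a b G * sqrt (d * r n)) \<longlonglongrightarrow> L2_norm_on a b G * sqrt (d * 0)"
      unfolding r_def by (intro tendsto_intros sawtooth_error_tendsto_0)
    then show "(\<lambda>n. L2_norm_on a b G * sqrt (d * r n)) \<longlonglongrightarrow> 0" by simp
  qed
  then have "(\<lambda>n. of_real d * ((F a + F b) / 2) - of_real d * integral {a..b} (\<lambda>x. G x * E n x)) \<longlonglongrightarrow>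
      of_real d * ((F a + F b) / 2) - of_real d * 0"
    by (intro tendsto_intros)
  then show ?thesis unfolding d_def[symmetric] eq by simp
qed

lemma integral_split_equidistant:
  fixes g :: "real \<Rightarrow> complex"
  assumes "M \<ge> 1" and g: "continuous_on {0..1} g"
  shows "integral {0..1} g = (\<Sum>i<M. integral {real i / real M..real (Suc i) / real M} g)"
proof -
  have "integral {0..real m / real M} g = (\<Sum>i<m. integral {real i / real M..real (Suc i) / real M} g)" if "m \<le> M" for m
    using that
  proof (induction m)
    case (Suc m)
    have le: "real (Suc m) / real M \<le> 1" "real m / real M \<le> real (Suc m) / real M"
      using Suc.prems \<open>M \<ge> 1\<close> by (auto simp: divide_simps)
    have "integral {0..real (Suc m) / real M} g = integral {0..real m / real M} g + integral {real m / real M..real (Suc m) / real M} g"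
    proof (rule Henstock_Kurzweil_Integration.integral_combine[symmetric])
      have "continuous_on {0..real (Suc m) / real M} g"
        by (rule continuous_on_subset[OF g]) (use le in auto)
      then show "g integrable_on {0..real (Suc m) / real M}" by (rule integrable_continuous_real)
    qed (use le in auto)
    then show ?case using Suc by simp
  qed simp
  from this[of M] show ?thesis using \<open>M \<ge> 1\<close> by simp
qed

lemma trapezoid_limit:
  assumes F: "has_L2_derivative 0 1 F G" and "M \<ge> 1"
  shows "(\<lambda>n. integral {0..1} (\<lambda>x. F x * of_real (dirichlet_kernel n (real M * x))))
           \<longlonglongrightarrow> (\<Sum>i<M. (F (real i / real M) + F (real (Suc i) / real M)) / 2) / of_nat M"
proof -
  have piece: "(\<lambda>n. integral {real i / real M..real (Suc i) / real M} (\<lambda>x. F x * of_real (dirichlet_kernel n (real M * x))))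
      \<longlonglongrightarrow> of_real (1 / real M) * ((F (real i / real M) + F (real (Suc i) / real M)) / 2)" if "i < M" for i
  proof -
    define a b where "a = real i / real M" and "b = real (Suc i) / real M"
    have ab: "0 \<le> a" "a < b" "b \<le> 1" "b - a = 1 / real M"
      using that \<open>M \<ge> 1\<close> by (auto simp: a_def b_def divide_simps)
    have "(\<lambda>n. integral {a..b} (\<lambda>x. F x * of_real (dirichlet_kernel n ((x - a) / (b - a))))) \<longlonglongrightarrow> of_real (b - a) * ((F a + F b) / 2)"
      by (rule trapezoid_limit_interval[OF has_L2_derivative_subinterval[OF F] ab(2)]) (use ab in auto)
    moreover have "dirichlet_kernel n ((x - a) / (b - a)) = dirichlet_kernel n (real M * x)" for n x
    proof -
      have "(x - a) / (b - a) = real M * x - real i"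
        using \<open>M \<ge> 1\<close> unfolding ab(4) by (simp add: a_def field_simps)
      then show ?thesis by (simp add: dirichlet_kernel_periodic)
    qed
    ultimately show ?thesis unfolding ab(4) by (simp add: a_def b_def)
  qed
  have "integral {0..1} (\<lambda>x. F x * of_real (dirichlet_kernel n (real M * x))) =
      (\<Sum>i<M. integral {real i / real M..real (Suc i) / real M} (\<lambda>x. F x * of_real (dirichlet_kernel n (real M * x))))" for n
    using has_L2_derivative_imp_continuous_on[OF F]
    by (intro integral_split_equidistant[OF \<open>M \<ge> 1\<close>]) (auto simp: dirichlet_kernel_def intro!: continuous_intros)
  moreover have "(\<lambda>n. \<Sum>i<M. integral {real i / real M..real (Suc i) / real M} (\<lambda>x. F x * of_real (dirichlet_kernel n (real M * x))))
      \<longlonglongrightarrow> (\<Sum>i<M. of_real (1 / real M) * ((F (real i / real M) + F (real (Suc i) / real M)) / 2))"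
    by (intro tendsto_sum piece) simp
  ultimately show ?thesis by (simp add: sum_divide_distrib mult.commute)
qed

lemma wave_times_dirichlet_kernel:
  "wave k x * of_real (dirichlet_kernel n (real M * x)) =
     wave k x + (\<Sum>q=1..n. wave (k + int q * int M) x + wave (k - int q * int M) x)"
proof -
  have "wave k x * of_real (2 * cos (2 * pi * real q * (real M * x))) = wave (k + int q * int M) x + wave (k - int q * int M) x" for q
  proof -
    define u where "u = 2 * pi * real q * (real M * x)"
    have "wave (int q * int M) x = cis (- u)" "wave (- (int q * int M)) x = cis u"
      by (simp_all add: wave_eq_cis u_def mult_ac)
    then have "of_real (2 * cos u) = wave (int q * int M) x + wave (- (int q * int M)) x"
      by (simp add: complex_eq_iff)
    then show ?thesis
      unfolding u_def by (simp add: wave_add[symmetric] ring_distribs del: of_real_mult)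
  qed
  then show ?thesis
    by (simp add: dirichlet_kernel_def ring_distribs sum_distrib_left del: of_real_mult)
qed

text \<open>
  Poisson summation in the form needed for quadrature: the trapezoidal rule with \<open>M\<close> panels for the
  integrand of \<open>I\<^sub>k\<close> adds up all coefficients whose index is congruent to \<open>k\<close> modulo \<open>M\<close>.
\<close>

lemma fourier_sum_limit:
  fixes k :: int
  assumes F: "has_L2_derivative 0 1 F G" and M: "M \<ge> 1"
  defines "h \<equiv> (\<lambda>x. F x * wave k x)"
  shows "(\<lambda>n. fourier_integral k F +
            (\<Sum>q=1..n. fourier_integral (k + int q * int M) F + fourier_integral (k - int q * int M) F))
           \<longlonglongrightarrow> (\<Sum>i<M. (h (real i / real M) + h (real (Suc i) / real M)) / 2) / of_nat M"
proof -
  have cF: "continuous_on {0..1} F" by (rule has_L2_derivative_imp_continuous_on[OF F])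
  have h: "has_L2_derivative 0 1 h (\<lambda>x. F x * (- freq k * wave k x) + G x * wave k x)"
    unfolding h_def by (rule has_L2_derivative_mult_C1[OF F wave_has_vector_derivative]) (intro continuous_intros)
  have int: "(\<lambda>x. F x * wave j x) integrable_on {0..1}" for j
    using cF by (intro integrable_continuous_real continuous_intros)
  have "integral {0..1} (\<lambda>x. h x * of_real (dirichlet_kernel n (real M * x))) = fourier_integral k F +
            (\<Sum>q=1..n. fourier_integral (k + int q * int M) F + fourier_integral (k - int q * int M) F)" for n
  proof -
    have "integral {0..1} (\<lambda>x. h x * of_real (dirichlet_kernel n (real M * x))) =
          integral {0..1} (\<lambda>x. F x * wave k x + (\<Sum>q=1..n. F x * wave (k + int q * int M) x + F x * wave (k - int q * int M) x))"
      unfolding h_def mult.assoc wave_times_dirichlet_kernel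
      by (simp add: ring_distribs sum_distrib_left)
    also have "\<dots> = integral {0..1} (\<lambda>x. F x * wave k x) + (\<Sum>q=1..n. integral {0..1} (\<lambda>x. F x * wave (k + int q * int M) x) +
          integral {0..1} (\<lambda>x. F x * wave (k - int q * int M) x))"
      by (simp add: Henstock_Kurzweil_Integration.integral_add integral_sum int integrable_sum integrable_add)
    finally show ?thesis
      using L2_on_continuous[OF cF] by (simp add: fourier_integral_eq_integral)
  qed
  then show ?thesis using trapezoid_limit[OF h M] by simp
qed

section \<open>The Sobolev norm\<close>

lemma L2_on_deriv01:
  assumes "f \<in> sobolev s"
  shows "L2_on 0 1 (deriv01 s f)"
  using assms unfolding sobolev_def square_integrable01_def L2_on_def by blast

lemma sobolev_norm_sq:
  assumes f: "f \<in> sobolev s" and "s \<ge> 1"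
  shows "(sobolev_norm s f)\<^sup>2 = (\<Sum>l<s. (cmod (integral {0..1} (deriv01 l f)))\<^sup>2) + (L2_norm_on 0 1 (deriv01 s f))\<^sup>2"
    and "sobolev_norm s f \<ge> 0"
proof -
  have L2: "L2_on 0 1 (deriv01 l f)" if "l < s" for l
    using has_L2_derivative_imp_continuous_on[OF sobolev_has_L2_derivative[OF f that]]
    by (rule L2_on_continuous)
  have "(LINT x|lebesgue_on {0..1}. deriv01 l f x) * (LINT x|lebesgue_on {0..1}. cnj (deriv01 l f x)) =
      of_real ((cmod (integral {0..1} (deriv01 l f)))\<^sup>2)" if "l < s" for l
    using L2_on_integrable(1)[OF L2[OF that]]
    by (simp add: lebesgue_integral_eq_integral flip: complex_norm_square)
  moreover have "(LINT x|lebesgue_on {0..1}. deriv01 s f x * cnj (deriv01 s f x)) =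
      of_real (LINT x|lebesgue_on {0..1}. (cmod (deriv01 s f x))\<^sup>2)"
    by (simp add: integral_complex_of_real[symmetric] flip: complex_norm_square del: integral_complex_of_real)
  moreover have "(LINT x|lebesgue_on {0..1}. (cmod (deriv01 s f x))\<^sup>2) = (L2_norm_on 0 1 (deriv01 s f))\<^sup>2"
    unfolding L2_norm_on_eq_LINT[OF L2_on_deriv01[OF f]] by simp
  ultimately have "Re (sobolev_inner s f f) = (\<Sum>l<s. (cmod (integral {0..1} (deriv01 l f)))\<^sup>2) + (L2_norm_on 0 1 (deriv01 s f))\<^sup>2"
    unfolding sobolev_inner_def by simp
  moreover have "0 \<le> (\<Sum>l<s. (cmod (integral {0..1} (deriv01 l f)))\<^sup>2) + (L2_norm_on 0 1 (deriv01 s f))\<^sup>2"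
    by (intro add_nonneg_nonneg sum_nonneg) auto
  ultimately show "(sobolev_norm s f)\<^sup>2 = (\<Sum>l<s. (cmod (integral {0..1} (deriv01 l f)))\<^sup>2) + (L2_norm_on 0 1 (deriv01 s f))\<^sup>2"
    "sobolev_norm s f \<ge> 0"
    unfolding sobolev_norm_def by simp_all
qed

lemma L2_norm_deriv_le_sobolev_norm:
  assumes f: "f \<in> sobolev s" and "s \<ge> 1"
  shows "L2_norm_on 0 1 (deriv01 s f) \<le> sobolev_norm s f"
proof (rule power2_le_imp_le)
  show "(L2_norm_on 0 1 (deriv01 s f))\<^sup>2 \<le> (sobolev_norm s f)\<^sup>2"
    unfolding sobolev_norm_sq[OF assms] by (simp add: sum_nonneg)
qed (rule sobolev_norm_sq(2)[OF assms])

section \<open>Aliasing\<close>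

text \<open>
  The sum is the integral of \<open>G\<close> against a trigonometric polynomial, so this is Bessel's inequality in
  dual form.
\<close>

lemma fourier_sum_le_L2_norm:
  assumes G: "L2_on 0 1 G" and "finite J"
  shows "cmod (\<Sum>j\<in>J. c j * fourier_integral j G) \<le> L2_norm_on 0 1 G * sqrt (\<Sum>j\<in>J. (cmod (c j))\<^sup>2)"
proof -
  have "(\<Sum>j\<in>J. c j * fourier_integral j G) = integral {0..1} (\<lambda>x. G x * (\<Sum>j\<in>J. c j * wave j x))"
  proof -
    have "(\<lambda>x. G x * wave j x) integrable_on {0..1}" for j
      by (intro L2_on_mult(2) G L2_on_continuous continuous_intros)
    then have "((\<lambda>x. \<Sum>j\<in>J. c j * (G x * wave j x)) has_integral (\<Sum>j\<in>J. c j * fourier_integral j G)) {0..1}"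
      unfolding fourier_integral_eq_integral[OF G]
      by (intro has_integral_sum has_integral_mult_right integrable_integral \<open>finite J\<close>)
    then show ?thesis by (simp add: integral_unique sum_distrib_left mult_ac)
  qed
  also have "cmod \<dots> \<le> L2_norm_on 0 1 G * L2_norm_on 0 1 (\<lambda>x. \<Sum>j\<in>J. c j * wave j x)"
    by (intro L2_on_mult(3) G L2_on_continuous continuous_intros)
  finally show ?thesis unfolding L2_norm_wave_sum[OF \<open>finite J\<close>] .
qed

text \<open>
  \<open>|j| \<ge> q M - |k|\<close>, and \<open>3 (q M - |k|) \<ge> (2 q - 1) (M + |k|)\<close> because \<open>(q + 1) (M - 2 |k|) \<ge> 0\<close>. Equality
  is attained for \<open>2 |k| = M\<close>; this is the origin of the constant 3 in the error bounds.
\<close>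

lemma aliased_freq_bound:
  fixes k :: int
  assumes "M \<ge> 1" and k: "2 * \<bar>k\<bar> \<le> int M" and "q \<ge> 1"
    and j: "j = k + int q * int M \<or> j = k - int q * int M"
  shows "j \<noteq> 0" and "1 / cmod (freq j) \<le> 3 / (2 * pi * (real M + real_of_int \<bar>k\<bar>)) / (2 * real q - 1)"
proof -
  define K where "K = real_of_int \<bar>k\<bar>"
  have K: "K \<ge> 0" "2 * K \<le> real M" "real M \<ge> 1"
    using k \<open>M \<ge> 1\<close> unfolding K_def by linarith+
  have q: "real q \<ge> 1" using \<open>q \<ge> 1\<close> by simp
  have "real q * real M - K \<le> real_of_int \<bar>j\<bar>"
  proof -
    have "int q * int M - \<bar>k\<bar> \<le> \<bar>j\<bar>" using j by auto
    then have "real_of_int (int q * int M - \<bar>k\<bar>) \<le> real_of_int \<bar>j\<bar>" by (simp only: of_int_le_iff)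
    then show ?thesis by (simp add: K_def)
  qed
  moreover have "(2 * real q - 1) * (real M + K) \<le> 3 * (real q * real M - K)"
    using mult_left_mono[OF K(2), of "real q + 1"] q by (simp add: algebra_simps)
  moreover have "(2 * real q - 1) * (real M + K) > 0" using q K by (intro mult_pos_pos) auto
  ultimately have jb: "(2 * real q - 1) * (real M + K) \<le> 3 * real_of_int \<bar>j\<bar>" "3 * real_of_int \<bar>j\<bar> > 0"
    by (meson mult_left_mono order_trans order_less_le_trans zero_le_numeral)+
  then show "j \<noteq> 0" by auto
  have b1: "1 / (2 * pi * real_of_int \<bar>j\<bar>) \<le> 3 / (2 * pi * ((2 * real q - 1) * (real M + K)))"
    using jb q K by (simp add: divide_simps)
  then show "1 / cmod (freq j) \<le> 3 / (2 * pi * (real M + real_of_int \<bar>k\<bar>)) / (2 * real q - 1)"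
  proof -
    have eq: "3 / (2 * pi * ((2 * real q - 1) * (real M + K))) = 3 / (2 * pi * (real M + K)) / (2 * real q - 1)"
      by (simp only: divide_divide_eq_left mult_ac)
    show ?thesis using b1 unfolding eq norm_freq K_def[symmetric] .
  qed
qed

text \<open>
  A telescoping bound for the sum is enough; its limit is \<open>\<pi>\<^sup>2 / 8\<close>.
\<close>

lemma sum_odd_inverse_squares: "(\<Sum>q=1..n. 1 / (2 * real q - 1)\<^sup>2) \<le> 2"
proof -
  \<comment> \<open>The slack \<open>1 / (n + 1)\<close> makes the induction work.\<close>
  have "(\<Sum>q=1..Suc n. 1 / (2 * real q - 1)\<^sup>2) \<le> 2 - 1 / real (Suc n)" for n
  proof (induction n)
    case (Suc n)
    have "1 / (2 * real (Suc (Suc n)) - 1)\<^sup>2 \<le> 1 / real (Suc n) - 1 / real (Suc (Suc n))"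
    proof -
      have "1 / real (Suc n) - 1 / real (Suc (Suc n)) = 1 / (real (Suc n) * real (Suc (Suc n)))"
        by (simp add: field_simps)
      moreover have "1 / (2 * real (Suc (Suc n)) - 1)\<^sup>2 \<le> 1 / (real (Suc n) * real (Suc (Suc n)))"
      proof (rule divide_left_mono)
        show "real (Suc n) * real (Suc (Suc n)) \<le> (2 * real (Suc (Suc n)) - 1)\<^sup>2"
          by (simp add: power2_eq_square algebra_simps)
        show "0 < (2 * real (Suc (Suc n)) - 1)\<^sup>2 * (real (Suc n) * real (Suc (Suc n)))"
          by (intro mult_pos_pos zero_less_power) auto
      qed simp
      ultimately show ?thesis by simp
    qed
    then show ?case using Suc by simp
  qed simp
  from this[of "n - 1"] show ?thesis
    by (cases n) (auto intro: order_trans)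
qed

text \<open>
  The frequencies other than \<open>k\<close> that agree with \<open>k\<close> at the points \<open>i / M\<close>, up to the \<open>n\<close>-th pair.
\<close>

definition aliases :: "int \<Rightarrow> nat \<Rightarrow> nat \<Rightarrow> int set" where
  "aliases k M n = (\<lambda>q. k + int q * int M) ` {1..n} \<union> (\<lambda>q. k - int q * int M) ` {1..n}"

lemma sum_aliases:
  fixes a :: "int \<Rightarrow> 'b::comm_monoid_add"
  assumes "M \<ge> 1"
  shows "(\<Sum>j\<in>aliases k M n. a j) = (\<Sum>q=1..n. a (k + int q * int M) + a (k - int q * int M))"
proof -
  have M: "int M > 0" using assms by simp
  have disj: "(\<lambda>q. k + int q * int M) ` {1..n} \<inter> (\<lambda>q. k - int q * int M) ` {1..n} = {}"
  proof -
    have "k + int q * int M \<noteq> k - int p * int M" if "q \<ge> 1" "p \<ge> 1" for p q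
    proof -
      have "int q * int M > 0" "int p * int M > 0" using that M by auto
      then show ?thesis by linarith
    qed
    then show ?thesis by auto
  qed
  have "inj_on (\<lambda>q. k + int q * int M) {1..n}" "inj_on (\<lambda>q. k - int q * int M) {1..n}"
    using M by (auto simp: inj_on_def)
  then show ?thesis
    unfolding aliases_def using disj by (simp add: sum.union_disjoint sum.reindex sum.distrib)
qed

lemma aliasing_error:
  fixes k :: int
  assumes M: "M \<ge> 1" and k: "2 * \<bar>k\<bar> \<le> int M" and "s \<ge> 1" and G: "L2_on 0 1 G"
  shows "cmod (\<Sum>j\<in>aliases k M n. fourier_integral j G / freq j ^ s) \<le>
           2 * (3 / (2 * pi * (real M + real_of_int \<bar>k\<bar>))) ^ s * L2_norm_on 0 1 G"
proof -
  define \<rho> where "\<rho> = 3 / (2 * pi * (real M + real_of_int \<bar>k\<bar>))"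
  have \<rho>: "\<rho> > 0" using M by (simp add: \<rho>_def add_pos_nonneg)
  have one: "(cmod (1 / freq j ^ s))\<^sup>2 \<le> \<rho> ^ (2 * s) * (1 / (2 * real q - 1)\<^sup>2)"
    if "q \<ge> 1" "j = k + int q * int M \<or> j = k - int q * int M" for j q
  proof -
    have q: "2 * real q - 1 \<ge> 1" using that(1) by simp
    have "(cmod (1 / freq j ^ s))\<^sup>2 = (1 / cmod (freq j)) ^ (2 * s)"
      by (simp add: norm_divide norm_power power_divide power_mult[symmetric] mult.commute)
    also have "\<dots> \<le> (\<rho> / (2 * real q - 1)) ^ (2 * s)"
      using aliased_freq_bound(2)[OF M k that] unfolding \<rho>_def by (intro power_mono) auto
    also have "\<dots> = \<rho> ^ (2 * s) * (1 / (2 * real q - 1) ^ (2 * s))"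
      by (simp add: power_divide)
    also have "\<dots> \<le> \<rho> ^ (2 * s) * (1 / (2 * real q - 1)\<^sup>2)"
    proof (rule mult_left_mono)
      have "(2 * real q - 1)\<^sup>2 \<le> (2 * real q - 1) ^ (2 * s)"
        using q \<open>s \<ge> 1\<close> by (intro power_increasing) auto
      then show "1 / (2 * real q - 1) ^ (2 * s) \<le> 1 / (2 * real q - 1)\<^sup>2"
        using q by (intro divide_left_mono) auto
    qed (use \<rho> in simp)
    finally show ?thesis .
  qed
  have "(\<Sum>j\<in>aliases k M n. (cmod (1 / freq j ^ s))\<^sup>2) \<le>
      (\<Sum>q=1..n. \<rho> ^ (2 * s) * (1 / (2 * real q - 1)\<^sup>2) + \<rho> ^ (2 * s) * (1 / (2 * real q - 1)\<^sup>2))"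
    unfolding sum_aliases[OF M] by (intro sum_mono add_mono one) auto
  also have "\<dots> = 2 * \<rho> ^ (2 * s) * (\<Sum>q=1..n. 1 / (2 * real q - 1)\<^sup>2)"
    unfolding sum.distrib sum_distrib_left[symmetric] by simp
  also have "\<dots> \<le> 2 * \<rho> ^ (2 * s) * 2"
    using \<rho> by (intro mult_left_mono sum_odd_inverse_squares) auto
  also have "\<dots> = (2 * \<rho> ^ s)\<^sup>2"
    by (simp add: power_mult_distrib power_mult[symmetric] mult.commute)
  finally have "sqrt (\<Sum>j\<in>aliases k M n. (cmod (1 / freq j ^ s))\<^sup>2) \<le> 2 * \<rho> ^ s"
    using \<rho> by (intro real_le_lsqrt) auto
  moreover have "finite (aliases k M n)" by (simp add: aliases_def)
  then have "cmod (\<Sum>j\<in>aliases k M n. 1 / freq j ^ s * fourier_integral j G) \<le>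
      L2_norm_on 0 1 G * sqrt (\<Sum>j\<in>aliases k M n. (cmod (1 / freq j ^ s))\<^sup>2)"
    by (intro fourier_sum_le_L2_norm G)
  ultimately have "cmod (\<Sum>j\<in>aliases k M n. 1 / freq j ^ s * fourier_integral j G) \<le> L2_norm_on 0 1 G * (2 * \<rho> ^ s)"
    using L2_norm_on_nonneg[of 0 1 G] by (meson mult_left_mono order_trans)
  then show ?thesis by (simp add: \<rho>_def mult_ac)
qed

text \<open>
  For \<open>l = 1\<close> the single terms are only of order \<open>1 / q\<close>, but the two terms of a pair combine to
  \<open>2 freq k\<close> times their product, which is of order \<open>1 / q\<^sup>2\<close>.
\<close>

lemma alias_weights_convergent:
  fixes k :: int
  assumes M: "M \<ge> 1" and k: "2 * \<bar>k\<bar> \<le> int M" and "l \<ge> 1"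
  shows "convergent (\<lambda>n. \<Sum>j\<in>aliases k M n. 1 / freq j ^ l)"
proof -
  define \<rho> where "\<rho> = 3 / (2 * pi * (real M + real_of_int \<bar>k\<bar>))"
  have \<rho>: "\<rho> > 0" using M by (simp add: \<rho>_def add_pos_nonneg)
  define u v where "u = (\<lambda>q. 1 / freq (k + int q * int M))" and "v = (\<lambda>q. 1 / freq (k - int q * int M))"
  have uv: "cmod (u q) \<le> \<rho> / real q" "cmod (v q) \<le> \<rho> / real q"
    "k + int q * int M \<noteq> 0" "k - int q * int M \<noteq> 0" if "q \<ge> 1" for q
  proof -
    have "\<rho> / (2 * real q - 1) \<le> \<rho> / real q"
      using that \<rho> by (intro divide_left_mono) auto
    then show "cmod (u q) \<le> \<rho> / real q" "cmod (v q) \<le> \<rho> / real q"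
      using aliased_freq_bound(2)[OF M k that, of "k + int q * int M"]
        aliased_freq_bound(2)[OF M k that, of "k - int q * int M"]
      by (simp_all add: u_def v_def norm_divide \<rho>_def)
    show "k + int q * int M \<noteq> 0" "k - int q * int M \<noteq> 0"
      using aliased_freq_bound(1)[OF M k that] by blast+
  qed
  define C where "C = (if l = 1 then 2 * cmod (freq k) * \<rho>\<^sup>2 else 2 * \<rho> ^ l)"
  have bound: "cmod (u q ^ l + v q ^ l) \<le> C * (1 / (real q)\<^sup>2)" if "q \<ge> 1" for q
  proof (cases "l = 1")
    case True
    have "u q + v q = 2 * freq k * (u q * v q)"
    proof -
      have "freq (k + int q * int M) + freq (k - int q * int M) = 2 * freq k"
        by (simp add: freq_def algebra_simps)
      then show ?thesis using uv(3,4)[OF that]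
        by (simp add: u_def v_def add_frac_eq add.commute)
    qed
    also have "cmod \<dots> = 2 * cmod (freq k) * (cmod (u q) * cmod (v q))"
      by (simp add: norm_mult)
    also have "\<dots> \<le> 2 * cmod (freq k) * ((\<rho> / real q) * (\<rho> / real q))"
      using uv(1,2)[OF that] \<rho> by (intro mult_left_mono mult_mono) auto
    finally show ?thesis using True by (simp add: C_def power2_eq_square)
  next
    case False
    then have l: "l \<ge> 2" using \<open>l \<ge> 1\<close> by simp
    have "cmod (u q ^ l + v q ^ l) \<le> (\<rho> / real q) ^ l + (\<rho> / real q) ^ l"
      using uv(1,2)[OF that] by (intro norm_triangle_mono) (auto simp: norm_power intro!: power_mono)
    also have "\<dots> = 2 * \<rho> ^ l * (1 / real q ^ l)" by (simp add: power_divide)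
    also have "\<dots> \<le> 2 * \<rho> ^ l * (1 / (real q)\<^sup>2)"
    proof (rule mult_left_mono)
      have "(real q)\<^sup>2 \<le> real q ^ l" using that l by (intro power_increasing) auto
      then show "1 / real q ^ l \<le> 1 / (real q)\<^sup>2" using that by (intro divide_left_mono) auto
    qed (use \<rho> in simp)
    finally show ?thesis using False by (simp add: C_def)
  qed
  have "summable (\<lambda>q. C * (1 / (real (Suc q))\<^sup>2))"
    using sums_summable[OF inverse_squares_sums] by (intro summable_mult) (simp add: add.commute)
  then have "summable (\<lambda>q. u (Suc q) ^ l + v (Suc q) ^ l)"
    by (rule summable_comparison_test'[of _ 0]) (use bound in \<open>simp del: of_nat_Suc\<close>)
  then have "convergent (\<lambda>n. \<Sum>q<n. u (Suc q) ^ l + v (Suc q) ^ l)"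
    by (simp add: summable_iff_convergent)
  moreover have "(\<Sum>q<n. u (Suc q) ^ l + v (Suc q) ^ l) = (\<Sum>j\<in>aliases k M n. 1 / freq j ^ l)" for n
  proof -
    have "(\<Sum>q<n. u (Suc q) ^ l + v (Suc q) ^ l) = (\<Sum>q=1..n. u q ^ l + v q ^ l)"
      by (rule sum.reindex_bij_witness[of _ "\<lambda>q. q - 1" Suc]) auto
    then show ?thesis unfolding sum_aliases[OF M] by (simp add: u_def v_def power_one_over)
  qed
  ultimately show ?thesis by simp
qed

section \<open>Algorithms and upper error bounds\<close>

lemma algorithms_sum:
  assumes "\<And>i. i < n \<Longrightarrow> l i < s \<and> x i \<in> {0..1}"
  shows "(\<lambda>f. \<Sum>i<n. a i * deriv01 (l i) f (x i)) \<in> algorithms n s"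
proof -
  have "(\<lambda>f. \<Sum>i<n. a i * deriv01 (l i) f (x i)) =
      (\<lambda>f. \<Sum>j=1..n. a (j - 1) * deriv01 (l (j - 1)) f (x (j - 1)))"
    by (intro ext sum.reindex_bij_witness[of _ "\<lambda>j. j - 1" Suc]) auto
  moreover have "\<forall>j\<in>{1..n}. l (j - 1) < s \<and> x (j - 1) \<in> {0..1}"
    using assms by (metis atLeastAtMost_iff diff_less le_neq_implies_less less_imp_diff_less zero_less_one less_one not_le order_less_le_trans)
  ultimately show ?thesis
    unfolding algorithms_def by (auto intro!: exI[of _ "\<lambda>j. a (j - 1)"] exI[of _ "\<lambda>j. l (j - 1)"] exI[of _ "\<lambda>j. x (j - 1)"])
qed

lemma algorithms_add:
  assumes "A \<in> algorithms n s" "B \<in> algorithms m s"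
  shows "(\<lambda>f. A f + B f) \<in> algorithms (n + m) s"
proof -
  obtain a l x where A: "\<forall>j\<in>{1..n}. l j < s \<and> x j \<in> {0..1::real}" "A = (\<lambda>f. \<Sum>j=1..n. a j * deriv01 (l j) f (x j))"
    using assms(1) unfolding algorithms_def by blast
  obtain b l' y where B: "\<forall>j\<in>{1..m}. l' j < s \<and> y j \<in> {0..1::real}" "B = (\<lambda>f. \<Sum>j=1..m. b j * deriv01 (l' j) f (y j))"
    using assms(2) unfolding algorithms_def by blast
  define c p z where "c = (\<lambda>j. if j \<le> n then a j else b (j - n))"
    and "p = (\<lambda>j. if j \<le> n then l j else l' (j - n))"
    and "z = (\<lambda>j. if j \<le> n then x j else y (j - n))"
  have "\<forall>j\<in>{1..n + m}. p j < s \<and> z j \<in> {0..1}"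
  proof
    fix j assume "j \<in> {1..n + m}"
    then have "j \<in> {1..n} \<or> \<not> j \<le> n \<and> j - n \<in> {1..m}" by auto
    then show "p j < s \<and> z j \<in> {0..1}"
      using A(1) B(1) by (auto simp: p_def z_def)
  qed
  moreover have "(\<lambda>f. A f + B f) = (\<lambda>f. \<Sum>j=1..n + m. c j * deriv01 (p j) f (z j))"
  proof
    fix f
    have "{1..n + m} = {1..n} \<union> {n + 1..n + m}" by auto
    then have "(\<Sum>j=1..n + m. c j * deriv01 (p j) f (z j)) =
        (\<Sum>j=1..n. c j * deriv01 (p j) f (z j)) + (\<Sum>j=n + 1..n + m. c j * deriv01 (p j) f (z j))"
      by (simp only:) (rule sum.union_disjoint, auto)
    also have "(\<Sum>j=1..n. c j * deriv01 (p j) f (z j)) = A f"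
      unfolding A(2) by (intro sum.cong) (auto simp: c_def p_def z_def)
    also have "(\<Sum>j=n + 1..n + m. c j * deriv01 (p j) f (z j)) = B f"
      unfolding B(2) by (rule sum.reindex_bij_witness[of _ "\<lambda>j. j + n" "\<lambda>j. j - n"]) (auto simp: c_def p_def z_def)
    finally show "A f + B f = (\<Sum>j=1..n + m. c j * deriv01 (p j) f (z j))" ..
  qed
  ultimately show ?thesis unfolding algorithms_def by blast
qed

lemma zero_in_algorithms: "s \<ge> 1 \<Longrightarrow> (\<lambda>f. 0) \<in> algorithms n s"
  using algorithms_sum[of n "\<lambda>_. 0" s "\<lambda>_. 0" "\<lambda>_. 0"] by simp

lemma algorithms_0: "algorithms 0 s = {\<lambda>f. 0}"
  unfolding algorithms_def by auto

lemma endpoint_algorithm: "(\<lambda>f. \<Sum>m<s. c m * deriv01 m f 1 + d m * deriv01 m f 0) \<in> algorithms (2 * s) s"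
proof -
  have "(\<lambda>f. \<Sum>m<s. c m * deriv01 m f 1) \<in> algorithms s s" "(\<lambda>f. \<Sum>m<s. d m * deriv01 m f 0) \<in> algorithms s s"
    by (rule algorithms_sum, simp)+
  from algorithms_add[OF this] show ?thesis by (simp add: sum.distrib mult_2)
qed

lemma trapezoid_regroup:
  fixes H :: "nat \<Rightarrow> complex"
  assumes "M \<ge> 1"
  shows "(\<Sum>i<M. (H i + H (Suc i)) / 2) = (\<Sum>i<M - 1. H (Suc i)) + (H 0 + H M) / 2"
proof -
  have "(\<Sum>i<Suc m. (H i + H (Suc i)) / 2) = (\<Sum>i<m. H (Suc i)) + (H 0 + H (Suc m)) / 2" for m
  proof (induction m)
    case (Suc m)
    have *: "(\<Sum>i<Suc (Suc m). (H i + H (Suc i)) / 2) =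
        (\<Sum>i<Suc m. (H i + H (Suc i)) / 2) + (H (Suc m) + H (Suc (Suc m))) / 2"
      by (rule sum.lessThan_Suc)
    show ?case by (simp only: * Suc.IH) (simp add: field_simps)
  qed simp
  from this[of "M - 1"] show ?thesis using assms by simp
qed

text \<open>
  By Poisson summation the trapezoidal rule differs from \<open>I\<^sub>k(f)\<close> by the aliased coefficients. Their
  boundary terms are fixed combinations of the \<open>2 s\<close> end point values, so the algorithm subtracts them,
  and the remaining error is an aliased sum for the derivative of order \<open>s\<close>. The end points are also
  nodes of the trapezoidal rule, so that only \<open>M - 1\<close> interior nodes are added.
\<close>

lemma corrected_trapezoid_algorithm:
  fixes k :: int
  assumes "s \<ge> 1" and M: "M \<ge> 1" and k: "2 * \<bar>k\<bar> \<le> int M"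
  obtains A where "A \<in> algorithms (M - 1 + 2 * s) s"
    "\<And>f. f \<in> sobolev s \<Longrightarrow> cmod (fourier_integral k f - A f) \<le>
       2 * (3 / (2 * pi * (real M + real_of_int \<bar>k\<bar>))) ^ s * L2_norm_on 0 1 (deriv01 s f)"
proof -
  define \<sigma> where "\<sigma> = (\<lambda>n m. \<Sum>j\<in>aliases k M n. 1 / freq j ^ Suc m)"
  have "\<exists>g. (\<lambda>n. \<sigma> n m) \<longlonglongrightarrow> g" for m
    using alias_weights_convergent[OF M k, of "Suc m"] by (simp add: \<sigma>_def convergent_def)
  then obtain \<gamma> where \<gamma>: "\<And>m. (\<lambda>n. \<sigma> n m) \<longlonglongrightarrow> \<gamma> m" by metis
  \<comment> \<open>The weight of the two end points in the trapezoidal rule, which is half of an interior weight.\<close>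
  define e where "e = (\<lambda>m::nat. if m = 0 then 1 / (2 * of_nat M) else 0 :: complex)"
  define A where "A = (\<lambda>f. (\<Sum>i<M - 1. wave k (real (Suc i) / real M) / of_nat M * deriv01 0 f (real (Suc i) / real M)) +
      (\<Sum>m<s. (\<gamma> m + e m) * deriv01 m f 1 + (e m - \<gamma> m) * deriv01 m f 0))"
  have A_in: "A \<in> algorithms (M - 1 + 2 * s) s"
    unfolding A_def
    by (intro algorithms_add algorithms_sum endpoint_algorithm) (use \<open>s \<ge> 1\<close> in \<open>auto simp: divide_simps\<close>)
  have A_err: "cmod (fourier_integral k f - A f) \<le>
       2 * (3 / (2 * pi * (real M + real_of_int \<bar>k\<bar>))) ^ s * L2_norm_on 0 1 (deriv01 s f)"
    if f: "f \<in> sobolev s" for f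
  proof -
    define D where "D = (\<lambda>m. deriv01 m f 1 - deriv01 m f 0)"
    define h where "h = (\<lambda>x. f x * wave k x)"
    define R where "R = (\<lambda>n. \<Sum>j\<in>aliases k M n. fourier_integral j (deriv01 s f) / freq j ^ s)"
    have F: "has_L2_derivative 0 1 f (deriv01 1 f)"
      using sobolev_has_L2_derivative[OF f, of 0] \<open>s \<ge> 1\<close> by simp
    have Af: "A f = (\<Sum>i<M. (h (real i / real M) + h (real (Suc i) / real M)) / 2) / of_nat M + (\<Sum>m<s. \<gamma> m * D m)"
    proof -
      have "(\<Sum>m<s. e m * (deriv01 m f 1 + deriv01 m f 0)) = (f 1 + f 0) / (2 * of_nat M)"
      proof -
        have "(\<Sum>m<s. e m * (deriv01 m f 1 + deriv01 m f 0)) = (\<Sum>m<s. if m = 0 then (f 1 + f 0) / (2 * of_nat M) else 0)"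
          by (intro sum.cong) (auto simp: e_def)
        also have "\<dots> = (f 1 + f 0) / (2 * of_nat M)" using \<open>s \<ge> 1\<close> by (simp add: sum.delta)
        finally show ?thesis .
      qed
      moreover have "(\<Sum>m<s. (\<gamma> m + e m) * deriv01 m f 1 + (e m - \<gamma> m) * deriv01 m f 0) =
          (\<Sum>m<s. e m * (deriv01 m f 1 + deriv01 m f 0)) + (\<Sum>m<s. \<gamma> m * D m)"
        by (simp add: sum.distrib[symmetric] D_def algebra_simps)
      moreover have "(\<Sum>i<M - 1. wave k (real (Suc i) / real M) / of_nat M * deriv01 0 f (real (Suc i) / real M)) =
          (\<Sum>i<M - 1. h (real (Suc i) / real M)) / of_nat M"
        by (simp add: h_def sum_divide_distrib mult.commute)
      moreover have "h 0 = f 0" "h 1 = f 1" by (simp_all add: h_def)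
      ultimately show ?thesis
        using trapezoid_regroup[OF M, of "\<lambda>i. h (real i / real M)"] M
        by (simp add: A_def add_divide_distrib add.commute)
    qed
    have aliased: "(\<Sum>j\<in>aliases k M n. fourier_integral j f) = R n - (\<Sum>m<s. \<sigma> n m * D m)" for n
    proof -
      have "fourier_integral j f = fourier_integral j (deriv01 s f) / freq j ^ s - (\<Sum>m<s. 1 / freq j ^ Suc m * D m)"
        if jA: "j \<in> aliases k M n" for j
      proof -
        obtain q where "q \<ge> 1" "j = k + int q * int M \<or> j = k - int q * int M"
          using jA unfolding aliases_def by (elim UnE imageE) auto
        then have "j \<noteq> 0" by (rule aliased_freq_bound(1)[OF M k])
        from fourier_integral_sobolev[OF f this order_refl] show ?thesis by (simp add: D_def)
      qed
      then have "(\<Sum>j\<in>aliases k M n. fourier_integral j f) = R n - (\<Sum>j\<in>aliases k M n. \<Sum>m<s. 1 / freq j ^ Suc m * D m)"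
        by (simp add: R_def sum_subtractf)
      also have "(\<Sum>j\<in>aliases k M n. \<Sum>m<s. 1 / freq j ^ Suc m * D m) = (\<Sum>m<s. \<sigma> n m * D m)"
        unfolding \<sigma>_def sum_distrib_right by (rule sum.swap)
      finally show ?thesis .
    qed
    define T where "T = (\<Sum>i<M. (h (real i / real M) + h (real (Suc i) / real M)) / 2) / of_nat M"
    have "(\<lambda>n. fourier_integral k f + (\<Sum>j\<in>aliases k M n. fourier_integral j f)) \<longlonglongrightarrow> T"
      unfolding sum_aliases[OF M] T_def h_def by (rule fourier_sum_limit[OF F M])
    then have L1: "(\<lambda>n. fourier_integral k f + (R n - (\<Sum>m<s. \<sigma> n m * D m))) \<longlonglongrightarrow> T"
      unfolding aliased .
    have L2: "(\<lambda>n. \<Sum>m<s. \<sigma> n m * D m) \<longlonglongrightarrow> (\<Sum>m<s. \<gamma> m * D m)"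
      by (intro tendsto_intros \<gamma>)
    have "(\<lambda>n. fourier_integral k f + (R n - (\<Sum>m<s. \<sigma> n m * D m)) + (\<Sum>m<s. \<sigma> n m * D m) - fourier_integral k f)
        \<longlonglongrightarrow> T + (\<Sum>m<s. \<gamma> m * D m) - fourier_integral k f"
      by (intro tendsto_diff tendsto_add L1 L2 tendsto_const)
    moreover have "A f = T + (\<Sum>m<s. \<gamma> m * D m)" unfolding Af T_def ..
    ultimately have "R \<longlonglongrightarrow> A f - fourier_integral k f" by simp
    then have "(\<lambda>n. cmod (R n)) \<longlonglongrightarrow> cmod (A f - fourier_integral k f)" by (rule tendsto_norm)
    moreover have "cmod (R n) \<le> 2 * (3 / (2 * pi * (real M + real_of_int \<bar>k\<bar>))) ^ s * L2_norm_on 0 1 (deriv01 s f)" for n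
      unfolding R_def by (rule aliasing_error[OF M k \<open>s \<ge> 1\<close> L2_on_deriv01[OF f]])
    ultimately have "cmod (A f - fourier_integral k f) \<le>
        2 * (3 / (2 * pi * (real M + real_of_int \<bar>k\<bar>))) ^ s * L2_norm_on 0 1 (deriv01 s f)"
      by (blast intro: LIMSEQ_le_const2)
    then show ?thesis by (simp add: norm_minus_commute)
  qed
  show thesis by (rule that[OF A_in A_err])
qed

text \<open>
  The end point values alone remove the boundary terms of \<open>I\<^sub>k(f)\<close> itself.
\<close>

lemma hermite_algorithm:
  fixes k :: int
  assumes "k \<noteq> 0"
  obtains A where "A \<in> algorithms (2 * s) s"
    "\<And>f. f \<in> sobolev s \<Longrightarrow> cmod (fourier_integral k f - A f) \<le>
       (1 / (2 * pi * real_of_int \<bar>k\<bar>)) ^ s * L2_norm_on 0 1 (deriv01 s f)"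
proof -
  define A where "A = (\<lambda>f. \<Sum>m<s. (- 1 / freq k ^ Suc m) * deriv01 m f 1 + (1 / freq k ^ Suc m) * deriv01 m f 0)"
  have A_in: "A \<in> algorithms (2 * s) s" unfolding A_def by (rule endpoint_algorithm)
  have A_err: "cmod (fourier_integral k f - A f) \<le>
       (1 / (2 * pi * real_of_int \<bar>k\<bar>)) ^ s * L2_norm_on 0 1 (deriv01 s f)" if f: "f \<in> sobolev s" for f
  proof -
    have "A f = - (\<Sum>m<s. (deriv01 m f 1 - deriv01 m f 0) / freq k ^ Suc m)"
      unfolding A_def sum_negf[symmetric] by (intro sum.cong) (auto simp: diff_divide_distrib)
    then have "fourier_integral k f - A f = fourier_integral k (deriv01 s f) / freq k ^ s"
      using fourier_integral_sobolev[OF f assms order_refl] by simp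
    moreover have "cmod (fourier_integral k (deriv01 s f)) \<le> L2_norm_on 0 1 (deriv01 s f)"
      using fourier_sum_le_L2_norm[OF L2_on_deriv01[OF f], of "{k}" "\<lambda>_. 1"] by simp
    ultimately show ?thesis
      using assms by (simp add: norm_divide norm_power norm_freq power_one_over divide_right_mono)
  qed
  show thesis by (rule that[OF A_in A_err])
qed

lemma min_error_le:
  assumes "A \<in> algorithms n s"
    and "\<And>f. f \<in> sobolev s \<Longrightarrow> sobolev_norm s f \<le> 1 \<Longrightarrow> cmod (fourier_integral k f - A f) \<le> B"
  shows "min_error n k s \<le> ennreal B"
  unfolding min_error_def worst_case_error_def
  by (rule INF_lower2[OF assms(1)]) (auto intro!: SUP_least ennreal_leI assms(2))

text \<open>
  When \<open>2 |k| > M\<close>, the frequency is so high that the nodes in the interior do not pay: then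
  \<open>M + |k| \<le> 3 |k|\<close>, and the algorithm that uses only the end points already meets the bound.
\<close>

lemma min_error_upper:
  fixes k :: int
  assumes "s \<ge> 1" and M: "M \<ge> 1"
  shows "min_error (M - 1 + 2 * s) k s \<le> ennreal (2 * (3 / (2 * pi * (real M + real_of_int \<bar>k\<bar>))) ^ s)"
proof -
  define \<rho> where "\<rho> = 3 / (2 * pi * (real M + real_of_int \<bar>k\<bar>))"
  have \<rho>: "\<rho> > 0" using M by (simp add: \<rho>_def add_pos_nonneg)
  obtain A where A: "A \<in> algorithms (M - 1 + 2 * s) s"
    "\<And>f. f \<in> sobolev s \<Longrightarrow> cmod (fourier_integral k f - A f) \<le> 2 * \<rho> ^ s * L2_norm_on 0 1 (deriv01 s f)"
  proof (cases "2 * \<bar>k\<bar> \<le> int M")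
    case True
    show thesis
      by (rule corrected_trapezoid_algorithm[OF assms True]) (rule that, auto simp: \<rho>_def)
  next
    case False
    then have "k \<noteq> 0" by auto
    obtain B where B: "B \<in> algorithms (2 * s) s" "\<And>f. f \<in> sobolev s \<Longrightarrow> cmod (fourier_integral k f - B f) \<le>
       (1 / (2 * pi * real_of_int \<bar>k\<bar>)) ^ s * L2_norm_on 0 1 (deriv01 s f)"
      using hermite_algorithm[OF \<open>k \<noteq> 0\<close>] by blast
    have "B \<in> algorithms (M - 1 + 2 * s) s"
      using algorithms_add[OF zero_in_algorithms[OF \<open>s \<ge> 1\<close>] B(1)] by simp
    moreover have "(1 / (2 * pi * real_of_int \<bar>k\<bar>)) ^ s \<le> 2 * \<rho> ^ s"
    proof -
      have "real M \<le> 2 * real_of_int \<bar>k\<bar>" using False by linarith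
      then have "1 / (2 * pi * real_of_int \<bar>k\<bar>) \<le> \<rho>"
        using \<open>k \<noteq> 0\<close> M unfolding \<rho>_def by (simp add: divide_simps add_pos_nonneg)
      then have "(1 / (2 * pi * real_of_int \<bar>k\<bar>)) ^ s \<le> \<rho> ^ s" by (intro power_mono) auto
      also have "\<dots> \<le> 2 * \<rho> ^ s" using \<rho> by simp
      finally show ?thesis .
    qed
    ultimately show thesis
      using B(2) L2_norm_on_nonneg by (intro that[of B]) (meson mult_right_mono order_trans)+
  qed
  have "cmod (fourier_integral k f - A f) \<le> 2 * \<rho> ^ s" if f: "f \<in> sobolev s" "sobolev_norm s f \<le> 1" for f
  proof -
    have "L2_norm_on 0 1 (deriv01 s f) \<le> 1"
      using L2_norm_deriv_le_sobolev_norm[OF f(1) \<open>s \<ge> 1\<close>] f(2) by simp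
    then have "2 * \<rho> ^ s * L2_norm_on 0 1 (deriv01 s f) \<le> 2 * \<rho> ^ s * 1"
      using \<rho> by (intro mult_left_mono) auto
    with A(2)[OF f(1)] show ?thesis by simp
  qed
  then show ?thesis unfolding \<rho>_def by (intro min_error_le[OF A(1)])
qed

section \<open>The initial error\<close>

text \<open>
  The squared \<open>beta\<close> divided by \<open>y\<^sup>2\<close> is a geometric sum in \<open>1 / y\<^sup>2\<close> in which the last term, of order \<open>s\<close>,
  has weight 2 instead of 1.
\<close>

lemma beta_eq_geometric:
  fixes k :: int
  assumes "k \<noteq> 0"
  defines "y \<equiv> 2 * pi * real_of_int \<bar>k\<bar>"
  shows "beta k (Suc p) / y = sqrt (2 / y ^ (2 * Suc p) + (\<Sum>m<p. 1 / y ^ (2 * Suc m)))"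
proof -
  have k1: "real_of_int \<bar>k\<bar> \<ge> 1" using assms by linarith
  have "2 * pi * 1 \<le> y" unfolding y_def using k1 by (intro mult_left_mono) auto
  then have y: "y > 1" using pi_gt3 by linarith
  define Y where "Y = y\<^sup>2"
  have Y: "Y > 1" using y by (simp add: Y_def one_less_power)
  have yY: "y ^ (2 * n) = Y ^ n" "(2 * pi * real_of_int k) ^ (2 * n) = Y ^ n" for n
    by (simp_all add: Y_def y_def power_mult power_mult_distrib)
  have Y2: "(2 * pi * real_of_int k)\<^sup>2 = Y"
    by (simp add: Y_def y_def power_mult_distrib)
  have geo: "(\<Sum>m<p. 1 / Y ^ Suc m) = (1 - 1 / Y ^ p) / (Y - 1)"
  proof (induction p)
    case (Suc p)
    have "(1 - 1 / Y ^ p) / (Y - 1) + 1 / Y ^ Suc p = (1 - 1 / Y ^ Suc p) / (Y - 1)"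
      using Y by (simp add: divide_simps) (simp add: algebra_simps)
    with Suc show ?case by simp
  qed simp
  have "(2 / Y ^ Suc p + (\<Sum>m<p. 1 / Y ^ Suc m)) * Y = (if p = 0 then 2 else (Y ^ Suc p + Y - 2) / (Y ^ Suc p - Y ^ p))"
  proof (cases "p = 0")
    case False
    have "Y ^ Suc p - Y ^ p = Y ^ p * (Y - 1)" by (simp add: algebra_simps)
    then show ?thesis
      unfolding geo using False Y by (simp add: divide_simps) (simp add: algebra_simps)
  qed (use Y in simp)
  then have "2 / Y ^ Suc p + (\<Sum>m<p. 1 / Y ^ Suc m) = (if p = 0 then 2 else (Y ^ Suc p + Y - 2) / (Y ^ Suc p - Y ^ p)) / Y"
    using Y by (simp add: field_simps)
  moreover have "beta k (Suc p) = sqrt (if p = 0 then 2 else (Y ^ Suc p + Y - 2) / (Y ^ Suc p - Y ^ p))"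
    unfolding beta_def yY Y2 by simp
  moreover have "sqrt Y = y" using y by (simp add: Y_def)
  ultimately show ?thesis unfolding yY by (simp add: real_sqrt_divide)
qed

text \<open>
  In the expansion of \<open>I\<^sub>k(f)\<close> the boundary term of order \<open>m < s - 1\<close> is the mean of the derivative of order
  \<open>m + 1\<close>, which occurs in the norm. The last boundary term is the mean of the derivative \<open>g\<close> of order \<open>s\<close>
  and is merged with \<open>I\<^sub>k(g)\<close>: the functional \<open>I\<^sub>k - I\<^sub>0\<close> has norm \<open>sqrt 2\<close> on square-integrable functions.
  The Cauchy-Schwarz inequality over the orders then gives the bound.
\<close>

lemma fourier_integral_le_beta:
  fixes k :: int
  assumes f: "f \<in> sobolev s" and "s \<ge> 1" and k: "k \<noteq> 0"
  shows "cmod (fourier_integral k f) \<le> beta k s / (2 * pi * real_of_int \<bar>k\<bar>) * sobolev_norm s f"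
proof -
  obtain p where s: "s = Suc p" using \<open>s \<ge> 1\<close> by (cases s) auto
  define y where "y = 2 * pi * real_of_int \<bar>k\<bar>"
  have y: "y > 0" "cmod (freq k) = y" using k by (simp_all add: y_def norm_freq)
  define g where "g = deriv01 s f"
  define D where "D = (\<lambda>m. deriv01 m f 1 - deriv01 m f 0)"
  have gL2: "L2_on 0 1 g" using L2_on_deriv01[OF f] by (simp add: g_def)
  have D: "D m = integral {0..1} (deriv01 (Suc m) f)" if "m < s" for m
    using integral_has_L2_derivative[OF sobolev_has_L2_derivative[OF f that]]
    by (simp add: D_def integral_unique)
  have "fourier_integral 0 g = integral {0..1} g"
    by (simp add: fourier_integral_eq_integral[OF gL2])
  also have "\<dots> = D p"
    using D[of p] s by (simp add: g_def del: deriv01.simps)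
  finally have "fourier_integral k f = (fourier_integral k g - fourier_integral 0 g) / freq k ^ s - (\<Sum>m<p. D m / freq k ^ Suc m)"
    using fourier_integral_sobolev[OF f k order_refl] by (simp add: g_def D_def s diff_divide_distrib)
  also have "cmod \<dots> \<le> cmod ((fourier_integral k g - fourier_integral 0 g) / freq k ^ s) + cmod (\<Sum>m<p. D m / freq k ^ Suc m)"
    by (rule norm_triangle_ineq4)
  also have "\<dots> \<le> L2_norm_on 0 1 g * (sqrt 2 / y ^ s) + (\<Sum>m<p. cmod (D m) * (1 / y ^ Suc m))"
  proof (rule add_mono)
    have "(\<Sum>j\<in>{0, k}. (if j = k then 1 else - 1) * fourier_integral j g) = fourier_integral k g - fourier_integral 0 g"
      using k by simp
    moreover have "(\<Sum>j\<in>{0, k}. (cmod (if j = k then 1 else - 1))\<^sup>2) = 2"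
      using k by simp
    ultimately have "cmod (fourier_integral k g - fourier_integral 0 g) \<le> L2_norm_on 0 1 g * sqrt 2"
      using fourier_sum_le_L2_norm[OF gL2, of "{0, k}" "\<lambda>j. if j = k then 1 else - 1"] by simp
    then have "cmod (fourier_integral k g - fourier_integral 0 g) / y ^ s \<le> L2_norm_on 0 1 g * sqrt 2 / y ^ s"
      using y by (intro divide_right_mono) auto
    then show "cmod ((fourier_integral k g - fourier_integral 0 g) / freq k ^ s) \<le> L2_norm_on 0 1 g * (sqrt 2 / y ^ s)"
      by (simp add: norm_divide norm_power y)
    have "cmod (D m / freq k ^ Suc m) = cmod (D m) * (1 / y ^ Suc m)" for m
      by (simp add: norm_divide norm_power norm_mult y)
    then show "cmod (\<Sum>m<p. D m / freq k ^ Suc m) \<le> (\<Sum>m<p. cmod (D m) * (1 / y ^ Suc m))"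
      by (metis (no_types, lifting) norm_sum sum.cong)
  qed
  also have "\<dots> \<le> sobolev_norm s f * sqrt (2 / y ^ (2 * s) + (\<Sum>m<p. 1 / y ^ (2 * Suc m)))"
  proof -
    define a where "a = (\<lambda>m. if m = p then L2_norm_on 0 1 g else cmod (D m))"
    define b where "b = (\<lambda>m. if m = p then sqrt 2 / y ^ s else 1 / y ^ Suc m)"
    have "(L2_norm_on 0 1 g * (sqrt 2 / y ^ s) + (\<Sum>m<p. cmod (D m) * (1 / y ^ Suc m)))\<^sup>2 = (\<Sum>m<s. a m * b m)\<^sup>2"
      unfolding s by (simp add: a_def b_def s add.commute)
    also have "\<dots> \<le> (\<Sum>m<s. (a m)\<^sup>2) * (\<Sum>m<s. (b m)\<^sup>2)"
      by (rule Cauchy_Schwarz_ineq_sum)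
    also have "(\<Sum>m<s. (b m)\<^sup>2) = 2 / y ^ (2 * s) + (\<Sum>m<p. 1 / y ^ (2 * Suc m))"
      unfolding s by (simp add: b_def s power_divide add.commute flip: power_mult power_Suc) (simp add: mult.commute)
    also have "(\<Sum>m<s. (a m)\<^sup>2) * (2 / y ^ (2 * s) + (\<Sum>m<p. 1 / y ^ (2 * Suc m))) \<le>
        (sobolev_norm s f)\<^sup>2 * (2 / y ^ (2 * s) + (\<Sum>m<p. 1 / y ^ (2 * Suc m)))"
    proof (rule mult_right_mono)
      have "(\<Sum>m<s. (a m)\<^sup>2) = (\<Sum>m<p. (cmod (D m))\<^sup>2) + (L2_norm_on 0 1 g)\<^sup>2"
        unfolding s by (simp add: a_def)
      also have "(\<Sum>m<p. (cmod (D m))\<^sup>2) = (\<Sum>m<p. (cmod (integral {0..1} (deriv01 (Suc m) f)))\<^sup>2)"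
        by (intro sum.cong refl) (simp add: D s del: deriv01.simps)
      also have "\<dots> + (L2_norm_on 0 1 g)\<^sup>2 \<le> (sobolev_norm s f)\<^sup>2"
        unfolding sobolev_norm_sq(1)[OF f \<open>s \<ge> 1\<close>] g_def
        unfolding s sum.lessThan_Suc_shift by simp
      finally show "(\<Sum>m<s. (a m)\<^sup>2) \<le> (sobolev_norm s f)\<^sup>2" .
    qed (use y in \<open>auto intro!: add_nonneg_nonneg sum_nonneg\<close>)
    finally have "sqrt ((L2_norm_on 0 1 g * (sqrt 2 / y ^ s) + (\<Sum>m<p. cmod (D m) * (1 / y ^ Suc m)))\<^sup>2) \<le>
        sqrt ((sobolev_norm s f)\<^sup>2 * (2 / y ^ (2 * s) + (\<Sum>m<p. 1 / y ^ (2 * Suc m))))"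
      by (rule real_sqrt_le_mono)
    then show ?thesis
      using sobolev_norm_sq(2)[OF f \<open>s \<ge> 1\<close>] by (simp add: real_sqrt_mult)
  qed
  also have "\<dots> = beta k s / y * sobolev_norm s f"
    using beta_eq_geometric[OF k, of p] unfolding y_def[symmetric] s by simp
  finally show ?thesis unfolding y_def .
qed

lemma min_error_0_le_beta:
  fixes k :: int
  assumes "s \<ge> 1" "k \<noteq> 0"
  shows "min_error 0 k s \<le> ennreal (beta k s / (2 * pi * real_of_int \<bar>k\<bar>))"
proof (rule min_error_le)
  show "(\<lambda>f. 0) \<in> algorithms 0 s" by (simp add: algorithms_0)
  fix f assume f: "f \<in> sobolev s" "sobolev_norm s f \<le> 1"
  obtain p where s: "s = Suc p" using \<open>s \<ge> 1\<close> by (cases s) auto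
  have "beta k s / (2 * pi * real_of_int \<bar>k\<bar>) \<ge> 0"
    unfolding s beta_eq_geometric[OF assms(2)] by (intro real_sqrt_ge_zero add_nonneg_nonneg sum_nonneg) auto
  then have "beta k s / (2 * pi * real_of_int \<bar>k\<bar>) * sobolev_norm s f \<le> beta k s / (2 * pi * real_of_int \<bar>k\<bar>) * 1"
    using f(2) by (intro mult_left_mono)
  then show "cmod (fourier_integral k f - 0) \<le> beta k s / (2 * pi * real_of_int \<bar>k\<bar>)"
    using fourier_integral_le_beta[OF f(1) assms] by simp
qed

section \<open>Lower error bounds\<close>

lemma
  assumes "x \<in> {0..1}"
  shows deriv01_wave: "deriv01 l (\<lambda>x. c * wave j x) x = c * (- freq j) ^ l * wave j x"
    and has_vector_derivative_deriv01_wave: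
      "(deriv01 l (\<lambda>x. c * wave j x) has_vector_derivative c * (- freq j) ^ Suc l * wave j x) (at x within {0..1})"
proof -
  define P where "P = (\<lambda>l x. deriv01 l (\<lambda>x. c * wave j x) x = c * (- freq j) ^ l * wave j x)"
  have step: "(deriv01 l (\<lambda>x. c * wave j x) has_vector_derivative c * (- freq j) ^ Suc l * wave j x) (at x within {0..1})"
    if P: "\<And>x. x \<in> {0..1} \<Longrightarrow> P l x" and x: "x \<in> {0..1}" for l x
  proof -
    have "((\<lambda>x. c * (- freq j) ^ l * wave j x) has_vector_derivative c * (- freq j) ^ l * (- freq j * wave j x)) (at x within {0..1})"
      by (rule has_vector_derivative_mult_right[OF wave_has_vector_derivative])
    moreover have "c * (- freq j) ^ l * (- freq j * wave j x) = c * (- freq j) ^ Suc l * wave j x"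
      by (simp only: power_Suc mult_ac)
    ultimately have "((\<lambda>x. c * (- freq j) ^ l * wave j x) has_vector_derivative c * (- freq j) ^ Suc l * wave j x) (at x within {0..1})"
      by (simp only:)
    then show ?thesis
      by (rule has_vector_derivative_transform[OF x, rotated]) (use P in \<open>simp add: P_def\<close>)
  qed
  have P: "P l x" if "x \<in> {0..1}" for l x
    using that
  proof (induction l arbitrary: x)
    case (Suc l)
    have "(deriv01 l (\<lambda>x. c * wave j x) has_vector_derivative c * (- freq j) ^ Suc l * wave j x) (at x within {0..1})"
      by (rule step[OF Suc.IH Suc.prems])
    then show ?case
      unfolding P_def deriv01.simps
      using Suc.prems by (intro vector_derivative_within_closed_interval) auto
  qed (simp add: P_def)
  show "deriv01 l (\<lambda>x. c * wave j x) x = c * (- freq j) ^ l * wave j x"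
    using P[OF assms, of l] by (simp only: P_def)
  show "(deriv01 l (\<lambda>x. c * wave j x) has_vector_derivative c * (- freq j) ^ Suc l * wave j x) (at x within {0..1})"
    by (rule step[OF P assms])
qed

lemma wave_in_periodic_sobolev:
  assumes "s \<ge> 1"
  shows "(\<lambda>x. c * wave j x) \<in> periodic_sobolev s"
proof -
  define F where "F = (\<lambda>x. c * wave j x)"
  have "has_L2_derivative 0 1 (deriv01 (s - 1) F) (\<lambda>x. c * (- freq j) ^ Suc (s - 1) * wave j x)"
    unfolding F_def by (rule C1_imp_has_L2_derivative[OF has_vector_derivative_deriv01_wave]) (auto intro!: continuous_intros)
  then have "absolutely_continuous_on 0 1 (deriv01 (s - 1) F)" by (simp add: has_L2_derivative_def)
  moreover have "deriv01 l F differentiable (at x within {0..1})" if "x \<in> {0..1}" for l x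
    unfolding F_def using has_vector_derivative_deriv01_wave[OF that] differentiableI_vector by blast
  moreover have "square_integrable01 (deriv01 s F)"
  proof -
    have "continuous_on {0..1} (deriv01 s F)"
    proof (rule continuous_on_eq)
      show "continuous_on {0..1} (\<lambda>x. c * (- freq j) ^ s * wave j x)" by (intro continuous_intros)
    qed (simp add: F_def deriv01_wave)
    then show ?thesis using L2_on_continuous unfolding square_integrable01_def L2_on_def by blast
  qed
  moreover have "deriv01 l F 0 = deriv01 l F 1" for l
    unfolding F_def by (simp add: deriv01_wave)
  ultimately show ?thesis
    unfolding periodic_sobolev_def sobolev_def F_def by blast
qed

lemma sobolev_norm_wave:
  assumes "s \<ge> 1"
  shows "(sobolev_norm s (\<lambda>x. c * wave j x))\<^sup>2 = (cmod c)\<^sup>2 * (if j = 0 then 1 else cmod (freq j) ^ (2 * s))"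
proof -
  define F where "F = (\<lambda>x. c * wave j x)"
  have F: "F \<in> sobolev s" using wave_in_periodic_sobolev[OF assms] by (simp add: F_def periodic_sobolev_def)
  have int: "integral {0..1} (deriv01 l F) = c * (- freq j) ^ l * (if j = 0 then 1 else 0)" for l
  proof -
    have "integral {0..1} (deriv01 l F) = integral {0..1} (\<lambda>x. c * (- freq j) ^ l * wave j x)"
      by (rule integral_cong) (simp add: F_def deriv01_wave)
    also have "\<dots> = c * (- freq j) ^ l * (if j = 0 then 1 else 0)"
      by (intro integral_unique has_integral_mult_right has_integral_wave)
    finally show ?thesis .
  qed
  have "L2_norm_on 0 1 (deriv01 s F) = L2_norm_on 0 1 (\<lambda>x. \<Sum>j\<in>{j}. c * (- freq j) ^ s * wave j x)"
    unfolding L2_norm_on_def by (intro arg_cong[where f = sqrt] integral_cong) (simp add: F_def deriv01_wave)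
  also have "\<dots> = sqrt (\<Sum>j\<in>{j}. (cmod (c * (- freq j) ^ s))\<^sup>2)"
    by (rule L2_norm_wave_sum) simp
  finally have L2: "(L2_norm_on 0 1 (deriv01 s F))\<^sup>2 = (cmod c)\<^sup>2 * cmod (freq j) ^ (2 * s)"
    by (simp add: norm_mult norm_power power_mult_distrib mult.commute flip: power_mult)
  have "(\<Sum>l<s. (cmod (integral {0..1} (deriv01 l F)))\<^sup>2) = (if j = 0 then (cmod c)\<^sup>2 else 0)"
  proof (cases "j = 0")
    case True
    then have "(\<Sum>l<s. (cmod (integral {0..1} (deriv01 l F)))\<^sup>2) = (\<Sum>l<s. if l = 0 then (cmod c)\<^sup>2 else 0)"
      unfolding int by (intro sum.cong refl) (simp add: power_0_left)
    with True assms show ?thesis by (simp add: sum.delta)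
  qed (simp add: int)
  then show ?thesis
    using sobolev_norm_sq(1)[OF F assms] L2 assms unfolding F_def by (auto simp: norm_freq)
qed

lemma worst_case_error_ge:
  assumes "f \<in> F" "sobolev_norm s f \<le> 1"
  shows "ennreal (cmod (fourier_integral k f - A f)) \<le> worst_case_error F s k A"
  unfolding worst_case_error_def by (rule SUP_upper) (use assms in simp)

text \<open>
  The test function is \<open>wave (- k)\<close>, scaled to norm 1.
\<close>

lemma min_error_0_ge:
  fixes k :: int
  assumes "s \<ge> 1"
  shows "min_error 0 k s \<ge> ennreal (if k = 0 then 1 else 1 / (2 * pi * real_of_int \<bar>k\<bar>) ^ s)"
proof -
  define c where "c = (if k = 0 then 1 else 1 / (2 * pi * real_of_int \<bar>k\<bar>) ^ s)"
  define F where "F = (\<lambda>x. complex_of_real c * wave (- k) x)"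
  have c: "c \<ge> 0" by (simp add: c_def)
  have F: "F \<in> sobolev s"
    using wave_in_periodic_sobolev[OF assms] by (simp add: F_def periodic_sobolev_def)
  have "(sobolev_norm s F)\<^sup>2 = 1"
    unfolding F_def sobolev_norm_wave[OF assms] by (simp add: c_def norm_freq power_divide mult.commute flip: power_mult)
  then have "sobolev_norm s F \<le> 1"
    by (metis order_refl power2_le_imp_le power_one zero_le_one)
  moreover have "fourier_integral k F = c"
  proof -
    have "fourier_integral k F = integral {0..1} (\<lambda>x. F x * wave k x)"
      by (intro fourier_integral_eq_integral L2_on_continuous) (auto simp: F_def intro!: continuous_intros)
    also have "\<dots> = integral {0..1} (\<lambda>x. complex_of_real c * wave 0 x)"
      by (rule integral_cong) (simp add: F_def wave_add[symmetric] mult.assoc)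
    also have "\<dots> = c"
      using has_integral_mult_right[OF has_integral_wave[of 0], of "complex_of_real c"] by (simp add: integral_unique)
    finally show ?thesis .
  qed
  ultimately have "ennreal c \<le> worst_case_error (sobolev s) s k (\<lambda>f. 0)"
    using worst_case_error_ge[OF F, of s k "\<lambda>f. 0"] c by simp
  then show ?thesis unfolding min_error_def algorithms_0 c_def by simp
qed

lemma min_error_periodic_le_min_error: "min_error_periodic n k s \<le> min_error n k s"
  unfolding min_error_def min_error_periodic_def worst_case_error_def
  by (intro INF_mono' SUP_subset_mono) (auto simp: periodic_sobolev_def)

text \<open>
  On periodic functions the boundary terms vanish, so that the zero algorithm has at most this error.
\<close>

lemma min_error_periodic_le:
  fixes k :: int
  assumes "s \<ge> 1" "k \<noteq> 0"
  shows "min_error_periodic n k s \<le> ennreal ((1 / (2 * pi * real_of_int \<bar>k\<bar>)) ^ s)"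
  unfolding min_error_periodic_def worst_case_error_def
proof (rule INF_lower2[OF zero_in_algorithms[OF assms(1)]], rule SUP_least, rule ennreal_leI)
  fix f assume "f \<in> {f \<in> periodic_sobolev s. sobolev_norm s f \<le> 1}"
  then have f: "f \<in> sobolev s" "\<And>l. l < s \<Longrightarrow> deriv01 l f 0 = deriv01 l f 1" "sobolev_norm s f \<le> 1"
    by (auto simp: periodic_sobolev_def)
  have "fourier_integral k f = fourier_integral k (deriv01 s f) / freq k ^ s"
    using fourier_integral_sobolev[OF f(1) assms(2) order_refl] f(2) by simp
  moreover have "cmod (fourier_integral k (deriv01 s f)) \<le> L2_norm_on 0 1 (deriv01 s f)"
    using fourier_sum_le_L2_norm[OF L2_on_deriv01[OF f(1)], of "{k}" "\<lambda>_. 1"] by simp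
  moreover have "L2_norm_on 0 1 (deriv01 s f) \<le> 1"
    using L2_norm_deriv_le_sobolev_norm[OF f(1) assms(1)] f(3) by simp
  ultimately show "cmod (fourier_integral k f - 0) \<le> (1 / (2 * pi * real_of_int \<bar>k\<bar>)) ^ s"
    by (simp add: norm_divide norm_power norm_freq power_one_over divide_right_mono)
qed

text \<open>
  For a single node and \<open>|k| \<rightarrow> \<infinity>\<close> the assumed lower bound is squeezed by the error of the zero algorithm.
\<close>

lemma lower_constant_bound:
  fixes c :: real
  assumes s: "s \<ge> 1"
    and c_bound: "\<And>(k::int) (n::nat). n \<ge> 1 \<Longrightarrow>
      ennreal (c / (real n + real_of_int \<bar>k\<bar>) ^ s) \<le> min_error_periodic n k s"
  shows "c \<le> (1 / (2 * pi)) ^ s"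
proof (rule LIMSEQ_le_const)
  have "(\<lambda>m. (1 / real (Suc m) + 1) * (1 / (2 * pi))) \<longlonglongrightarrow> (0 + 1) * (1 / (2 * pi))"
    by (intro tendsto_intros LIMSEQ_Suc[OF lim_1_over_n])
  from tendsto_power[OF this, of s]
  show "(\<lambda>m. ((1 / real (Suc m) + 1) * (1 / (2 * pi))) ^ s) \<longlonglongrightarrow> (1 / (2 * pi)) ^ s" by simp
  have "c \<le> ((1 / real (Suc m) + 1) * (1 / (2 * pi))) ^ s" for m
  proof -
    have "ennreal (c / (1 + real (Suc m)) ^ s) \<le> ennreal ((1 / (2 * pi * real (Suc m))) ^ s)"
      using order_trans[OF c_bound[of 1 "int (Suc m)"] min_error_periodic_le[OF s, of "int (Suc m)" 1]] by simp
    then have "c / (1 + real (Suc m)) ^ s \<le> (1 / (2 * pi * real (Suc m))) ^ s"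
      by (subst (asm) ennreal_le_iff) auto
    then have "c \<le> (1 / (2 * pi * real (Suc m))) ^ s * (1 + real (Suc m)) ^ s"
      by (simp add: pos_divide_le_eq del: of_nat_Suc)
    also have "\<dots> = ((1 / real (Suc m) + 1) * (1 / (2 * pi))) ^ s"
      by (simp add: power_mult_distrib[symmetric] field_simps)
    finally show ?thesis .
  qed
  then show "\<exists>N. \<forall>m\<ge>N. c \<le> ((1 / real (Suc m) + 1) * (1 / (2 * pi))) ^ s" by blast
qed

section \<open>Information complexity\<close>

lemma info_complexity_ge:
  assumes "\<And>n. min_error n k s \<le> ennreal \<epsilon> \<Longrightarrow> B \<le> real n"
  shows "ereal B \<le> ereal_of_enat (info_complexity \<epsilon> k s)"
proof (cases "{n. min_error n k s \<le> ennreal \<epsilon>} = {}")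
  case True
  then show ?thesis by (simp add: info_complexity_def top_enat_def)
next
  case False
  then have "info_complexity \<epsilon> k s \<in> enat ` {n. min_error n k s \<le> ennreal \<epsilon>}"
    unfolding info_complexity_def Inf_enat_def by (auto intro: LeastI)
  then show ?thesis using assms by auto
qed

lemma info_complexity_le:
  assumes "min_error n k s \<le> ennreal \<epsilon>"
  shows "ereal_of_enat (info_complexity \<epsilon> k s) \<le> ereal (real n)"
proof -
  have "info_complexity \<epsilon> k s \<le> enat n"
    unfolding info_complexity_def by (rule INF_lower) (use assms in simp)
  then have "ereal_of_enat (info_complexity \<epsilon> k s) \<le> ereal_of_enat (enat n)"
    by (simp only: ereal_of_enat_le_iff)
  then show ?thesis by simp
qed

lemma root_bound:
  assumes "s \<ge> 1" "c > 0" "\<epsilon> > 0" "x \<ge> 0" "c / \<epsilon> \<le> x ^ s"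
  shows "c powr (1 / real s) * (1 / \<epsilon>) powr (1 / real s) \<le> (x::real)"
proof -
  have "c powr (1 / real s) * (1 / \<epsilon>) powr (1 / real s) = (c / \<epsilon>) powr (1 / real s)"
    using assms by (simp add: powr_mult[symmetric])
  also have "\<dots> \<le> (x ^ s) powr (1 / real s)"
    using assms by (intro powr_mono2) auto
  also have "\<dots> = x"
  proof (cases "x = 0")
    case False
    with assms have "x > 0" by simp
    then have "x ^ s = x powr real s" by (simp add: powr_realpow)
    with \<open>x > 0\<close> assms(1) show ?thesis by (simp add: powr_powr)
  qed (use assms(1) in simp)
  finally show ?thesis .
qed

text \<open>
  For \<open>n \<ge> 1\<close> this is the assumed lower bound, since passing to periodic functions does not increase the error.
  The assumption says nothing about \<open>n = 0\<close>. There, if \<open>k \<noteq> 0\<close>, the bound \<open>c \<le> (1 / (2 \<pi>))\<^sup>s\<close> on the constant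
  and a single wave as test function serve instead, and if \<open>k = 0\<close>, the constant function 1 shows that
  \<open>n = 0\<close> does not suffice.
\<close>

lemma info_complexity_lower:
  fixes k :: int and c :: real
  assumes s: "s \<ge> 1" and c_pos: "c > 0"
    and c_bound: "\<And>(k::int) (n::nat). n \<ge> 1 \<Longrightarrow>
      ennreal (c / (real n + real_of_int \<bar>k\<bar>) ^ s) \<le> min_error_periodic n k s"
    and \<epsilon>: "\<epsilon> > 0" "k = 0 \<Longrightarrow> \<epsilon> < 1"
  shows "ereal (c powr (1 / real s) * (1 / \<epsilon>) powr (1 / real s) - real_of_int \<bar>k\<bar>)
          \<le> ereal_of_enat (info_complexity \<epsilon> k s)"
proof (rule info_complexity_ge)
  fix n assume n: "min_error n k s \<le> ennreal \<epsilon>"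
  define x where "x = real n + real_of_int \<bar>k\<bar>"
  have "x > 0 \<and> c / x ^ s \<le> \<epsilon>"
  proof (cases "n = 0")
    case False
    then have x: "x > 0" by (simp add: x_def add_pos_nonneg)
    have "ennreal (c / x ^ s) \<le> ennreal \<epsilon>"
      unfolding x_def
      by (rule order_trans[OF c_bound order_trans[OF min_error_periodic_le_min_error n]]) (use False in simp)
    then show ?thesis using x \<epsilon> by (simp add: ennreal_le_iff)
  next
    case True
    have ge: "ennreal (if k = 0 then 1 else 1 / (2 * pi * real_of_int \<bar>k\<bar>) ^ s) \<le> ennreal \<epsilon>"
      using order_trans[OF min_error_0_ge[OF s]] n True by blast
    then have ge': "(if k = 0 then 1 else 1 / (2 * pi * real_of_int \<bar>k\<bar>) ^ s) \<le> \<epsilon>"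
      using \<epsilon> by (subst (asm) ennreal_le_iff) auto
    then have "k \<noteq> 0" using \<epsilon>(2) by auto
    then have x: "x > 0" using True by (simp add: x_def)
    have "c / x ^ s \<le> (1 / (2 * pi)) ^ s / x ^ s"
      using lower_constant_bound[OF s c_bound] x by (intro divide_right_mono) auto
    also have "\<dots> = 1 / (2 * pi * real_of_int \<bar>k\<bar>) ^ s"
      using True by (simp add: x_def power_mult_distrib power_divide)
    also have "\<dots> \<le> \<epsilon>" using ge' \<open>k \<noteq> 0\<close> by simp
    finally show ?thesis using x by simp
  qed
  then have x: "x > 0" "c / x ^ s \<le> \<epsilon>" by blast+
  have "c \<le> \<epsilon> * x ^ s"
    using mult_right_mono[OF x(2), of "x ^ s"] x(1) by simp
  then have "c / \<epsilon> \<le> x ^ s" using \<epsilon>(1) by (simp add: pos_divide_le_eq mult.commute)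
  then have "c powr (1 / real s) * (1 / \<epsilon>) powr (1 / real s) \<le> x"
    using s c_pos \<epsilon> by (intro root_bound) (auto simp: x_def)
  then show "c powr (1 / real s) * (1 / \<epsilon>) powr (1 / real s) - real_of_int \<bar>k\<bar> \<le> real n"
    by (simp add: x_def)
qed

lemma info_complexity_upper:
  fixes k :: int
  assumes s: "s \<ge> 1" and \<epsilon>: "\<epsilon> > 0" and M: "M \<ge> 1"
    and le: "\<lceil>3 / (2 * pi) * (2 / \<epsilon>) powr (1 / real s)\<rceil> \<le> int M + \<bar>k\<bar>"
  shows "ereal_of_enat (info_complexity \<epsilon> k s) \<le> ereal (real (M - 1 + 2 * s))"
proof (rule info_complexity_le)
  define X where "X = (2 / \<epsilon>) powr (1 / real s)"
  define y where "y = real M + real_of_int \<bar>k\<bar>"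
  have X: "X > 0" using \<epsilon> by (simp add: X_def)
  have y: "y > 0" using M by (simp add: y_def add_pos_nonneg)
  have "3 / (2 * pi) * X \<le> y"
    using le unfolding X_def[symmetric] y_def by (simp add: ceiling_le_iff)
  then have "3 / (2 * pi * y) \<le> 1 / X" using X y by (simp add: field_simps)
  then have "(3 / (2 * pi * y)) ^ s \<le> (1 / X) ^ s" using y by (intro power_mono) auto
  also have "(1 / X) ^ s = \<epsilon> / 2"
  proof -
    have "X ^ s = X powr real s" using X by (simp add: powr_realpow)
    also have "\<dots> = 2 / \<epsilon>" using s \<epsilon> by (simp add: X_def powr_powr)
    finally show ?thesis by (simp add: power_divide)
  qed
  finally have "2 * (3 / (2 * pi * y)) ^ s \<le> \<epsilon>" by simp
  then have "ennreal (2 * (3 / (2 * pi * y)) ^ s) \<le> ennreal \<epsilon>" by (rule ennreal_leI)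
  with min_error_upper[OF s M, of k] show "min_error (M - 1 + 2 * s) k s \<le> ennreal \<epsilon>"
    unfolding y_def by (rule order_trans)
qed

theorem corollary16:
  fixes s :: nat and c :: real
  assumes s: "s \<ge> 1"
    and c_pos: "c > 0"
    and c_bound: "\<And>(k::int) (n::nat). n \<ge> 1 \<Longrightarrow>
      ennreal (c / (real n + real_of_int \<bar>k\<bar>) ^ s) \<le> min_error_periodic n k s"
  shows
    "(\<forall>\<epsilon>::real. 0 < \<epsilon> \<and> \<epsilon> < 1 \<longrightarrow>
        ereal (c powr (1 / real s) * (1 / \<epsilon>) powr (1 / real s))
          \<le> ereal_of_enat (info_complexity \<epsilon> 0 s) \<and>
        ereal_of_enat (info_complexity \<epsilon> 0 s)
          \<le> ereal (real_of_int (\<lceil>3 / (2 * pi) * (2 / \<epsilon>) powr (1 / real s)\<rceil> + 2 * int s - 1))) \<and>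
     (\<forall>k::int. k \<noteq> 0 \<longrightarrow>
        (\<forall>\<epsilon>::real. beta k s / (2 * pi * real_of_int \<bar>k\<bar>) \<le> \<epsilon> \<and> \<epsilon> < 1 \<longrightarrow>
           info_complexity \<epsilon> k s = 0) \<and>
        (\<forall>\<epsilon>::real. 0 < \<epsilon> \<and> \<epsilon> < beta k s / (2 * pi * real_of_int \<bar>k\<bar>) \<longrightarrow>
           ereal (c powr (1 / real s) * (1 / \<epsilon>) powr (1 / real s) - real_of_int \<bar>k\<bar>)
             \<le> ereal_of_enat (info_complexity \<epsilon> k s) \<and>
           ereal_of_enat (info_complexity \<epsilon> k s)
             \<le> ereal (real_of_int
                  (2 * int s +
                   max 0 (\<lceil>3 / (2 * pi) * (2 / \<epsilon>) powr (1 / real s)\<rceil> - 1 - \<bar>k\<bar>)))))"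
proof (intro conjI allI impI)
  fix \<epsilon> :: real assume "0 < \<epsilon> \<and> \<epsilon> < 1"
  then have \<epsilon>: "0 < \<epsilon>" "\<epsilon> < 1" by blast+
  show "ereal (c powr (1 / real s) * (1 / \<epsilon>) powr (1 / real s)) \<le> ereal_of_enat (info_complexity \<epsilon> 0 s)"
    using info_complexity_lower[OF s c_pos c_bound \<epsilon>(1), of 0] \<epsilon>(2) by simp
  define m where "m = \<lceil>3 / (2 * pi) * (2 / \<epsilon>) powr (1 / real s)\<rceil>"
  have "m \<ge> 1" using \<epsilon> by (simp add: m_def)
  have "\<lceil>3 / (2 * pi) * (2 / \<epsilon>) powr (1 / real s)\<rceil> \<le> int (nat m) + \<bar>0\<bar>"
    unfolding m_def[symmetric] by simp
  then have "ereal_of_enat (info_complexity \<epsilon> 0 s) \<le> ereal (real (nat m - 1 + 2 * s))"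
    using \<open>m \<ge> 1\<close> by (intro info_complexity_upper[OF s \<epsilon>(1)]) auto
  moreover have "real (nat m - 1 + 2 * s) = real_of_int (m + 2 * int s - 1)"
    using \<open>m \<ge> 1\<close> by (simp add: of_nat_diff)
  ultimately show "ereal_of_enat (info_complexity \<epsilon> 0 s)
          \<le> ereal (real_of_int (\<lceil>3 / (2 * pi) * (2 / \<epsilon>) powr (1 / real s)\<rceil> + 2 * int s - 1))"
    unfolding m_def[symmetric] by (simp only:)
next
  fix k :: int and \<epsilon> :: real
  assume k: "k \<noteq> 0" and "beta k s / (2 * pi * real_of_int \<bar>k\<bar>) \<le> \<epsilon> \<and> \<epsilon> < 1"
  then have \<epsilon>: "beta k s / (2 * pi * real_of_int \<bar>k\<bar>) \<le> \<epsilon>" by blast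
  have "min_error 0 k s \<le> ennreal \<epsilon>"
    using min_error_0_le_beta[OF s k] ennreal_leI[OF \<epsilon>] by (rule order_trans)
  then have "info_complexity \<epsilon> k s \<le> enat 0"
    unfolding info_complexity_def by (intro INF_lower) simp
  then show "info_complexity \<epsilon> k s = 0" by (simp add: enat_0)
next
  fix k :: int and \<epsilon> :: real
  assume k: "k \<noteq> 0" and "0 < \<epsilon> \<and> \<epsilon> < beta k s / (2 * pi * real_of_int \<bar>k\<bar>)"
  then have \<epsilon>: "0 < \<epsilon>" by blast
  show "ereal (c powr (1 / real s) * (1 / \<epsilon>) powr (1 / real s) - real_of_int \<bar>k\<bar>)
             \<le> ereal_of_enat (info_complexity \<epsilon> k s)"
    by (rule info_complexity_lower[OF s c_pos c_bound \<epsilon>]) (use k in blast)+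
  define m where "m = \<lceil>3 / (2 * pi) * (2 / \<epsilon>) powr (1 / real s)\<rceil>"
  \<comment> \<open>At least one panel: for \<open>m \<le> |k|\<close> the \<open>2 s\<close> end point values suffice.\<close>
  define M where "M = nat (max 1 (m - \<bar>k\<bar>))"
  have M: "M \<ge> 1" "int M = max 1 (m - \<bar>k\<bar>)" by (auto simp: M_def)
  have "\<lceil>3 / (2 * pi) * (2 / \<epsilon>) powr (1 / real s)\<rceil> \<le> int M + \<bar>k\<bar>"
    unfolding m_def[symmetric] M(2) by simp
  then have "ereal_of_enat (info_complexity \<epsilon> k s) \<le> ereal (real (M - 1 + 2 * s))"
    using M(1) by (intro info_complexity_upper[OF s \<epsilon>])
  moreover have "real (M - 1 + 2 * s) = real_of_int (2 * int s + max 0 (m - 1 - \<bar>k\<bar>))"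
  proof -
    have "int (M - 1 + 2 * s) = 2 * int s + max 0 (m - 1 - \<bar>k\<bar>)"
      using M by (simp add: of_nat_diff max_def)
    then show ?thesis by (metis of_int_of_nat_eq)
  qed
  ultimately show "ereal_of_enat (info_complexity \<epsilon> k s)
             \<le> ereal (real_of_int (2 * int s +
                   max 0 (\<lceil>3 / (2 * pi) * (2 / \<epsilon>) powr (1 / real s)\<rceil> - 1 - \<bar>k\<bar>)))"
    unfolding m_def[symmetric] by (simp only:)
qed

end
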